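(* Let $G$ be a periodic graph with countable discrete group $\Gamma\le\mathrm{Aut}\,G$. Let $\mathbf{d}_1,\mathbf{d}_2:\ell^2(R(G))\to\ell^2(V(G))$ be bounded operators commuting with the actions of $\Gamma$ and satisfying $\mathbf{d}_i\mathbf{d}_i^*=\mathbf{I}_V$ $(i=1,2)$. Let $a_2,b_2\in\mathbb{C}$, $c_2=a_2-b_2$, and $$\mathbf{C}_1=\mathbf{d}_1^*\mathbf{d}_1-(\mathbf{I}_R-\mathbf{d}_1^*\mathbf{d}_1),\qquad \mathbf{C}_2=a_2\mathbf{d}_2^*\mathbf{d}_2+b_2(\mathbf{I}_R-\mathbf{d}_2^*\mathbf{d}_2),\qquad \mathbf{U}=\mathbf{C}_1\mathbf{C}_2$$ (so $\mathbf{C}_1^2=\mathbf{I}_R$). Then, for complex $u$ with $|u|$ sufficiently small, $$\det{}_\Gamma(\mathbf{I}_R-u\mathbf{U})=(1+b_2u)^{\mathrm{Tr}_\Gamma(\mathbf{I}_R)-2\mathrm{Tr}_\Gamma(\mathbf{I}_V)}\det{}_\Gamma\big((1+a_2u)(1-b_2u)\mathbf{I}_V-2c_2u\,\mathbf{d}_2\mathbf{d}_1^*\mathbf{d}_1\mathbf{d}_2^*\big),$$ where $\mathrm{Tr}_\Gamma(\mathbf{I}_R)=\sum_{e\in\mathcal{F}_1}\frac{1}{|\Gamma_e|}$ and $\mathrm{Tr}_\Gamma(\mathbf{I}_V)=\sum_{v\in\mathcal{F}_0}\frac{1}{|\Gamma_v|}$.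
   Context: A periodic graph is a countable simple graph $G$ with bounded degree ($\sup_v\deg v<\infty$), with arc set $R(G)=\{(u,v),(v,u)\mid uv\in E(G)\}$, together with a countable discrete subgroup $\Gamma$ of automorphisms of $G$ acting (1) without inversions ($\gamma(e)\ne e^{-1}$ for all $\gamma\in\Gamma$, $e\in R(G)$, where $(u,v)^{-1}=(v,u)$), (2) discretely (each stabilizer $\Gamma_v=\{\gamma:\gamma v=v\}$ is finite), and (3) with bounded covolume ($\sum_{v\in\mathcal{F}_0}1/|\Gamma_v|<\infty$), where $\mathcal{F}_0\subset V(G)$ (resp. $\mathcal{F}_1\subset R(G)$) contains exactly one representative of each $\Gamma$-orbit of vertices (resp. arcs), and $\Gamma_e$ is the stabilizer of the arc $e$. $\mathbf{I}_V,\mathbf{I}_R$ are the identities of $\ell^2(V(G))$, $\ell^2(R(G))$. $\Gamma$ acts on these spaces by $(\lambda_0(\gamma)f)(x)=f(\gamma^{-1}x)$ and $(\lambda_1(\gamma)\omega)(e)=\omega(\gamma^{-1}e)$. $\mathcal{N}_0(G,\Gamma)$ (resp. $\mathcal{N}_1(G,\Gamma)$) is the von Neumann algebra of bounded operators on $\ell^2(V(G))$ (resp. $\ell^2(R(G))$) commuting with all $\lambda_0(\gamma)$ (resp. $\lambda_1(\gamma)$), with finite trace $\mathrm{Tr}_\Gamma(A)=\sum_{x\in\mathcal{F}_0}\frac{1}{|\Gamma_x|}A(x,x)$ (resp. $\sum_{e\in\mathcal{F}_1}\frac{1}{|\Gamma_e|}A(e,e)$), where $A(x,y)$ are the matrix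 entries of $A$. For $A$ in such an algebra with trace $\tau=\mathrm{Tr}_\Gamma$, $\det_\Gamma(A)=\exp\big(\tau(\log A)\big)$ with $\log A=\frac{1}{2\pi i}\int_\Lambda\log\lambda\,(\lambda-A)^{-1}\,d\lambda$, where $\Lambda$ is the boundary of a connected, simply connected region containing $\sigma(A)$ and not containing $0$ (on which a branch of $\log$ is chosen). *)

theory Defs
  imports "HOL-Complex_Analysis.Complex_Analysis" "HOL-Combinatorics.Permutations"
begin

section \<open>Square-summable functions\<close>

typedef 'a ell2 = "{f :: 'a \<Rightarrow> complex. (\<lambda>x. (cmod (f x))\<^sup>2) summable_on UNIV}"
  morphisms coeff Abs_ell2
  by (rule exI[of _ "\<lambda>_. 0"]) simp

lemma coeff_summable: "(\<lambda>x. (cmod (coeff f x))\<^sup>2) summable_on S"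
  using coeff[of f] summable_on_subset_banach[of _ UNIV S] by blast

lemma ell2_eqI: "(\<And>x. coeff f x = coeff g x) \<Longrightarrow> f = g"
  using coeff_inject by blast

lemma coeff_Abs: "(\<lambda>x. (cmod (f x))\<^sup>2) summable_on UNIV \<Longrightarrow> coeff (Abs_ell2 f) = f"
  by (rule Abs_ell2_inverse) simp

lemma sq_summable_add:
  fixes f g :: "'a \<Rightarrow> complex"
  assumes "(\<lambda>x. (cmod (f x))\<^sup>2) summable_on S" "(\<lambda>x. (cmod (g x))\<^sup>2) summable_on S"
  shows "(\<lambda>x. (cmod (f x + g x))\<^sup>2) summable_on S"
proof (rule summable_on_comparison_test)
  show "(\<lambda>x. 2 * (cmod (f x))\<^sup>2 + 2 * (cmod (g x))\<^sup>2) summable_on S"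
    using assms by (intro summable_on_add summable_on_cmult_right)
  fix x
  have "(cmod (f x + g x))\<^sup>2 \<le> (cmod (f x) + cmod (g x))\<^sup>2"
    by (intro power_mono norm_triangle_ineq) simp
  also have "\<dots> \<le> 2 * (cmod (f x))\<^sup>2 + 2 * (cmod (g x))\<^sup>2"
    using sum_squares_bound[of "cmod (f x)" "cmod (g x)"] by (simp add: power2_sum)
  finally show "(cmod (f x + g x))\<^sup>2 \<le> 2 * (cmod (f x))\<^sup>2 + 2 * (cmod (g x))\<^sup>2" .
qed simp

lemma sq_summable_scale:
  fixes f :: "'a \<Rightarrow> complex"
  assumes "(\<lambda>x. (cmod (f x))\<^sup>2) summable_on S"
  shows "(\<lambda>x. (cmod (c * f x))\<^sup>2) summable_on S"
  using summable_on_cmult_right[OF assms, of "(cmod c)\<^sup>2"] by (simp add: norm_mult power_mult_distrib)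

definition cinner :: "'a ell2 \<Rightarrow> 'a ell2 \<Rightarrow> complex" where
  "cinner f g = (\<Sum>\<^sub>\<infinity>x. cnj (coeff f x) * coeff g x)"

definition scaleC :: "complex \<Rightarrow> 'a ell2 \<Rightarrow> 'a ell2"  (infixr "*\<^sub>C" 75) where
  "c *\<^sub>C f = Abs_ell2 (\<lambda>x. c * coeff f x)"

lemma coeff_scaleC [simp]: "coeff (c *\<^sub>C f) x = c * coeff f x"
  unfolding scaleC_def by (simp add: coeff_Abs sq_summable_scale coeff_summable)

lemma cinner_summable: "(\<lambda>x. cnj (coeff f x) * coeff g x) summable_on UNIV"
proof -
  have "(\<lambda>x. norm (cnj (coeff f x) * coeff g x)) summable_on UNIV"
  proof (rule summable_on_comparison_test)
    show "(\<lambda>x. (cmod (coeff f x))\<^sup>2 + (cmod (coeff g x))\<^sup>2) summable_on UNIV"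
      by (rule summable_on_add[OF coeff_summable coeff_summable])
    fix x
    have "cmod (coeff f x) * cmod (coeff g x) \<le> 2 * cmod (coeff f x) * cmod (coeff g x)" by simp
    also have "\<dots> \<le> (cmod (coeff f x))\<^sup>2 + (cmod (coeff g x))\<^sup>2" by (rule sum_squares_bound)
    finally have "cmod (coeff f x) * cmod (coeff g x) \<le> (cmod (coeff f x))\<^sup>2 + (cmod (coeff g x))\<^sup>2" .
    then show "norm (cnj (coeff f x) * coeff g x) \<le> (cmod (coeff f x))\<^sup>2 + (cmod (coeff g x))\<^sup>2"
      by (simp add: norm_mult)
  qed simp
  then show ?thesis by (rule abs_summable_summable)
qed

instantiation ell2 :: (type) real_inner
begin

definition zero_ell2 :: "'a ell2" where "zero_ell2 = Abs_ell2 (\<lambda>_. 0)"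
definition plus_ell2 :: "'a ell2 \<Rightarrow> 'a ell2 \<Rightarrow> 'a ell2" where
  "plus_ell2 f g = Abs_ell2 (\<lambda>x. coeff f x + coeff g x)"
definition uminus_ell2 :: "'a ell2 \<Rightarrow> 'a ell2" where "uminus_ell2 f = (-1) *\<^sub>C f"
definition minus_ell2 :: "'a ell2 \<Rightarrow> 'a ell2 \<Rightarrow> 'a ell2" where
  "minus_ell2 f g = f + (- g)"
definition scaleR_ell2 :: "real \<Rightarrow> 'a ell2 \<Rightarrow> 'a ell2" where
  "scaleR_ell2 r f = of_real r *\<^sub>C f"
definition inner_ell2 :: "'a ell2 \<Rightarrow> 'a ell2 \<Rightarrow> real" where
  "inner_ell2 f g = Re (cinner f g)"
definition norm_ell2 :: "'a ell2 \<Rightarrow> real" where "norm_ell2 f = sqrt (inner f f)"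
definition sgn_ell2 :: "'a ell2 \<Rightarrow> 'a ell2" where "sgn_ell2 f = scaleR (inverse (norm f)) f"
definition dist_ell2 :: "'a ell2 \<Rightarrow> 'a ell2 \<Rightarrow> real" where "dist_ell2 f g = norm (f - g)"
definition uniformity_ell2 :: "('a ell2 \<times> 'a ell2) filter" where
  "uniformity_ell2 = (INF e\<in>{0<..}. principal {(x, y). dist x y < e})"
definition open_ell2 :: "'a ell2 set \<Rightarrow> bool" where
  "open_ell2 S = (\<forall>x\<in>S. \<forall>\<^sub>F (x', y) in uniformity. x' = x \<longrightarrow> y \<in> S)"

lemma coeff_zero': "coeff (0 :: 'a ell2) x = 0"
  unfolding zero_ell2_def by (simp add: coeff_Abs)

lemma coeff_add': "coeff (f + g :: 'a ell2) x = coeff f x + coeff g x"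
  unfolding plus_ell2_def by (simp add: coeff_Abs sq_summable_add coeff_summable)

lemma coeff_uminus': "coeff (- f :: 'a ell2) x = - coeff f x"
  unfolding uminus_ell2_def by simp

lemma inner_ell2_eq: "inner f g = (\<Sum>\<^sub>\<infinity>x. Re (cnj (coeff f x) * coeff g x))" for f g :: "'a ell2"
  unfolding inner_ell2_def cinner_def by (rule infsum_Re[symmetric, OF cinner_summable])

lemma inner_ell2_self: "inner f f = (\<Sum>\<^sub>\<infinity>x. (cmod (coeff f x))\<^sup>2)" for f :: "'a ell2"
  unfolding inner_ell2_eq by (rule infsum_cong) (simp only: cmod_power2, simp add: power2_eq_square)

instance
proof
  fix f g h :: "'a ell2" and r s :: real
  note c = coeff_zero' coeff_add' coeff_uminus' scaleR_ell2_def minus_ell2_def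
  show "f + g + h = f + (g + h)" "f + g = g + f" "0 + f = f" "- f + f = 0" "f - g = f + - g"
    "r *\<^sub>R (f + g) = r *\<^sub>R f + r *\<^sub>R g" "(r + s) *\<^sub>R f = r *\<^sub>R f + s *\<^sub>R f"
    "r *\<^sub>R s *\<^sub>R f = (r * s) *\<^sub>R f" "1 *\<^sub>R f = f"
    by (auto intro!: ell2_eqI simp: c algebra_simps)
  show "dist f g = norm (f - g)" by (rule dist_ell2_def)
  show "sgn f = scaleR (inverse (norm f)) f" by (rule sgn_ell2_def)
  show "(uniformity :: ('a ell2 \<times> 'a ell2) filter)
      = (INF e\<in>{0<..}. principal {(x, y). dist x y < e})" by (rule uniformity_ell2_def)
  show "open S = (\<forall>x\<in>S. \<forall>\<^sub>F (x', y) in uniformity. x' = x \<longrightarrow> y \<in> S)" for S :: "'a ell2 set"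
    by (rule open_ell2_def)
  show "norm f = sqrt (inner f f)" by (rule norm_ell2_def)
  show "inner f g = inner g f"
    unfolding inner_ell2_eq by (rule infsum_cong) (simp add: algebra_simps)
  show "inner (f + g) h = inner f h + inner g h"
    unfolding inner_ell2_def cinner_def c
    using infsum_add[OF cinner_summable[of f h] cinner_summable[of g h]]
    by (simp add: algebra_simps)
  show "inner (r *\<^sub>R f) g = r * inner f g"
    unfolding inner_ell2_def cinner_def c
    using infsum_cmult_right'[of "of_real r" "\<lambda>x. cnj (coeff f x) * coeff g x" UNIV]
    by (simp add: algebra_simps)
  show "0 \<le> inner f f" unfolding inner_ell2_self by (rule infsum_nonneg) simp
  show "(inner f f = 0) = (f = 0)"
  proof
    assume "inner f f = 0"
    then have "(cmod (coeff f x))\<^sup>2 = 0" for x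
      using nonneg_infsum_le_0D[OF _ coeff_summable[of f UNIV], of x]
      by (simp add: inner_ell2_self)
    then show "f = 0" by (intro ell2_eqI) (simp add: c)
  qed (simp add: inner_ell2_self c)
qed

end

lemma coeff_zero [simp]: "coeff 0 x = 0"
  and coeff_add [simp]: "coeff (f + g) x = coeff f x + coeff g x"
  and coeff_uminus [simp]: "coeff (- f) x = - coeff f x"
  and coeff_diff [simp]: "coeff (f - g) x = coeff f x - coeff g x"
  and coeff_scaleR [simp]: "coeff (r *\<^sub>R f) x = of_real r * coeff f x"
proof -
  show "coeff (f - g) x = coeff f x - coeff g x"
    unfolding minus_ell2_def coeff_add' coeff_uminus' by simp
qed (simp_all only: coeff_zero' coeff_add' coeff_uminus' scaleR_ell2_def coeff_scaleC)

lemma norm_ell2_sq: "(norm f)\<^sup>2 = (\<Sum>\<^sub>\<infinity>x. (cmod (coeff f x))\<^sup>2)"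
  using inner_ell2_self[of f] by (simp add: power2_norm_eq_inner)

lemma sum_coeff_le_norm:
  assumes "finite F"
  shows "(\<Sum>x\<in>F. (cmod (coeff f x))\<^sup>2) \<le> (norm f)\<^sup>2"
  unfolding norm_ell2_sq by (rule finite_sum_le_infsum) (use assms coeff_summable in auto)

lemma coeff_le_norm: "cmod (coeff f x) \<le> norm f"
  by (rule power2_le_imp_le[OF _ norm_ge_zero]) (use sum_coeff_le_norm[of "{x}" f] in simp)

lemma sq_summable_of_bounded:
  fixes f :: "'a \<Rightarrow> complex"
  assumes "\<And>F. finite F \<Longrightarrow> (\<Sum>x\<in>F. (cmod (f x))\<^sup>2) \<le> B\<^sup>2" "0 \<le> B"
  shows "(\<lambda>x. (cmod (f x))\<^sup>2) summable_on UNIV" "norm (Abs_ell2 f) \<le> B"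
proof -
  show s: "(\<lambda>x. (cmod (f x))\<^sup>2) summable_on UNIV"
    by (rule nonneg_bdd_above_summable_on) (use assms in \<open>auto simp: bdd_above_def\<close>)
  have "(norm (Abs_ell2 f))\<^sup>2 \<le> B\<^sup>2"
    unfolding norm_ell2_sq coeff_Abs[OF s] by (rule infsum_le_finite_sums[OF s]) (simp add: assms)
  then show "norm (Abs_ell2 f) \<le> B" using assms(2) by (rule power2_le_imp_le)
qed

instance ell2 :: (type) banach
proof
  fix X :: "nat \<Rightarrow> 'a ell2"
  assume X: "Cauchy X"
  have "Cauchy (\<lambda>n. coeff (X n) x)" for x
  proof (rule metric_CauchyI)
    fix e :: real assume "e > 0"
    then obtain N where "\<forall>m\<ge>N. \<forall>n\<ge>N. dist (X m) (X n) < e" using X unfolding Cauchy_def by blast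
    then show "\<exists>N. \<forall>m\<ge>N. \<forall>n\<ge>N. dist (coeff (X m) x) (coeff (X n) x) < e"
      using coeff_le_norm[of "X m - X n" x for m n]
      by (metis coeff_diff dist_norm le_less_trans)
  qed
  then have "\<forall>x. \<exists>l. (\<lambda>n. coeff (X n) x) \<longlonglongrightarrow> l"
    using Cauchy_convergent_iff convergent_def by blast
  then obtain g where g: "\<And>x. (\<lambda>n. coeff (X n) x) \<longlonglongrightarrow> g x" by metis
  have key: "\<exists>N. \<forall>n\<ge>N. \<forall>F. finite F \<longrightarrow> (\<Sum>x\<in>F. (cmod (g x - coeff (X n) x))\<^sup>2) \<le> e\<^sup>2"
    if "e > 0" for e :: real
  proof -
    obtain N where N: "\<forall>m\<ge>N. \<forall>n\<ge>N. dist (X m) (X n) < e"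
      using X \<open>e > 0\<close> unfolding Cauchy_def by blast
    have "(\<Sum>x\<in>F. (cmod (g x - coeff (X n) x))\<^sup>2) \<le> e\<^sup>2" if "n \<ge> N" "finite F" for n F
    proof (rule LIMSEQ_le_const2)
      show "(\<lambda>m. \<Sum>x\<in>F. (cmod (coeff (X m) x - coeff (X n) x))\<^sup>2)
          \<longlonglongrightarrow> (\<Sum>x\<in>F. (cmod (g x - coeff (X n) x))\<^sup>2)"
        by (intro tendsto_intros g)
      have "(\<Sum>x\<in>F. (cmod (coeff (X m) x - coeff (X n) x))\<^sup>2) \<le> e\<^sup>2" if "m \<ge> N" for m
      proof -
        have "(norm (X m - X n))\<^sup>2 \<le> e\<^sup>2"
          using N that \<open>n \<ge> N\<close> by (intro power_mono) (auto simp: dist_norm less_imp_le)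
        with sum_coeff_le_norm[OF \<open>finite F\<close>, of "X m - X n"] show ?thesis by simp
      qed
      then show "\<exists>N. \<forall>m\<ge>N. (\<Sum>x\<in>F. (cmod (coeff (X m) x - coeff (X n) x))\<^sup>2) \<le> e\<^sup>2" by blast
    qed
    then show ?thesis by blast
  qed
  obtain N where N: "\<And>F. finite F \<Longrightarrow> (\<Sum>x\<in>F. (cmod (g x - coeff (X N) x))\<^sup>2) \<le> 1\<^sup>2"
    using key[of 1] by auto
  have "(\<lambda>x. (cmod ((g x - coeff (X N) x) + coeff (X N) x))\<^sup>2) summable_on UNIV"
    by (intro sq_summable_add coeff_summable sq_summable_of_bounded(1)[OF N]) auto
  then have cg: "coeff (Abs_ell2 g) = g" by (simp add: coeff_Abs)
  have "X \<longlonglongrightarrow> Abs_ell2 g"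
  proof (rule metric_LIMSEQ_I)
    fix r :: real assume "r > 0"
    then obtain N where
      N: "\<And>n F. n \<ge> N \<Longrightarrow> finite F \<Longrightarrow> (\<Sum>x\<in>F. (cmod (g x - coeff (X n) x))\<^sup>2) \<le> (r / 2)\<^sup>2"
      using key[of "r / 2"] by auto
    have "dist (X n) (Abs_ell2 g) < r" if "n \<ge> N" for n
    proof -
      note b = sq_summable_of_bounded[OF N[OF that]]
      have "Abs_ell2 g - X n = Abs_ell2 (\<lambda>x. g x - coeff (X n) x)"
        by (rule ell2_eqI) (use b(1) \<open>r > 0\<close> in \<open>simp add: cg coeff_Abs\<close>)
      then have "norm (Abs_ell2 g - X n) \<le> r / 2" using b(2) \<open>r > 0\<close> by simp
      then show ?thesis using \<open>r > 0\<close> by (simp add: dist_norm norm_minus_commute)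
    qed
    then show "\<exists>N. \<forall>n\<ge>N. dist (X n) (Abs_ell2 g) < r" by blast
  qed
  then show "convergent X" by (auto simp: convergent_def)
qed

definition delta :: "'a \<Rightarrow> 'a ell2" where
  "delta y = Abs_ell2 (\<lambda>x. if x = y then 1 else 0)"

lemma coeff_delta [simp]: "coeff (delta y) x = (if x = y then 1 else 0)"
proof -
  have "(\<lambda>x. (cmod (if x = y then 1 else 0))\<^sup>2) summable_on UNIV"
    using summable_on_cong_neutral[of "{y}" UNIV "\<lambda>x. (cmod (if x = y then 1 else 0))\<^sup>2"
        "\<lambda>x. (cmod (if x = y then 1 else 0))\<^sup>2"] by simp
  then show ?thesis unfolding delta_def by (simp add: coeff_Abs)
qed

section \<open>Operators\<close>

text \<open>
  For a subset \<open>S\<close> of the index type, \<open>\<ell>\<^sup>2(S)\<close> is identified with the closed subspace of functions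
  vanishing outside \<open>S\<close>, and an operator \<open>\<ell>\<^sup>2(S) \<rightarrow> \<ell>\<^sup>2(T)\<close> with its extension by zero to the
  orthogonal complement of \<open>\<ell>\<^sup>2(S)\<close>.  The type of bounded linear functions only knows about
  real-linearity, so complex-linearity is a separate requirement.
\<close>

definition operators :: "'a set \<Rightarrow> 'b set \<Rightarrow> ('a ell2 \<Rightarrow>\<^sub>L 'b ell2) set" where
  "operators S T = {A.
     (\<forall>c f. blinfun_apply A (c *\<^sub>C f) = c *\<^sub>C blinfun_apply A f) \<and>
     (\<forall>f. \<forall>y. y \<notin> T \<longrightarrow> coeff (blinfun_apply A f) y = 0) \<and>
     (\<forall>f. (\<forall>x\<in>S. coeff f x = 0) \<longrightarrow> blinfun_apply A f = 0)}"

definition op_scale :: "complex \<Rightarrow> ('a ell2 \<Rightarrow>\<^sub>L 'b ell2) \<Rightarrow> ('a ell2 \<Rightarrow>\<^sub>L 'b ell2)"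
    (infixr "*\<^sub>O" 75) where
  "c *\<^sub>O A = Blinfun (\<lambda>f. c *\<^sub>C blinfun_apply A f)"

definition ident :: "'a set \<Rightarrow> 'a ell2 \<Rightarrow>\<^sub>L 'a ell2" where
  "ident S = Blinfun (\<lambda>f. Abs_ell2 (\<lambda>x. if x \<in> S then coeff f x else 0))"

definition adj :: "('a ell2 \<Rightarrow>\<^sub>L 'b ell2) \<Rightarrow> ('b ell2 \<Rightarrow>\<^sub>L 'a ell2)" where
  "adj A = (THE B. \<forall>f g. cinner (blinfun_apply A f) g = cinner f (blinfun_apply B g))"

definition entry :: "('a ell2 \<Rightarrow>\<^sub>L 'b ell2) \<Rightarrow> 'b \<Rightarrow> 'a \<Rightarrow> complex" where
  "entry A x y = coeff (blinfun_apply A (delta y)) x"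

text \<open>Inverses and spectra are taken in the algebra of operators on \<open>\<ell>\<^sup>2(S)\<close>, with unit \<open>ident S\<close>.\<close>

definition is_op_inverse :: "'a set \<Rightarrow> ('a ell2 \<Rightarrow>\<^sub>L 'a ell2) \<Rightarrow> ('a ell2 \<Rightarrow>\<^sub>L 'a ell2) \<Rightarrow> bool" where
  "is_op_inverse S A B \<longleftrightarrow> B \<in> operators S S \<and> A o\<^sub>L B = ident S \<and> B o\<^sub>L A = ident S"

definition op_inverse :: "'a set \<Rightarrow> ('a ell2 \<Rightarrow>\<^sub>L 'a ell2) \<Rightarrow> ('a ell2 \<Rightarrow>\<^sub>L 'a ell2)" where
  "op_inverse S A = (THE B. is_op_inverse S A B)"

definition op_spectrum :: "'a set \<Rightarrow> ('a ell2 \<Rightarrow>\<^sub>L 'a ell2) \<Rightarrow> complex set" where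
  "op_spectrum S A = {z. \<nexists>B. is_op_inverse S (z *\<^sub>O ident S - A) B}"

lemma norm_scaleC: "norm (c *\<^sub>C f) = cmod c * norm f"
proof -
  have "(norm (c *\<^sub>C f))\<^sup>2 = (cmod c * norm f)\<^sup>2"
    unfolding norm_ell2_sq power_mult_distrib
    by (simp add: norm_mult power_mult_distrib infsum_cmult_right')
  then show ?thesis by (simp add: power2_eq_iff_nonneg)
qed

lemma blinfun_apply_op_scale [simp]: "blinfun_apply (c *\<^sub>O A) f = c *\<^sub>C blinfun_apply A f"
proof -
  have "bounded_linear (\<lambda>f. c *\<^sub>C blinfun_apply A f)"
  proof (rule bounded_linear_intro[where K = "cmod c * norm A"])
    fix f g and r :: real
    show "c *\<^sub>C blinfun_apply A (f + g) = c *\<^sub>C blinfun_apply A f + c *\<^sub>C blinfun_apply A g"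
      by (rule ell2_eqI) (simp add: blinfun.add_right algebra_simps)
    show "c *\<^sub>C blinfun_apply A (r *\<^sub>R f) = r *\<^sub>R c *\<^sub>C blinfun_apply A f"
      by (rule ell2_eqI) (simp add: blinfun.scaleR_right algebra_simps)
    have "cmod c * norm (blinfun_apply A f) \<le> cmod c * (norm A * norm f)"
      by (intro mult_left_mono norm_blinfun) simp
    then show "norm (c *\<^sub>C blinfun_apply A f) \<le> norm f * (cmod c * norm A)"
      by (simp add: norm_scaleC mult_ac)
  qed
  then show ?thesis unfolding op_scale_def by (simp add: bounded_linear_Blinfun_apply)
qed

lemma coeff_ident [simp]:
  "coeff (blinfun_apply (ident S) f) x = (if x \<in> S then coeff f x else 0)"
proof -
  define P :: "'a ell2 \<Rightarrow> 'a ell2" where "P f = Abs_ell2 (\<lambda>x. if x \<in> S then coeff f x else 0)" for f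
  have b: "(\<Sum>x\<in>F. (cmod (if x \<in> S then coeff f x else 0))\<^sup>2) \<le> (norm f)\<^sup>2"
    if "finite F" for F and f :: "'a ell2"
    by (rule order_trans[OF sum_mono sum_coeff_le_norm[OF that]]) simp
  have s: "coeff (P f) x = (if x \<in> S then coeff f x else 0)" for f x
    unfolding P_def by (subst coeff_Abs[OF sq_summable_of_bounded(1)[OF b norm_ge_zero]]) simp_all
  have "bounded_linear P"
  proof (rule bounded_linear_intro[where K = 1])
    fix f g and r :: real
    show "P (f + g) = P f + P g" "P (r *\<^sub>R f) = r *\<^sub>R P f"
      by (rule ell2_eqI, simp add: s)+
    show "norm (P f) \<le> norm f * 1"
      unfolding P_def using sq_summable_of_bounded(2)[OF b norm_ge_zero] by simp
  qed
  then have "blinfun_apply (Blinfun P) = P" by (rule bounded_linear_Blinfun_apply)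
  moreover have "ident S = Blinfun P" unfolding ident_def P_def ..
  ultimately show ?thesis by (simp only: s)
qed

section \<open>Logarithm and determinant\<close>

text \<open>
  Different branches of the logarithm change the determinant of an operator by a factor
  \<open>exp (2 \<pi> i k Tr I)\<close>, which need not be 1.  The branch \<open>L\<close> and its domain \<open>D\<close> are therefore
  explicit parameters; the region bounded by the contour may be any Jordan region inside \<open>D\<close>.
\<close>

definition log_branch :: "complex set \<Rightarrow> (complex \<Rightarrow> complex) \<Rightarrow> bool" where
  "log_branch D L \<longleftrightarrow> open D \<and> connected D \<and> simply_connected D \<and> 0 \<notin> D \<and>
     L holomorphic_on D \<and> (\<forall>z\<in>D. exp (L z) = z)"

definition log_contour :: "complex set \<Rightarrow> complex set \<Rightarrow> (real \<Rightarrow> complex) \<Rightarrow> bool" where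
  "log_contour D K \<Lambda> \<longleftrightarrow> valid_path \<Lambda> \<and> simple_path \<Lambda> \<and> pathfinish \<Lambda> = pathstart \<Lambda> \<and>
     path_image \<Lambda> \<subseteq> D \<and> inside (path_image \<Lambda>) \<subseteq> D \<and>
     K \<subseteq> inside (path_image \<Lambda>) \<and>
     (\<forall>z\<in>inside (path_image \<Lambda>). winding_number \<Lambda> z = 1)"

text \<open>
  The contour integral \<open>1/(2 \<pi> i) \<integral>\<^sub>\<Lambda> L(z) (z - A)\<^sup>-\<^sup>1 dz\<close>, as an integral with respect to the operator
  norm; an admissible contour must exist and the value must not depend on it.
\<close>

definition is_op_log ::
  "'a set \<Rightarrow> complex set \<Rightarrow> (complex \<Rightarrow> complex) \<Rightarrow> ('a ell2 \<Rightarrow>\<^sub>L 'a ell2) \<Rightarrow> ('a ell2 \<Rightarrow>\<^sub>L 'a ell2) \<Rightarrow> bool"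
where
  "is_op_log S D L A B \<longleftrightarrow>
     (\<exists>\<Lambda>. log_contour D (op_spectrum S A) \<Lambda>) \<and>
     (\<forall>\<Lambda>. log_contour D (op_spectrum S A) \<Lambda> \<longrightarrow>
        ((\<lambda>t. (1 / (2 * of_real pi * \<i>) * L (\<Lambda> t) * vector_derivative \<Lambda> (at t within {0..1})) *\<^sub>O
              op_inverse S (\<Lambda> t *\<^sub>O ident S - A)) has_integral B) {0..1})"

definition op_log ::
  "'a set \<Rightarrow> complex set \<Rightarrow> (complex \<Rightarrow> complex) \<Rightarrow> ('a ell2 \<Rightarrow>\<^sub>L 'a ell2) \<Rightarrow> ('a ell2 \<Rightarrow>\<^sub>L 'a ell2)"
where
  "op_log S D L A = (THE B. is_op_log S D L A B)"

text \<open>Below, \<open>act\<close> is the action of the group \<open>\<Gamma>\<close> on the index type.\<close>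

definition stabilizer :: "('g \<Rightarrow> 'a \<Rightarrow> 'a) \<Rightarrow> 'g set \<Rightarrow> 'a \<Rightarrow> 'g set" where
  "stabilizer act \<Gamma> x = {\<gamma> \<in> \<Gamma>. act \<gamma> x = x}"

definition orbit_representatives :: "('g \<Rightarrow> 'a \<Rightarrow> 'a) \<Rightarrow> 'g set \<Rightarrow> 'a set \<Rightarrow> 'a set \<Rightarrow> bool" where
  "orbit_representatives act \<Gamma> S F \<longleftrightarrow> F \<subseteq> S \<and> (\<forall>x\<in>S. \<exists>!y. y \<in> F \<and> (\<exists>\<gamma>\<in>\<Gamma>. act \<gamma> x = y))"

definition translate :: "('a \<Rightarrow> 'a) \<Rightarrow> 'a ell2 \<Rightarrow> 'a ell2" where
  "translate p f = Abs_ell2 (\<lambda>x. coeff f (inv p x))"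

definition Gamma_trace ::
  "('g \<Rightarrow> 'a \<Rightarrow> 'a) \<Rightarrow> 'g set \<Rightarrow> 'a set \<Rightarrow> ('a ell2 \<Rightarrow>\<^sub>L 'a ell2) \<Rightarrow> complex" where
  "Gamma_trace act \<Gamma> F A =
     (\<Sum>\<^sub>\<infinity>x\<in>F. 1 / of_nat (card (stabilizer act \<Gamma> x)) * entry A x x)"

definition Gamma_det ::
  "('g \<Rightarrow> 'a \<Rightarrow> 'a) \<Rightarrow> 'g set \<Rightarrow> 'a set \<Rightarrow> 'a set \<Rightarrow> complex set \<Rightarrow> (complex \<Rightarrow> complex) \<Rightarrow>
   ('a ell2 \<Rightarrow>\<^sub>L 'a ell2) \<Rightarrow> complex" where
  "Gamma_det act \<Gamma> F S D L A = exp (Gamma_trace act \<Gamma> F (op_log S D L A))"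

lemma Gamma_trace_ident:
  assumes "F \<subseteq> S"
  shows "Gamma_trace act \<Gamma> F (ident S) = (\<Sum>\<^sub>\<infinity>x\<in>F. 1 / of_nat (card (stabilizer act \<Gamma> x)))"
  unfolding Gamma_trace_def entry_def using assms by (intro infsum_cong) (simp add: subset_iff)

section \<open>Periodic graphs\<close>

definition arcs :: "'v set set \<Rightarrow> ('v \<times> 'v) set" where
  "arcs E = {(u, v). {u, v} \<in> E}"

definition simple_graph :: "'v set \<Rightarrow> 'v set set \<Rightarrow> bool" where
  "simple_graph V E \<longleftrightarrow> E \<subseteq> {{u, v} | u v. u \<in> V \<and> v \<in> V \<and> u \<noteq> v}"

text \<open>Automorphisms are extended by the identity outside \<open>V\<close>.\<close>

definition graph_automorphisms :: "'v set \<Rightarrow> 'v set set \<Rightarrow> ('v \<Rightarrow> 'v) set" where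
  "graph_automorphisms V E =
     {\<gamma>. \<gamma> permutes V \<and> (\<forall>u\<in>V. \<forall>v\<in>V. {\<gamma> u, \<gamma> v} \<in> E \<longleftrightarrow> {u, v} \<in> E)}"

definition automorphism_group :: "'v set \<Rightarrow> 'v set set \<Rightarrow> ('v \<Rightarrow> 'v) set \<Rightarrow> bool" where
  "automorphism_group V E \<Gamma> \<longleftrightarrow> \<Gamma> \<subseteq> graph_automorphisms V E \<and> id \<in> \<Gamma> \<and>
     (\<forall>\<gamma>\<in>\<Gamma>. \<forall>\<delta>\<in>\<Gamma>. \<gamma> \<circ> \<delta> \<in> \<Gamma>) \<and> (\<forall>\<gamma>\<in>\<Gamma>. inv \<gamma> \<in> \<Gamma>)"

abbreviation (input) vertex_act :: "('v \<Rightarrow> 'v) \<Rightarrow> 'v \<Rightarrow> 'v" where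
  "vertex_act \<gamma> \<equiv> \<gamma>"

abbreviation arc_act :: "('v \<Rightarrow> 'v) \<Rightarrow> 'v \<times> 'v \<Rightarrow> 'v \<times> 'v" where
  "arc_act \<gamma> \<equiv> map_prod \<gamma> \<gamma>"

definition periodic_graph :: "'v set \<Rightarrow> 'v set set \<Rightarrow> ('v \<Rightarrow> 'v) set \<Rightarrow> 'v set \<Rightarrow> bool" where
  "periodic_graph V E \<Gamma> F0 \<longleftrightarrow>
     countable V \<and> simple_graph V E \<and>
     (\<exists>N. \<forall>v\<in>V. finite {w. {v, w} \<in> E} \<and> card {w. {v, w} \<in> E} \<le> N) \<and>
     automorphism_group V E \<Gamma> \<and> countable \<Gamma> \<and>
     (\<forall>\<gamma>\<in>\<Gamma>. \<forall>(u, v)\<in>arcs E. arc_act \<gamma> (u, v) \<noteq> (v, u)) \<and>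
     (\<forall>v\<in>V. finite (stabilizer vertex_act \<Gamma> v)) \<and>
     orbit_representatives vertex_act \<Gamma> V F0 \<and>
     (\<lambda>v. 1 / real (card (stabilizer vertex_act \<Gamma> v))) summable_on F0"

definition equivariant ::
  "('v \<Rightarrow> 'v) set \<Rightarrow> (('v \<times> 'v) ell2 \<Rightarrow>\<^sub>L 'v ell2) \<Rightarrow> bool" where
  "equivariant \<Gamma> d \<longleftrightarrow> (\<forall>\<gamma>\<in>\<Gamma>. \<forall>f.
     blinfun_apply d (translate (arc_act \<gamma>) f) = translate (vertex_act \<gamma>) (blinfun_apply d f))"

end

theory Submission
  imports Defs
begin

text \<open>
  Put \<open>J = C\<^sub>1\<close> and \<open>B(u) = (1 + a\<^sub>2 u)(1 - b\<^sub>2 u) - 2 c\<^sub>2 u d\<^sub>2 d\<^sub>1\<^sup>* d\<^sub>1 d\<^sub>2\<^sup>*\<close>.  For small \<open>u\<close> both operators are of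
  the form \<open>1 - N\<close> with \<open>N\<close> small, and the contour integral defining the logarithm equals the power
  series of \<open>log (1 - N)\<close>.  Both sides of the logarithmic form of the identity are then holomorphic in
  \<open>u\<close> and vanish at \<open>u = 0\<close>, so it suffices to compare derivatives.  These are traces of resolvents.
  Writing \<open>I - uU = (I - u b\<^sub>2 J) - u c\<^sub>2 J d\<^sub>2\<^sup>* d\<^sub>2\<close> and using \<open>J\<^sup>2 = I\<close> gives
  \<open>(I - uU)\<^sup>-\<^sup>1 = (I + u c\<^sub>2 (J + u b\<^sub>2) d\<^sub>2\<^sup>* B(u)\<^sup>-\<^sup>1 d\<^sub>2) (I + u b\<^sub>2 J) / (1 - u\<^sup>2 b\<^sub>2\<^sup>2)\<close>, whose trace
  reduces to that of \<open>B(u)\<^sup>-\<^sup>1\<close> by cyclicity of the trace between arcs and vertices.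
\<close>

subsection \<open>Square-summable functions\<close>

text \<open>The factors into which \<open>ident R - u U\<close> splits do not commute, so exp of
  trace of log is not visibly multiplicative on them. Differentiating in u removes the obstacle:
  what remains is linear in the trace, and cyclicity suffices. Cyclicity is not a statement about
  trace-class operators here, since the trace only sums diagonal entries over orbit representatives.
  It comes from counting triples (arc representative, vertex representative, group element) in two
  ways, with absolute convergence from summable weights and uniformly bounded row sums. The
  coefficients of B(u) have one source: B(u) is 1 - u^2 b2^2 times the Schur complement of the
  perturbation of \<open>ident R - u b2 J\<close>. The exponent comes from Tr J = 2 Tr I_V - Tr I_R,
  a consequence of \<open>d1 o\<^sub>L adj d1 = ident V\<close>. Two features of the definition of
  the logarithm shape the analytic part. Its contours may run anywhere in D, while the power series
  lives on a disk around 1. And \<open>L 1 = 0\<close> makes L the principal branch near 1, so that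
  both logarithms vanish at u = 0.\<close>

lemma has_sum_finite_support:
  fixes f :: "'a \<Rightarrow> 'b::{comm_monoid_add,topological_space}"
  assumes "finite F" "\<And>x. x \<notin> F \<Longrightarrow> f x = 0"
  shows "(f has_sum sum f F) UNIV"
  using has_sum_finite[OF assms(1), of f] has_sum_cong_neutral[of F UNIV f f] assms(2) by auto

lemma bounded_linear_coeff: "bounded_linear (\<lambda>f. coeff f x)"
  by (rule bounded_linear_intro[where K = 1])
     (auto simp: coeff_le_norm scaleR_conv_of_real)

lemma coeff_sum: "coeff (sum f F) x = (\<Sum>i\<in>F. coeff (f i) x)"
  using bounded_linear.linear[OF bounded_linear_coeff] by (rule linear_sum)

lemma bounded_linear_entry: "bounded_linear (\<lambda>A. coeff (blinfun_apply A f) x)"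
  by (rule bounded_linear_compose[OF bounded_linear_coeff blinfun.bounded_linear_left])

lemma cinner_commute: "cinner g f = cnj (cinner f g)"
  unfolding cinner_def by (subst infsum_cnj[symmetric]) (simp add: mult.commute)

lemma cinner_add_right: "cinner f (g + h) = cinner f g + cinner f h"
  unfolding cinner_def using infsum_add[OF cinner_summable[of f g] cinner_summable[of f h]]
  by (simp add: algebra_simps)

lemma cinner_scaleC_right: "cinner f (c *\<^sub>C g) = c * cinner f g"
  unfolding cinner_def by (simp add: infsum_cmult_right' mult.left_commute)

lemma cinner_add_left: "cinner (f + g) h = cinner f h + cinner g h"
  and cinner_scaleC_left: "cinner (c *\<^sub>C f) h = cnj c * cinner f h"
  by (simp_all add: cinner_commute[of _ h] cinner_add_right cinner_scaleC_right)

lemma cinner_zero_right [simp]: "cinner f 0 = 0"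
  and cinner_zero_left [simp]: "cinner 0 f = 0"
  by (simp_all add: cinner_def)

lemma cinner_delta_left: "cinner (delta x) f = coeff f x"
proof -
  have "((\<lambda>y. cnj (coeff (delta x) y) * coeff f y) has_sum (\<Sum>y\<in>{x}. cnj (coeff (delta x) y) * coeff f y)) UNIV"
    by (rule has_sum_finite_support) auto
  then show ?thesis unfolding cinner_def by (simp add: infsumI)
qed

lemma cinner_self: "cinner f f = of_real ((norm f)\<^sup>2)"
proof -
  have "(\<lambda>x. cnj (coeff f x) * coeff f x) = (\<lambda>x. of_real ((cmod (coeff f x))\<^sup>2))"
    by (simp add: complex_norm_square mult.commute del: of_real_power)
  then show ?thesis unfolding cinner_def norm_ell2_sq
    using has_sum_bounded_linear[OF bounded_linear_of_real[where 'a = complex] has_sum_infsum[OF coeff_summable[of f UNIV]]]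
    by (simp add: infsumI del: of_real_power)
qed

text \<open>Rotating f by the phase of the inner product makes that product real and nonnegative, so
  the Cauchy-Schwarz inequality of the real inner product applies.\<close>

lemma cmod_cinner_le: "cmod (cinner f g) \<le> norm f * norm g"
proof -
  define c where "c = sgn (cinner f g)"
  have "cmod (cinner f g) = Re (cnj c * cinner f g)"
  proof -
    have "cnj (sgn z) * z = of_real (cmod z)" for z
    proof -
      have "cnj (sgn z) * z = cnj z * z / of_real (cmod z)" by (simp add: sgn_eq)
      also have "cnj z * z = of_real (cmod z) * of_real (cmod z)"
        using complex_norm_square[of z] unfolding power2_eq_square of_real_mult
        by (simp only: mult.commute)
      finally show ?thesis by simp
    qed
    then have "cnj c * cinner f g = of_real (cmod (cinner f g))" by (simp add: c_def)
    then show ?thesis by simp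
  qed
  also have "\<dots> = inner (c *\<^sub>C f) g" by (simp add: inner_ell2_def cinner_scaleC_left)
  also have "\<dots> \<le> norm (c *\<^sub>C f) * norm g" by (rule norm_cauchy_schwarz)
  also have "\<dots> \<le> norm f * norm g"
    by (intro mult_right_mono) (auto simp: norm_scaleC c_def norm_sgn)
  finally show ?thesis .
qed

lemma norm_delta [simp]: "norm (delta x) = 1"
proof -
  have "of_real ((norm (delta x))\<^sup>2) = (1 :: complex)"
    unfolding cinner_self[symmetric] cinner_delta_left by simp
  then have "(norm (delta x))\<^sup>2 = 1" by (simp only: of_real_eq_1_iff)
  then show ?thesis by (simp add: power2_eq_1_iff) (metis norm_ge_zero not_one_le_zero neg_0_le_iff_le)
qed

lemma bounded_linear_cinner_right: "bounded_linear (cinner f)"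
proof (rule bounded_linear_intro[where K = "norm f"])
  show "cinner f (r *\<^sub>R g) = r *\<^sub>R cinner f g" for r g
    by (simp add: scaleR_ell2_def cinner_scaleC_right scaleR_conv_of_real)
qed (use cmod_cinner_le[of f] in \<open>auto simp: cinner_add_right mult.commute\<close>)

text \<open>The squared distance from f to a finite partial sum is the tail of the sum of squared
  coefficients. The expansion lets a continuous complex-linear map be computed from its values on
  the \<open>delta x\<close>.\<close>

lemma delta_has_sum: "((\<lambda>x. coeff f x *\<^sub>C delta x) has_sum f) UNIV"
proof -
  define s where "s x = (cmod (coeff f x))\<^sup>2" for x
  define t where "t F = (\<Sum>x\<in>F. coeff f x *\<^sub>C delta x)" for F
  have ct: "coeff (t F) y = (if y \<in> F then coeff f y else 0)" if "finite F" for F y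
    unfolding t_def coeff_sum using that by (simp add: if_distrib sum.delta cong: if_cong)
  have n: "(norm (t F - f))\<^sup>2 = infsum s UNIV - sum s F" if "finite F" for F
  proof -
    have "(norm (t F - f))\<^sup>2 = (\<Sum>\<^sub>\<infinity>x\<in>UNIV - F. s x)"
      unfolding norm_ell2_sq by (rule infsum_cong_neutral) (auto simp: ct that s_def)
    also have "\<dots> = infsum s UNIV - infsum s F"
      by (rule infsum_Diff) (auto simp: s_def[abs_def] coeff_summable)
    finally show ?thesis using that by simp
  qed
  have "(sum s \<longlongrightarrow> infsum s UNIV) (finite_subsets_at_top UNIV)"
    using has_sum_infsum[OF coeff_summable[of f UNIV]] by (simp add: has_sum_def s_def[abs_def])
  then have "((\<lambda>F. infsum s UNIV - sum s F) \<longlongrightarrow> 0) (finite_subsets_at_top UNIV)"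
    using tendsto_diff[OF tendsto_const[of "infsum s UNIV"], of "sum s" "infsum s UNIV"] by simp
  then have "((\<lambda>F. (norm (t F - f))\<^sup>2) \<longlongrightarrow> 0) (finite_subsets_at_top UNIV)"
    by (rule Lim_transform_eventually) (auto simp: n intro: eventually_finite_subsets_at_top_weakI)
  then have "((\<lambda>F. norm (t F - f)) \<longlongrightarrow> 0) (finite_subsets_at_top UNIV)"
    using tendsto_real_sqrt[of "\<lambda>F. (norm (t F - f))\<^sup>2" 0] by simp
  then have "(t \<longlongrightarrow> f) (finite_subsets_at_top UNIV)"
    by (rule LIM_zero_cancel[OF tendsto_norm_zero_cancel])
  then show ?thesis by (simp add: has_sum_def t_def[abs_def])
qed

subsection \<open>Operators and adjoints\<close>

lemma operatorsI:
  assumes "\<And>c f. blinfun_apply A (c *\<^sub>C f) = c *\<^sub>C blinfun_apply A f"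
    and "\<And>f y. y \<notin> T \<Longrightarrow> coeff (blinfun_apply A f) y = 0"
    and "\<And>f. (\<And>x. x \<in> S \<Longrightarrow> coeff f x = 0) \<Longrightarrow> blinfun_apply A f = 0"
  shows "A \<in> operators S T"
  using assms by (simp add: operators_def)

lemma operators_scaleC: "A \<in> operators S T \<Longrightarrow> blinfun_apply A (c *\<^sub>C f) = c *\<^sub>C blinfun_apply A f"
  and operators_outside: "A \<in> operators S T \<Longrightarrow> y \<notin> T \<Longrightarrow> coeff (blinfun_apply A f) y = 0"
  and operators_kernel: "A \<in> operators S T \<Longrightarrow> (\<And>x. x \<in> S \<Longrightarrow> coeff f x = 0) \<Longrightarrow> blinfun_apply A f = 0"
  by (auto simp: operators_def)

lemma scaleC_zero [simp]: "c *\<^sub>C 0 = 0"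
  by (rule ell2_eqI) simp

lemma operators_zero: "0 \<in> operators S T"
  by (rule operatorsI) auto

lemma operators_add: "A \<in> operators S T \<Longrightarrow> B \<in> operators S T \<Longrightarrow> A + B \<in> operators S T"
  by (rule operatorsI, rule ell2_eqI)
     (auto simp: blinfun.add_left operators_scaleC operators_outside operators_kernel algebra_simps)

lemma operators_scale: "A \<in> operators S T \<Longrightarrow> c *\<^sub>O A \<in> operators S T"
  by (rule operatorsI, rule ell2_eqI)
     (auto simp: operators_scaleC operators_outside operators_kernel algebra_simps)

lemma scaleR_op: "r *\<^sub>R A = of_real r *\<^sub>O A"
  by (rule blinfun_eqI, rule ell2_eqI) (simp add: blinfun.scaleR_left)

lemma uminus_op: "- A = (- 1) *\<^sub>O A"
  by (rule blinfun_eqI, rule ell2_eqI) (simp add: blinfun.minus_left)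

lemma operators_scaleR: "A \<in> operators S T \<Longrightarrow> r *\<^sub>R A \<in> operators S T"
  by (simp add: scaleR_op operators_scale)

lemma operators_uminus: "A \<in> operators S T \<Longrightarrow> - A \<in> operators S T"
  by (simp add: uminus_op operators_scale)

lemma operators_diff: "A \<in> operators S T \<Longrightarrow> B \<in> operators S T \<Longrightarrow> A - B \<in> operators S T"
  using operators_add[of A S T "- B"] operators_uminus[of B S T] by simp

lemma operators_sum: "(\<And>i. i \<in> I \<Longrightarrow> A i \<in> operators S T) \<Longrightarrow> sum A I \<in> operators S T"
  by (induction I rule: infinite_finite_induct) (auto intro: operators_add operators_zero)

lemma operators_compose:
  "A \<in> operators T W \<Longrightarrow> B \<in> operators S T \<Longrightarrow> A o\<^sub>L B \<in> operators S W"
  by (rule operatorsI) (auto simp: operators_scaleC operators_outside operators_kernel)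

lemma operators_ident: "ident S \<in> operators S S"
  by (rule operatorsI) (auto intro!: ell2_eqI)

text \<open>Each condition defining \<open>operators\<close> can be checked coefficient by
  coefficient, and coefficients are continuous in the operator norm. This keeps the sums of operator
  series inside the class.\<close>

lemma operators_LIMSEQ:
  assumes "\<And>n. X n \<in> operators S T" "X \<longlonglongrightarrow> A"
  shows "A \<in> operators S T"
proof -
  have l: "(\<lambda>n. coeff (blinfun_apply (X n) f) x) \<longlonglongrightarrow> coeff (blinfun_apply A f) x" for f x
    by (rule bounded_linear.tendsto[OF bounded_linear_entry assms(2)])
  show ?thesis
  proof (rule operatorsI)
    show "blinfun_apply A (c *\<^sub>C f) = c *\<^sub>C blinfun_apply A f" for c f
    proof (rule ell2_eqI)
      fix x
      have "(\<lambda>n. coeff (blinfun_apply (X n) (c *\<^sub>C f)) x) \<longlonglongrightarrow> coeff (c *\<^sub>C blinfun_apply A f) x"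
        using tendsto_mult_left[OF l[of f x], of c] by (simp add: operators_scaleC[OF assms(1)])
      with l[of "c *\<^sub>C f" x] show "coeff (blinfun_apply A (c *\<^sub>C f)) x = coeff (c *\<^sub>C blinfun_apply A f) x"
        by (rule LIMSEQ_unique)
    qed
    show "coeff (blinfun_apply A f) y = 0" if "y \<notin> T" for f y
      using l[of f y] by (simp add: operators_outside[OF assms(1) that] LIMSEQ_const_iff)
    show "blinfun_apply A f = 0" if "\<And>x. x \<in> S \<Longrightarrow> coeff f x = 0" for f
    proof (rule ell2_eqI)
      fix x show "coeff (blinfun_apply A f) x = coeff 0 x"
        using l[of f x] by (simp add: operators_kernel[OF assms(1) that] LIMSEQ_const_iff)
    qed
  qed
qed

lemma operators_sums: "(\<And>n. X n \<in> operators S T) \<Longrightarrow> X sums A \<Longrightarrow> A \<in> operators S T"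
  unfolding sums_def by (rule operators_LIMSEQ) (auto intro: operators_sum)

lemma op_ident_right: "A \<in> operators S T \<Longrightarrow> A o\<^sub>L ident S = A"
proof (rule blinfun_eqI)
  fix f assume A: "A \<in> operators S T"
  have "blinfun_apply A (f - blinfun_apply (ident S) f) = 0" by (rule operators_kernel[OF A]) simp
  then show "blinfun_apply (A o\<^sub>L ident S) f = blinfun_apply A f" by (simp add: blinfun.diff_right)
qed

lemma op_ident_left: "A \<in> operators S T \<Longrightarrow> ident T o\<^sub>L A = A"
  by (rule blinfun_eqI, rule ell2_eqI) (simp add: operators_outside)

lemma op_scale_compose_left: "(c *\<^sub>O A) o\<^sub>L B = c *\<^sub>O (A o\<^sub>L B)"
  by (rule blinfun_eqI) simp

text \<open>Moving a complex scalar out of the inner factor uses complex linearity of A, which a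
  bounded real-linear map does not have by itself.\<close>

lemma op_scale_compose_right: "A \<in> operators S T \<Longrightarrow> A o\<^sub>L (c *\<^sub>O B) = c *\<^sub>O (A o\<^sub>L B)"
  by (rule blinfun_eqI) (simp add: operators_scaleC)

lemma op_scale_add_right: "c *\<^sub>O (A + B) = c *\<^sub>O A + c *\<^sub>O B"
  and op_scale_diff_right: "c *\<^sub>O (A - B) = c *\<^sub>O A - c *\<^sub>O B"
  and op_scale_add_left: "(c + d) *\<^sub>O A = c *\<^sub>O A + d *\<^sub>O A"
  and op_scale_diff_left: "(c - d) *\<^sub>O A = c *\<^sub>O A - d *\<^sub>O A"
  and op_scale_scale: "c *\<^sub>O d *\<^sub>O A = (c * d) *\<^sub>O A"
  and op_scale_one: "1 *\<^sub>O A = A"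
  and op_scale_zero: "0 *\<^sub>O A = 0"
  and op_scale_zero_right: "c *\<^sub>O 0 = 0"
  by (rule blinfun_eqI, rule ell2_eqI, simp add: blinfun.add_left blinfun.diff_left algebra_simps)+

lemma norm_op_scale: "norm (c *\<^sub>O A) = cmod c * norm A"
proof -
  have le: "norm (c *\<^sub>O A) \<le> cmod c * norm A" for c and A :: "'a ell2 \<Rightarrow>\<^sub>L 'b ell2"
  proof (rule norm_blinfun_bound)
    fix f
    have "cmod c * norm (blinfun_apply A f) \<le> cmod c * (norm A * norm f)"
      by (intro mult_left_mono norm_blinfun) simp
    then show "norm (blinfun_apply (c *\<^sub>O A) f) \<le> cmod c * norm A * norm f"
      by (simp add: norm_scaleC)
  qed simp
  show ?thesis
  proof (cases "c = 0")
    case False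
    have "norm A = norm ((1 / c) *\<^sub>O c *\<^sub>O A)" using False by (simp add: op_scale_scale op_scale_one)
    also have "\<dots> \<le> cmod (1 / c) * norm (c *\<^sub>O A)" by (rule le)
    finally have "cmod c * norm A \<le> norm (c *\<^sub>O A)" using False
      by (simp add: norm_divide divide_simps mult.commute)
    then show ?thesis using le[of c A] by simp
  qed (simp add: op_scale_zero)
qed

text \<open>The operator type carries only a real vector space structure. Bilinearity of the complex
  scaling over the reals supplies the limit, continuity, summation and derivative rules for
  it.\<close>

lemma bounded_bilinear_op_scale: "bounded_bilinear (*\<^sub>O)"
  by (rule bounded_bilinear.intro)
     (auto simp: op_scale_add_left op_scale_add_right scaleR_op op_scale_scale norm_op_scale
        scaleR_conv_of_real mult.commute intro!: exI[of _ 1])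

text \<open>Only an inequality, since \<open>ident S\<close> is zero for empty S.\<close>

lemma norm_ident_le: "norm (ident S) \<le> 1"
proof (rule norm_blinfun_bound)
  fix f :: "'a ell2"
  have "(norm (blinfun_apply (ident S) f))\<^sup>2 \<le> (norm f)\<^sup>2"
    unfolding norm_ell2_sq
  proof (rule infsum_mono)
    show "(\<lambda>x. (cmod (coeff (blinfun_apply (ident S) f) x))\<^sup>2) summable_on UNIV" by (rule coeff_summable)
  qed (auto simp: coeff_summable)
  then show "norm (blinfun_apply (ident S) f) \<le> 1 * norm f"
    by (simp add: power2_le_iff_abs_le)
qed simp

lemma norm_compose_le: "norm A \<le> a \<Longrightarrow> norm B \<le> b \<Longrightarrow> norm (A o\<^sub>L B) \<le> a * b"
  by (rule order_trans[OF norm_blinfun_compose mult_mono]) (auto intro: order_trans[OF norm_ge_zero])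

section \<open>Existence and properties of the adjoint\<close>

lemma cinner_ext: "(\<And>f. cinner f g = cinner f h) \<Longrightarrow> g = h"
  by (rule ell2_eqI) (metis cinner_delta_left)

text \<open>The adjoint must have coefficients b g x = <A delta_x, g>. To see that they are square
  summable, test A on h, the sum of b g x delta_x over a finite F: then ||h||^2 = <A h, g> <= ||A||
  ||h|| ||g||, and dividing by ||h|| gives a bound independent of F.\<close>

lemma adj_exists:
  assumes A: "A \<in> operators S T"
  shows "\<exists>B. \<forall>f g. cinner (blinfun_apply A f) g = cinner f (blinfun_apply B g)"
proof -
  define b where "b g x = cinner (blinfun_apply A (delta x)) g" for g x
  have bound: "(\<Sum>x\<in>F. (cmod (b g x))\<^sup>2) \<le> (norm A * norm g)\<^sup>2" if F: "finite F" for F g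
  proof -
    define s where "s = (\<Sum>x\<in>F. (cmod (b g x))\<^sup>2)"
    define h where "h = (\<Sum>x\<in>F. b g x *\<^sub>C delta x)"
    have s0: "0 \<le> s" unfolding s_def by (rule sum_nonneg) simp
    have ch: "coeff h y = (if y \<in> F then b g y else 0)" for y
      unfolding h_def coeff_sum using F by (simp add: if_distrib sum.delta cong: if_cong)
    have nh: "(norm h)\<^sup>2 = s"
    proof -
      have "((\<lambda>x. (cmod (coeff h x))\<^sup>2) has_sum (\<Sum>x\<in>F. (cmod (coeff h x))\<^sup>2)) UNIV"
        by (rule has_sum_finite_support[OF F]) (simp add: ch)
      then show ?thesis unfolding norm_ell2_sq s_def by (simp add: infsumI ch)
    qed
    have "cinner (blinfun_apply A h) g = (\<Sum>x\<in>F. cnj (b g x) * b g x)"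
      unfolding h_def using F
    proof (induction F)
      case (insert x F)
      then show ?case
        by (simp add: blinfun.add_right cinner_add_left operators_scaleC[OF A] cinner_scaleC_left b_def[of g x])
    qed (simp add: blinfun.zero_right)
    also have "\<dots> = of_real s"
      unfolding s_def of_real_sum by (intro sum.cong) (simp_all add: complex_norm_square mult.commute del: of_real_power)
    finally have "s = cmod (cinner (blinfun_apply A h) g)" using s0 by simp
    also have "\<dots> \<le> norm (blinfun_apply A h) * norm g" by (rule cmod_cinner_le)
    also have "\<dots> \<le> norm A * norm h * norm g" by (intro mult_right_mono norm_blinfun) simp
    finally have *: "(norm h)\<^sup>2 \<le> norm h * (norm A * norm g)" by (simp add: nh mult_ac)
    have "norm h \<le> norm A * norm g"
    proof (cases "norm h = 0")
      case False
      then show ?thesis using * by (simp add: power2_eq_square)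
    qed simp
    then show ?thesis unfolding s_def[symmetric] nh[symmetric] by (rule power_mono) simp
  qed
  have b0: "0 \<le> norm A * norm g" for g :: "'b ell2" by simp
  note sq = sq_summable_of_bounded[OF bound b0]
  define B where "B g = Abs_ell2 (b g)" for g
  have cB: "coeff (B g) x = b g x" for g x
    unfolding B_def by (simp add: coeff_Abs[OF sq(1)])
  have "bounded_linear B"
  proof (rule bounded_linear_intro[where K = "norm A"])
    show "B (f + g) = B f + B g" for f g by (rule ell2_eqI) (simp add: cB b_def cinner_add_right)
    show "B (r *\<^sub>R g) = r *\<^sub>R B g" for r g
      by (rule ell2_eqI) (simp add: cB b_def scaleR_ell2_def cinner_scaleC_right)
    show "norm (B g) \<le> norm g * norm A" for g using sq(2)[of g] by (simp add: B_def mult.commute)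
  qed
  then have B: "blinfun_apply (Blinfun B) = B" by (rule bounded_linear_Blinfun_apply)
  have "cinner (blinfun_apply A f) g = cinner f (blinfun_apply (Blinfun B) g)" for f g
  proof -
    have "((\<lambda>x. cinner g (blinfun_apply A (coeff f x *\<^sub>C delta x))) has_sum cinner g (blinfun_apply A f)) UNIV"
      by (rule has_sum_bounded_linear[OF bounded_linear_compose[OF bounded_linear_cinner_right
            blinfun.bounded_linear_right] delta_has_sum])
    then have "cinner g (blinfun_apply A f) = (\<Sum>\<^sub>\<infinity>x. coeff f x * cinner g (blinfun_apply A (delta x)))"
      by (simp add: infsumI operators_scaleC[OF A] cinner_scaleC_right)
    then have "cinner (blinfun_apply A f) g = cnj (\<Sum>\<^sub>\<infinity>x. coeff f x * cinner g (blinfun_apply A (delta x)))"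
      by (subst cinner_commute) simp
    also have "\<dots> = (\<Sum>\<^sub>\<infinity>x. cnj (coeff f x) * b g x)"
      unfolding infsum_cnj[symmetric] by (simp add: b_def cinner_commute[of _ g])
    finally show ?thesis by (simp add: B cB cinner_def)
  qed
  then show ?thesis by blast
qed

lemma cinner_adj:
  assumes "A \<in> operators S T"
  shows "cinner (blinfun_apply A f) g = cinner f (blinfun_apply (adj A) g)"
proof -
  have "\<exists>!B. \<forall>f g. cinner (blinfun_apply A f) g = cinner f (blinfun_apply B g)"
    using adj_exists[OF assms] by (metis blinfun_eqI cinner_ext)
  from theI'[OF this] show ?thesis unfolding adj_def by blast
qed

lemma cinner_adj':
  assumes "A \<in> operators S T"
  shows "cinner (blinfun_apply (adj A) g) f = cinner g (blinfun_apply A f)"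
  by (metis assms cinner_adj cinner_commute)

lemma coeff_adj: "A \<in> operators S T \<Longrightarrow> coeff (blinfun_apply (adj A) g) x = cinner (blinfun_apply A (delta x)) g"
  by (simp add: cinner_adj cinner_delta_left)

lemma operators_adj:
  assumes A: "A \<in> operators S T"
  shows "adj A \<in> operators T S"
proof (rule operatorsI)
  show "blinfun_apply (adj A) (c *\<^sub>C f) = c *\<^sub>C blinfun_apply (adj A) f" for c f
    by (rule ell2_eqI) (simp add: coeff_adj[OF A] cinner_scaleC_right)
  show "coeff (blinfun_apply (adj A) f) y = 0" if "y \<notin> S" for f y
  proof -
    have "blinfun_apply A (delta y) = 0" by (rule operators_kernel[OF A]) (use that in auto)
    then show ?thesis by (simp add: coeff_adj[OF A])
  qed
  show "blinfun_apply (adj A) f = 0" if "\<And>x. x \<in> T \<Longrightarrow> coeff f x = 0" for f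
  proof (rule ell2_eqI)
    have z: "cnj (coeff (blinfun_apply A (delta x)) y) * coeff f y = 0" for x y
      using that operators_outside[OF A, of y] by (cases "y \<in> T") auto
    show "coeff (blinfun_apply (adj A) f) x = coeff 0 x" for x
      unfolding coeff_adj[OF A] cinner_def z by simp
  qed
qed

subsection \<open>Neumann series and resolvents\<close>

interpretation blinfun_compose: bounded_bilinear "(o\<^sub>L)"
  by (rule bounded_bilinear_blinfun_compose)

lemma blinfun_compose_assoc: "(A o\<^sub>L B) o\<^sub>L C = A o\<^sub>L (B o\<^sub>L C)"
  by (rule blinfun_eqI) simp

lemma op_ident_square:
  "A \<in> operators S S \<Longrightarrow> ident S o\<^sub>L A = A"
  "A \<in> operators S S \<Longrightarrow> A o\<^sub>L ident S = A"
  by (rule op_ident_left op_ident_right, assumption)+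

text \<open>Powers inside the algebra of operators on S: the zeroth power is the unit
  \<open>ident S\<close> of that algebra, not the identity of the whole space.\<close>

definition opow :: "'a set \<Rightarrow> ('a ell2 \<Rightarrow>\<^sub>L 'a ell2) \<Rightarrow> nat \<Rightarrow> ('a ell2 \<Rightarrow>\<^sub>L 'a ell2)" where
  "opow S N k = ((o\<^sub>L) N ^^ k) (ident S)"

lemma opow_0 [simp]: "opow S N 0 = ident S"
  and opow_Suc: "opow S N (Suc k) = N o\<^sub>L opow S N k"
  by (simp_all add: opow_def)

lemma operators_opow: "N \<in> operators S S \<Longrightarrow> opow S N k \<in> operators S S"
  by (induction k) (auto simp: opow_Suc operators_ident intro: operators_compose)

lemma norm_opow_le: "norm (opow S N k) \<le> norm N ^ k"
  by (induction k) (auto simp: opow_Suc norm_ident_le intro: norm_compose_le)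

lemma opow_commute:
  assumes "N \<in> operators S S" "P \<in> operators S S" "P o\<^sub>L N = N o\<^sub>L P"
  shows "P o\<^sub>L opow S N k = opow S N k o\<^sub>L P"
proof (induction k)
  case (Suc k)
  have "P o\<^sub>L opow S N (Suc k) = N o\<^sub>L (P o\<^sub>L opow S N k)"
    unfolding opow_Suc blinfun_compose_assoc[symmetric] assms(3) ..
  then show ?case by (simp add: Suc opow_Suc blinfun_compose_assoc)
qed (simp add: op_ident_square assms)

lemma opow_Suc2: "N \<in> operators S S \<Longrightarrow> opow S N (Suc k) = opow S N k o\<^sub>L N"
  unfolding opow_Suc by (rule opow_commute) auto

lemma is_op_inverseI:
  "B \<in> operators S S \<Longrightarrow> A o\<^sub>L B = ident S \<Longrightarrow> B o\<^sub>L A = ident S \<Longrightarrow> is_op_inverse S A B"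
  by (simp add: is_op_inverse_def)

lemma is_op_inverse_unique:
  assumes "is_op_inverse S A B" "is_op_inverse S A C"
  shows "B = C"
proof -
  have "B = B o\<^sub>L (A o\<^sub>L C)" using assms by (simp add: is_op_inverse_def op_ident_square)
  also have "\<dots> = (B o\<^sub>L A) o\<^sub>L C" by (simp only: blinfun_compose_assoc)
  also have "\<dots> = C" using assms by (simp add: is_op_inverse_def op_ident_square)
  finally show ?thesis .
qed

lemma op_inverse_eq: "is_op_inverse S A B \<Longrightarrow> op_inverse S A = B"
  unfolding op_inverse_def using is_op_inverse_unique by blast

lemma is_op_inverse_compose:
  assumes "is_op_inverse S A A'" "is_op_inverse S B B'" "A \<in> operators S S" "B \<in> operators S S"
  shows "is_op_inverse S (A o\<^sub>L B) (B' o\<^sub>L A')"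
proof (rule is_op_inverseI)
  note a = assms(1,2)[unfolded is_op_inverse_def]
  show "B' o\<^sub>L A' \<in> operators S S" using a by (auto intro: operators_compose)
  have "A o\<^sub>L B o\<^sub>L (B' o\<^sub>L A') = A o\<^sub>L ((B o\<^sub>L B') o\<^sub>L A')" by (simp only: blinfun_compose_assoc)
  then show "A o\<^sub>L B o\<^sub>L (B' o\<^sub>L A') = ident S" using a by (simp add: op_ident_square)
  have "B' o\<^sub>L A' o\<^sub>L (A o\<^sub>L B) = B' o\<^sub>L ((A' o\<^sub>L A) o\<^sub>L B)" by (simp only: blinfun_compose_assoc)
  then show "B' o\<^sub>L A' o\<^sub>L (A o\<^sub>L B) = ident S" using a assms(4) by (simp add: op_ident_square)
qed

definition neumann :: "'a set \<Rightarrow> ('a ell2 \<Rightarrow>\<^sub>L 'a ell2) \<Rightarrow> ('a ell2 \<Rightarrow>\<^sub>L 'a ell2)" where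
  "neumann S N = (\<Sum>k. opow S N k)"

lemma summable_opow:
  assumes "norm N < 1"
  shows "summable (\<lambda>k. norm (opow S N k))"
proof (rule summable_comparison_test')
  show "summable (\<lambda>k. norm N ^ k)" using assms by (intro summable_geometric) simp
qed (simp add: norm_opow_le)

lemma neumann_sums: "norm N < 1 \<Longrightarrow> (\<lambda>k. opow S N k) sums neumann S N"
  unfolding neumann_def by (rule summable_sums[OF summable_norm_cancel[OF summable_opow]])

lemma norm_neumann_le:
  assumes "norm N < 1"
  shows "norm (neumann S N) \<le> 1 / (1 - norm N)"
proof -
  have "norm (neumann S N) \<le> (\<Sum>k. norm (opow S N k))"
    unfolding neumann_def by (rule summable_norm) (rule summable_opow[OF assms])
  also have "\<dots> \<le> (\<Sum>k. norm N ^ k)"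
    using assms by (intro suminf_le norm_opow_le summable_opow summable_geometric) auto
  also have "\<dots> = 1 / (1 - norm N)" by (rule suminf_geometric) (use assms in simp)
  finally show ?thesis .
qed

lemma operators_neumann: "norm N < 1 \<Longrightarrow> N \<in> operators S S \<Longrightarrow> neumann S N \<in> operators S S"
  by (rule operators_sums[OF operators_opow neumann_sums])

lemma is_op_inverse_neumann:
  assumes N: "norm N < 1" "N \<in> operators S S"
  shows "is_op_inverse S (ident S - N) (neumann S N)"
proof (rule is_op_inverseI)
  note W = operators_neumann[OF N]
  show "neumann S N \<in> operators S S" by (rule W)
  have s: "(\<lambda>k. opow S N (Suc k)) sums (neumann S N - ident S)"
    using sums_split_initial_segment[OF neumann_sums[OF N(1), of S], of 1] by simp
  have "(\<lambda>k. N o\<^sub>L opow S N k) sums (N o\<^sub>L neumann S N)"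
    by (rule bounded_linear.sums[OF blinfun_compose.bounded_linear_right neumann_sums[OF N(1)]])
  with s have "N o\<^sub>L neumann S N = neumann S N - ident S"
    by (simp add: opow_Suc sums_unique2)
  then show "(ident S - N) o\<^sub>L neumann S N = ident S"
    by (simp add: blinfun_compose.diff_left op_ident_left[OF W])
  have "(\<lambda>k. opow S N k o\<^sub>L N) sums (neumann S N o\<^sub>L N)"
    by (rule bounded_linear.sums[OF blinfun_compose.bounded_linear_left neumann_sums[OF N(1)]])
  with s have "neumann S N o\<^sub>L N = neumann S N - ident S"
    by (simp add: opow_Suc2[OF N(2)] sums_unique2)
  then show "neumann S N o\<^sub>L (ident S - N) = ident S"
    by (simp add: blinfun_compose.diff_right op_ident_right[OF W])
qed

lemma is_op_inverse_scale:
  assumes "is_op_inverse S A B" "A \<in> operators S S" "c \<noteq> 0"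
  shows "is_op_inverse S (c *\<^sub>O A) ((1 / c) *\<^sub>O B)"
  using assms unfolding is_op_inverse_def
  by (auto simp: op_scale_compose_left op_scale_compose_right op_scale_scale op_scale_one operators_scale)

lemma inverse_exists:
  assumes T: "T \<in> operators S S" "norm T < cmod c"
  obtains W where "is_op_inverse S (c *\<^sub>O ident S - T) W" "norm W \<le> 1 / (cmod c - norm T)"
proof -
  define N where "N = (1 / c) *\<^sub>O T"
  have c: "c \<noteq> 0" "cmod c > 0" using T(2) norm_ge_zero[of T] by fastforce+
  have N: "N \<in> operators S S" "norm N = norm T / cmod c" "norm N < 1"
    using T c by (auto simp: N_def operators_scale norm_op_scale norm_divide divide_simps)
  have "is_op_inverse S (c *\<^sub>O (ident S - N)) ((1 / c) *\<^sub>O neumann S N)"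
    by (rule is_op_inverse_scale) (use N c in \<open>auto simp: is_op_inverse_neumann operators_diff operators_ident\<close>)
  moreover have "c *\<^sub>O (ident S - N) = c *\<^sub>O ident S - T"
    using c by (simp add: N_def op_scale_diff_right op_scale_scale op_scale_one)
  moreover have "norm ((1 / c) *\<^sub>O neumann S N) \<le> 1 / (cmod c - norm T)"
  proof -
    have "norm ((1 / c) *\<^sub>O neumann S N) \<le> (1 / cmod c) * (1 / (1 - norm N))"
      unfolding norm_op_scale norm_divide norm_one
      by (intro mult_left_mono norm_neumann_le N) simp
    also have "\<dots> = 1 / (cmod c - norm T)" using c T(2) by (simp add: N(2) field_simps)
    finally show ?thesis .
  qed
  ultimately show ?thesis using that by simp
qed

section \<open>Resolvents and the spectrum\<close>

definition resolvent :: "'a set \<Rightarrow> ('a ell2 \<Rightarrow>\<^sub>L 'a ell2) \<Rightarrow> complex \<Rightarrow> ('a ell2 \<Rightarrow>\<^sub>L 'a ell2)" where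
  "resolvent S A z = op_inverse S (z *\<^sub>O ident S - A)"

lemma resolvent_inverse: "z \<notin> op_spectrum S A \<Longrightarrow> is_op_inverse S (z *\<^sub>O ident S - A) (resolvent S A z)"
  unfolding op_spectrum_def resolvent_def using op_inverse_eq by fastforce

lemma resolvent_eqI:
  assumes "is_op_inverse S (z *\<^sub>O ident S - A) W"
  shows "z \<notin> op_spectrum S A" "resolvent S A z = W"
  using assms by (auto simp: op_spectrum_def resolvent_def op_inverse_eq)

lemma operators_resolvent: "z \<notin> op_spectrum S A \<Longrightarrow> resolvent S A z \<in> operators S S"
  using resolvent_inverse is_op_inverse_def by blast

lemma resolvent_identity:
  assumes A: "A \<in> operators S S" and z: "z \<notin> op_spectrum S A" "w \<notin> op_spectrum S A"
  shows "resolvent S A z - resolvent S A w = (w - z) *\<^sub>O (resolvent S A z o\<^sub>L resolvent S A w)"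
proof -
  define g h where "g = resolvent S A z" and "h = resolvent S A w"
  note i = resolvent_inverse[OF z(1), folded g_def, unfolded is_op_inverse_def]
    resolvent_inverse[OF z(2), folded h_def, unfolded is_op_inverse_def]
  have "g o\<^sub>L ((w *\<^sub>O ident S - A) o\<^sub>L h) = g" "(g o\<^sub>L (z *\<^sub>O ident S - A)) o\<^sub>L h = h"
    using i op_ident_square[of g S] op_ident_square[of h S] by simp_all
  then have "g - h = (g o\<^sub>L ((w *\<^sub>O ident S - A) o\<^sub>L h)) - ((g o\<^sub>L (z *\<^sub>O ident S - A)) o\<^sub>L h)"
    by (simp only:)
  also have "\<dots> = g o\<^sub>L (((w *\<^sub>O ident S - A) - (z *\<^sub>O ident S - A)) o\<^sub>L h)"
    by (simp add: blinfun_compose_assoc blinfun_compose.diff_right blinfun_compose.diff_left)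
  also have "\<dots> = g o\<^sub>L (((w - z) *\<^sub>O ident S) o\<^sub>L h)" by (simp add: op_scale_diff_left)
  also have "\<dots> = (w - z) *\<^sub>O (g o\<^sub>L h)"
    using i by (simp add: op_scale_compose_left op_ident_square op_scale_compose_right[of g S S])
  finally show ?thesis by (simp add: g_def h_def)
qed

text \<open>Factor z - A = (w - A)(1 - (w - z) R(w)), where R(w) is the resolvent at w. The second
  factor is invertible by the Neumann series, whose norm bound gives the estimate.\<close>

lemma resolvent_near:
  assumes A: "A \<in> operators S S" and w: "w \<notin> op_spectrum S A"
    and d: "cmod (z - w) * norm (resolvent S A w) < 1"
  shows "z \<notin> op_spectrum S A"
    and "norm (resolvent S A z) \<le> norm (resolvent S A w) / (1 - cmod (z - w) * norm (resolvent S A w))"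
proof -
  define h where "h = resolvent S A w"
  have h: "h \<in> operators S S" "is_op_inverse S (w *\<^sub>O ident S - A) h"
    unfolding h_def by (rule operators_resolvent[OF w], rule resolvent_inverse[OF w])
  define T where "T = (w - z) *\<^sub>O h"
  have T: "T \<in> operators S S" "norm T = cmod (z - w) * norm h"
    unfolding T_def using h by (auto intro: operators_scale simp: norm_op_scale norm_minus_commute)
  then have "norm T < cmod 1" using d by (simp add: h_def)
  then obtain M where M: "is_op_inverse S (1 *\<^sub>O ident S - T) M" "norm M \<le> 1 / (cmod 1 - norm T)"
    using inverse_exists[OF T(1), of 1] by blast
  have "is_op_inverse S ((w *\<^sub>O ident S - A) o\<^sub>L (1 *\<^sub>O ident S - T)) (M o\<^sub>L h)"
    by (rule is_op_inverse_compose[OF h(2) M(1)])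
       (auto intro: operators_diff operators_scale operators_ident A T)
  also have "(w *\<^sub>O ident S - A) o\<^sub>L (1 *\<^sub>O ident S - T)
      = (w *\<^sub>O ident S - A) - (w - z) *\<^sub>O ((w *\<^sub>O ident S - A) o\<^sub>L h)"
  proof -
    have "w *\<^sub>O ident S - A \<in> operators S S" by (auto intro: operators_diff operators_scale operators_ident A)
    then show ?thesis
      by (simp add: T_def op_scale_one blinfun_compose.diff_right op_ident_square op_scale_compose_right)
  qed
  also have "\<dots> = z *\<^sub>O ident S - A" using h(2) by (simp add: is_op_inverse_def op_scale_diff_left)
  finally have "is_op_inverse S (z *\<^sub>O ident S - A) (M o\<^sub>L h)" .
  note r = resolvent_eqI[OF this]
  show "z \<notin> op_spectrum S A" by (rule r)
  have "norm (resolvent S A z) \<le> 1 / (cmod 1 - norm T) * norm h"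
    unfolding r(2) by (rule norm_compose_le[OF M(2)]) simp
  then show "norm (resolvent S A z) \<le> norm (resolvent S A w) / (1 - cmod (z - w) * norm (resolvent S A w))"
    by (simp add: T(2) h_def)
qed

lemma eventually_resolvent_near:
  assumes A: "A \<in> operators S S" and w: "w \<notin> op_spectrum S A"
  shows "\<forall>\<^sub>F z in nhds w. z \<notin> op_spectrum S A \<and>
    norm (resolvent S A z - resolvent S A w) \<le> cmod (z - w) * (2 * (norm (resolvent S A w))\<^sup>2)"
proof -
  define h where "h = norm (resolvent S A w)"
  \<comment> \<open>This radius forces |z - w| h <= 1/2, so the resolvent norm at most doubles and
    the resolvent identity yields the constant 2 h^2. The summand 1 keeps the radius defined when h
    = 0.\<close>
  have "\<forall>\<^sub>F z in nhds w. dist z w < 1 / (2 * h + 1)"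
    by (rule eventually_nhds_metric[THEN iffD2]) (rule exI[of _ "1 / (2 * h + 1)"], auto simp: h_def add_nonneg_pos)
  then show ?thesis
  proof eventually_elim
    case (elim z)
    have h0: "0 \<le> h" by (simp add: h_def)
    have "cmod (z - w) * (2 * h + 1) < 1" using elim h0 by (simp add: dist_norm field_simps)
    then have "2 * (cmod (z - w) * h) + cmod (z - w) < 1" by (simp add: algebra_simps)
    then have e: "cmod (z - w) * h \<le> 1 / 2" using norm_ge_zero[of "z - w"] by linarith
    then have "cmod (z - w) * h < 1" by simp
    note n = resolvent_near[OF A w, folded h_def, OF this]
    have "h / (1 - cmod (z - w) * h) \<le> h / (1 / 2)" using e h0 by (intro divide_left_mono) auto
    then have "norm (resolvent S A z) \<le> 2 * h" using n(2) by simp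
    then have "norm (resolvent S A z o\<^sub>L resolvent S A w) \<le> 2 * h * h"
      by (rule norm_compose_le) (simp add: h_def)
    then have "norm (resolvent S A z - resolvent S A w) \<le> cmod (z - w) * (2 * h * h)"
      unfolding resolvent_identity[OF A n(1) w] norm_op_scale
      by (simp add: norm_minus_commute mult_left_mono)
    then show ?case using n(1) by (simp add: h_def power2_eq_square mult.assoc)
  qed
qed

lemma open_resolvent_set:
  assumes "A \<in> operators S S"
  shows "open (- op_spectrum S A)"
proof -
  have "\<forall>\<^sub>F z in nhds w. z \<in> - op_spectrum S A" if "w \<in> - op_spectrum S A" for w
  proof -
    have "w \<notin> op_spectrum S A" using that by simp
    from eventually_resolvent_near[OF assms this] show ?thesis by (rule eventually_mono) simp
  qed
  then show ?thesis by (subst open_subopen) (auto simp: eventually_nhds subset_eq)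
qed

lemma isCont_resolvent:
  assumes A: "A \<in> operators S S" and w: "w \<notin> op_spectrum S A"
  shows "isCont (resolvent S A) w"
proof -
  have "((\<lambda>z. resolvent S A z - resolvent S A w) \<longlongrightarrow> 0) (at w)"
  proof (rule Lim_null_comparison)
    show "\<forall>\<^sub>F z in at w. norm (resolvent S A z - resolvent S A w) \<le> cmod (z - w) * (2 * (norm (resolvent S A w))\<^sup>2)"
      using eventually_resolvent_near[OF A w] unfolding eventually_at_filter by (auto elim: eventually_mono)
    show "((\<lambda>z. cmod (z - w) * (2 * (norm (resolvent S A w))\<^sup>2)) \<longlongrightarrow> 0) (at w)"
      by (rule tendsto_eq_intros refl | simp)+
  qed
  then show ?thesis unfolding isCont_def by (rule LIM_zero_cancel)
qed

text \<open>Complex differentiability is stated for coefficients, because the Cauchy theorems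
  applied later concern complex-valued functions. The resolvent identity turns the difference
  quotient into -R(z) R(w), which converges by continuity of the resolvent.\<close>

lemma resolvent_entry_derivative:
  assumes A: "A \<in> operators S S" and w: "w \<notin> op_spectrum S A"
  shows "((\<lambda>z. coeff (blinfun_apply (resolvent S A z) f) x) has_field_derivative
     - coeff (blinfun_apply (resolvent S A w o\<^sub>L resolvent S A w) f) x) (at w)"
proof -
  define g where "g = resolvent S A"
  have "((\<lambda>z. - coeff (blinfun_apply (g z) (blinfun_apply (g w) f)) x) \<longlongrightarrow>
      - coeff (blinfun_apply (g w) (blinfun_apply (g w) f)) x) (at w)"
    using isCont_resolvent[OF A w] unfolding isCont_def g_def
    by (intro tendsto_minus bounded_linear.tendsto[OF bounded_linear_entry])
  then have "((\<lambda>z. (coeff (blinfun_apply (g z) f) x - coeff (blinfun_apply (g w) f) x) / (z - w))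
      \<longlongrightarrow> - coeff (blinfun_apply (g w) (blinfun_apply (g w) f)) x) (at w)"
  proof (rule Lim_transform_eventually)
    have "\<forall>\<^sub>F z in at w. z \<notin> op_spectrum S A \<and> z \<noteq> w"
      using eventually_resolvent_near[OF A w] unfolding eventually_at_filter by (auto elim: eventually_mono)
    then show "\<forall>\<^sub>F z in at w. - coeff (blinfun_apply (g z) (blinfun_apply (g w) f)) x
        = (coeff (blinfun_apply (g z) f) x - coeff (blinfun_apply (g w) f) x) / (z - w)"
    proof eventually_elim
      case (elim z)
      then have "blinfun_apply (g z - g w) f = blinfun_apply ((w - z) *\<^sub>O (g z o\<^sub>L g w)) f"
        using resolvent_identity[OF A _ w] by (simp add: g_def)
      then have "coeff (blinfun_apply (g z) f) x - coeff (blinfun_apply (g w) f) x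
          = (w - z) * coeff (blinfun_apply (g z) (blinfun_apply (g w) f)) x"
        by (simp add: blinfun.diff_left flip: coeff_diff)
      then show ?case using elim by (simp add: field_simps)
    qed
  qed
  then show ?thesis unfolding has_field_derivative_iff g_def by simp
qed

text \<open>Behaviour at infinity, centred at 1: z - (1 - N) = (z - 1) + N. The last identity
  isolates the leading term 1/(z - 1) of the resolvent, with a remainder that the norm bound makes
  quadratically small.\<close>

lemma resolvent_far:
  assumes N: "N \<in> operators S S" and z: "norm N < cmod (z - 1)"
  shows "z \<notin> op_spectrum S (ident S - N)"
    and "norm (resolvent S (ident S - N) z) \<le> 1 / (cmod (z - 1) - norm N)"
    and "(z - 1) *\<^sub>O resolvent S (ident S - N) z = ident S - (N o\<^sub>L resolvent S (ident S - N) z)"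
proof -
  have e: "(z - 1) *\<^sub>O ident S - (- N) = z *\<^sub>O ident S - (ident S - N)"
    by (simp add: op_scale_diff_left op_scale_one)
  obtain W where W: "is_op_inverse S (z *\<^sub>O ident S - (ident S - N)) W" "norm W \<le> 1 / (cmod (z - 1) - norm N)"
    using inverse_exists[OF operators_uminus[OF N], of "z - 1"] z unfolding e by auto
  note r = resolvent_eqI[OF W(1)]
  show "z \<notin> op_spectrum S (ident S - N)" "norm (resolvent S (ident S - N) z) \<le> 1 / (cmod (z - 1) - norm N)"
    using r W(2) by auto
  have "((z - 1) *\<^sub>O ident S - (- N)) o\<^sub>L W = ident S" using W(1) unfolding e by (simp add: is_op_inverse_def)
  moreover have "W \<in> operators S S" using W(1) by (simp add: is_op_inverse_def)
  ultimately have "(z - 1) *\<^sub>O W + (N o\<^sub>L W) = ident S"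
    by (simp add: blinfun_compose.add_left op_scale_compose_left op_ident_square)
  then show "(z - 1) *\<^sub>O resolvent S (ident S - N) z = ident S - (N o\<^sub>L resolvent S (ident S - N) z)"
    unfolding r(2) by (simp add: algebra_simps)
qed

subsection \<open>Contour integrals of operator-valued functions\<close>

text \<open>A valid path need not be rectifiable, so integrability in the operator norm is obtained from
  local primitives rather than from boundedness of the integrand.\<close>

lemma operator_local_primitive:
  fixes h :: "complex \<Rightarrow> ('a ell2 \<Rightarrow>\<^sub>L 'b ell2)"
  assumes cont: "continuous_on (ball w r) h"
    and hol: "\<And>f x. (\<lambda>z. coeff (blinfun_apply (h z) f) x) holomorphic_on ball w r"
  obtains H where "\<And>z. z \<in> ball w r \<Longrightarrow> (H has_derivative (\<lambda>c. c *\<^sub>O h z)) (at z)"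
proof (cases "r > 0")
  case False
  then have "ball w r = {}" by simp
  then show ?thesis using that by blast
next
  case True
  \<comment> \<open>The primitive will be the integral along the segment from the centre w of the
    ball.\<close>
  define seg where "seg p q = integral {0..1} (\<lambda>t. (q - p) *\<^sub>O h (linepath p q t))" for p q
  have inb: "linepath p q t \<in> ball w r" if "p \<in> ball w r" "q \<in> ball w r" "t \<in> {0..1}" for p q t
  proof -
    have "linepath p q t \<in> closed_segment p q" using that(3) by (metis imageI linepath_image_01)
    moreover have "closed_segment p q \<subseteq> ball w r" using that by (intro closed_segment_subset) auto
    ultimately show ?thesis by blast
  qed
  have ch: "continuous_on {0..1} (\<lambda>t. h (linepath p q t))" if "p \<in> ball w r" "q \<in> ball w r" for p q
    by (rule continuous_on_compose2[OF cont]) (use inb[OF that] in \<open>auto intro: continuous_intros\<close>)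
  have ci: "continuous_on {0..1} (\<lambda>t. (q - p) *\<^sub>O h (linepath p q t))"
    if "p \<in> ball w r" "q \<in> ball w r" for p q
    by (intro bounded_bilinear.continuous_on[OF bounded_bilinear_op_scale] ch that continuous_intros)
  have sc: "((\<lambda>z. coeff (blinfun_apply (h z) f) x) has_contour_integral
      coeff (blinfun_apply (seg p q) f) x) (linepath p q)"
    if "p \<in> ball w r" "q \<in> ball w r" for p q f x
  proof -
    have "((\<lambda>t. (q - p) *\<^sub>O h (linepath p q t)) has_integral seg p q) {0..1}"
      unfolding seg_def by (intro integrable_integral integrable_continuous_interval ci that)
    from has_integral_linear[OF this bounded_linear_entry[of f x]]
    show ?thesis unfolding has_contour_integral_linepath by (simp add: o_def mult.commute)
  qed
  \<comment> \<open>Additivity is Cauchy's theorem for the triangle w, z, y, applied to each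
    coefficient. It reduces the increment of the primitive to the short segment from z to y, on
    which h is nearly constant.\<close>
  have add: "seg w y = seg w z + seg z y" if z: "z \<in> ball w r" and y: "y \<in> ball w r" for z y
  proof (rule blinfun_eqI, rule ell2_eqI)
    fix f x
    let ?g = "\<lambda>z. coeff (blinfun_apply (h z) f) x"
    have w: "w \<in> ball w r" using True by simp
    have "convex hull {w, z, y} \<subseteq> ball w r" by (rule hull_minimal) (use w z y in auto)
    then have "(?g has_contour_integral 0) (linepath w z +++ linepath z y +++ linepath y w)"
      by (intro Cauchy_theorem_triangle holomorphic_on_subset[OF hol])
    from has_chain_integral_chain_integral3[OF this]
    have "contour_integral (linepath w z) ?g + contour_integral (linepath z y) ?g + contour_integral (linepath y w) ?g = 0" .
    moreover have "contour_integral (linepath y w) ?g = - contour_integral (linepath w y) ?g"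
      using contour_integral_unique[OF has_contour_integral_reversepath[OF valid_path_linepath sc[OF w y, of f x]]]
        contour_integral_unique[OF sc[OF w y, of f x]] by simp
    ultimately show "coeff (blinfun_apply (seg w y) f) x = coeff (blinfun_apply (seg w z + seg z y) f) x"
      using contour_integral_unique[OF sc[OF w z, of f x]] contour_integral_unique[OF sc[OF z y, of f x]]
        contour_integral_unique[OF sc[OF w y, of f x]]
      by (simp add: blinfun.add_left)
  qed
  have "(seg w has_derivative (\<lambda>c. c *\<^sub>O h z)) (at z)" if z: "z \<in> ball w r" for z
    unfolding has_derivative_at_alt
  proof (intro conjI allI impI)
    show "bounded_linear (\<lambda>c. c *\<^sub>O h z)"
      by (rule bounded_bilinear.bounded_linear_left[OF bounded_bilinear_op_scale])
    fix e :: real assume e: "e > 0"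
    have "isCont h z" using cont z by (simp add: continuous_on_eq_continuous_at)
    then obtain d1 where d1: "d1 > 0" "\<And>v. dist v z < d1 \<Longrightarrow> dist (h v) (h z) < e"
      unfolding continuous_at_eps_delta using e by blast
    obtain d2 where d2: "d2 > 0" "ball z d2 \<subseteq> ball w r" using z open_contains_ball open_ball by blast
    show "\<exists>d>0. \<forall>y. norm (y - z) < d \<longrightarrow> norm (seg w y - seg w z - (y - z) *\<^sub>O h z) \<le> e * norm (y - z)"
    proof (intro exI[of _ "min d1 d2"] conjI allI impI)
      show "min d1 d2 > 0" using d1 d2 by simp
      fix y assume y: "norm (y - z) < min d1 d2"
      then have yb: "y \<in> ball w r" using d2 by (auto simp: dist_norm norm_minus_commute subset_eq)
      have "seg w y - seg w z - (y - z) *\<^sub>O h z = seg z y - integral {0..1} (\<lambda>t::real. (y - z) *\<^sub>O h z)"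
        using integral_unique[OF has_integral_const_real[of "(y - z) *\<^sub>O h z" 0 1]]
        by (simp add: add[OF z yb])
      also have "\<dots> = integral {0..1} (\<lambda>t. (y - z) *\<^sub>O h (linepath z y t) - (y - z) *\<^sub>O h z)"
        unfolding seg_def
        by (rule integral_diff[symmetric]) (intro integrable_continuous_interval ci z yb continuous_intros)+
      finally have eq: "seg w y - seg w z - (y - z) *\<^sub>O h z
          = integral {0..1} (\<lambda>t. (y - z) *\<^sub>O h (linepath z y t) - (y - z) *\<^sub>O h z)" .
      have "norm (seg w y - seg w z - (y - z) *\<^sub>O h z) \<le> (norm (y - z) * e) * (1 - 0)"
        unfolding eq
      proof (rule integral_bound)
        fix t :: real assume t: "t \<in> {0..1}"
        have "linepath z y t - z = t *\<^sub>R (y - z)" by (simp add: linepath_def algebra_simps)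
        then have "dist (linepath z y t) z = \<bar>t\<bar> * norm (y - z)" by (simp add: dist_norm norm_mult)
        also have "\<dots> \<le> 1 * norm (y - z)" using t by (intro mult_right_mono) auto
        finally have "dist (h (linepath z y t)) (h z) < e" using y by (intro d1) simp
        then show "norm ((y - z) *\<^sub>O h (linepath z y t) - (y - z) *\<^sub>O h z) \<le> norm (y - z) * e"
          unfolding op_scale_diff_right[symmetric] norm_op_scale
          by (intro mult_left_mono) (auto simp: dist_norm)
      qed (auto intro!: continuous_intros ci z yb)
      then show "norm (seg w y - seg w z - (y - z) *\<^sub>O h z) \<le> e * norm (y - z)" by (simp add: mult.commute)
    qed
  qed
  then show ?thesis using that by blast
qed

text \<open>Integrability is local on the parameter interval. Near each parameter value the
  integrand is the derivative of a local primitive H composed with the path, except at the finitely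
  many corners of the path, which the strong form of the fundamental theorem permits.\<close>

lemma operator_path_integrable:
  fixes h :: "complex \<Rightarrow> ('a ell2 \<Rightarrow>\<^sub>L 'b ell2)"
  assumes \<Omega>: "open \<Omega>" and path: "valid_path \<Lambda>" "path_image \<Lambda> \<subseteq> \<Omega>"
    and cont: "continuous_on \<Omega> h"
    and hol: "\<And>f x. (\<lambda>z. coeff (blinfun_apply (h z) f) x) holomorphic_on \<Omega>"
  shows "(\<lambda>t. vector_derivative \<Lambda> (at t within {0..1}) *\<^sub>O h (\<Lambda> t)) integrable_on {0..1}"
proof -
  let ?F = "\<lambda>t. vector_derivative \<Lambda> (at t within {0..1}) *\<^sub>O h (\<Lambda> t)"
  obtain K where K: "finite K" "\<Lambda> C1_differentiable_on ({0..1} - K)" and cl: "continuous_on {0..1} \<Lambda>"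
    using path(1) unfolding valid_path_def piecewise_C1_differentiable_on_def by blast
  obtain D where D: "\<And>t. t \<in> {0..1} - K \<Longrightarrow> (\<Lambda> has_vector_derivative D t) (at t)"
    using K(2) unfolding C1_differentiable_on_def by blast
  have "?F integrable_on cbox 0 1"
  proof (rule integrable_on_little_subintervals, intro ballI)
    fix s :: real assume s: "s \<in> cbox 0 1"
    then have "\<Lambda> s \<in> \<Omega>" using path(2) by (auto simp: path_image_def)
    then obtain r where r: "r > 0" "ball (\<Lambda> s) r \<subseteq> \<Omega>" using \<Omega> open_contains_ball by blast
    obtain H where H: "\<And>z. z \<in> ball (\<Lambda> s) r \<Longrightarrow> (H has_derivative (\<lambda>c. c *\<^sub>O h z)) (at z)"
      using operator_local_primitive[OF continuous_on_subset[OF cont r(2)] holomorphic_on_subset[OF hol r(2)]] by blast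
    have "\<exists>d>0. \<forall>t\<in>{0..1}. dist t s < d \<longrightarrow> dist (\<Lambda> t) (\<Lambda> s) < r"
      using cl s r(1) unfolding continuous_on_iff by auto
    then obtain d where d: "d > 0" "\<And>t. t \<in> {0..1} \<Longrightarrow> dist t s < d \<Longrightarrow> dist (\<Lambda> t) (\<Lambda> s) < r"
      by blast
    show "\<exists>d>0. \<forall>u v. s \<in> cbox u v \<and> cbox u v \<subseteq> ball s d \<and> cbox u v \<subseteq> cbox 0 1 \<longrightarrow> ?F integrable_on cbox u v"
    proof (intro exI[of _ d] conjI allI impI d(1))
      fix u v assume uv: "s \<in> cbox u v \<and> cbox u v \<subseteq> ball s d \<and> cbox u v \<subseteq> cbox 0 1"
      have inr: "\<Lambda> t \<in> ball (\<Lambda> s) r" "t \<in> {0..1}" if "t \<in> {u..v}" for t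
      proof -
        have "t \<in> ball s d" "t \<in> cbox 0 1" using uv that by auto
        then show "t \<in> {0..1}" by simp
        then show "\<Lambda> t \<in> ball (\<Lambda> s) r" using d(2)[of t] \<open>t \<in> ball s d\<close> by (simp add: dist_commute)
      qed
      have "(?F has_integral (H (\<Lambda> v) - H (\<Lambda> u))) {u..v}"
      proof (rule fundamental_theorem_of_calculus_interior_strong[OF K(1)])
        show "u \<le> v" using uv by auto
        fix t assume t: "t \<in> {u<..<v} - K"
        then have t': "t \<in> {u..v}" by simp
        then have t01: "t \<in> {0..1}" by (rule inr)
        have Dt: "(\<Lambda> has_vector_derivative D t) (at t)" using t t01 by (intro D) auto
        have vd: "vector_derivative \<Lambda> (at t within {0..1}) = D t"
          using t01 by (intro vector_derivative_at_within_ivl[OF Dt]) auto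
        have "((\<lambda>t. H (\<Lambda> t)) has_derivative (\<lambda>x. (x *\<^sub>R D t) *\<^sub>O h (\<Lambda> t))) (at t)"
          by (rule has_derivative_compose[OF Dt[unfolded has_vector_derivative_def] H[OF inr(1)[OF t']]])
        then show "((\<lambda>t. H (\<Lambda> t)) has_vector_derivative ?F t) (at t)"
          unfolding has_vector_derivative_def vd
          by (simp add: scaleR_op op_scale_scale scaleR_conv_of_real)
      next
        show "continuous_on {u..v} (\<lambda>t. H (\<Lambda> t))"
        proof (rule continuous_on_compose2[of "ball (\<Lambda> s) r" H])
          show "continuous_on (ball (\<Lambda> s) r) H"
            using H has_derivative_continuous by (intro continuous_at_imp_continuous_on) blast
          show "continuous_on {u..v} \<Lambda>" by (rule continuous_on_subset[OF cl]) (use inr in auto)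
        qed (use inr in auto)
      qed
      then show "?F integrable_on cbox u v" by (auto simp: integrable_on_def)
    qed
  qed
  then show ?thesis by simp
qed

text \<open>Existence of the operator integral is already known; its value is identified by the
  functionals \<open>coeff (blinfun_apply _ f) x\<close>, which are continuous, separate operators,
  and turn it into a scalar contour integral.\<close>

lemma operator_contour_integral:
  fixes h :: "complex \<Rightarrow> ('a ell2 \<Rightarrow>\<^sub>L 'b ell2)"
  assumes "open \<Omega>" "valid_path \<Lambda>" "path_image \<Lambda> \<subseteq> \<Omega>" "continuous_on \<Omega> h"
    and "\<And>f x. (\<lambda>z. coeff (blinfun_apply (h z) f) x) holomorphic_on \<Omega>"
    and B: "\<And>f x. ((\<lambda>z. coeff (blinfun_apply (h z) f) x) has_contour_integral coeff (blinfun_apply B f) x) \<Lambda>"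
  shows "((\<lambda>t. vector_derivative \<Lambda> (at t within {0..1}) *\<^sub>O h (\<Lambda> t)) has_integral B) {0..1}"
proof -
  obtain I where I: "((\<lambda>t. vector_derivative \<Lambda> (at t within {0..1}) *\<^sub>O h (\<Lambda> t)) has_integral I) {0..1}"
    using operator_path_integrable[OF assms(1-5)] by (auto simp: integrable_on_def)
  have "I = B"
  proof (rule blinfun_eqI, rule ell2_eqI)
    fix f x
    have "((\<lambda>t. coeff (blinfun_apply (h (\<Lambda> t)) f) x * vector_derivative \<Lambda> (at t within {0..1}))
        has_integral coeff (blinfun_apply I f) x) {0..1}"
      using has_integral_linear[OF I bounded_linear_entry[of f x]] by (simp add: o_def mult.commute)
    then show "coeff (blinfun_apply I f) x = coeff (blinfun_apply B f) x"
      using B[of f x] has_integral_unique unfolding has_contour_integral_def by blast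
  qed
  then show ?thesis using I by simp
qed

text \<open>Joining the contour to a large circle inside the exterior of the contour produces a cycle
  that does not wind around any point of \<open>K\<close>.\<close>

lemma contour_integral_eq_large_circle:
  assumes K: "open (- K)" and F: "F holomorphic_on - K"
    and path: "valid_path \<Lambda>" "simple_path \<Lambda>" "pathfinish \<Lambda> = pathstart \<Lambda>"
    and ins: "K \<subseteq> inside (path_image \<Lambda>)"
    and wn: "\<And>z. z \<in> inside (path_image \<Lambda>) \<Longrightarrow> winding_number \<Lambda> z = 1"
    and \<rho>: "path_image \<Lambda> \<subseteq> ball a \<rho>"
  shows "contour_integral \<Lambda> F = contour_integral (circlepath a \<rho>) F"
    and "F contour_integrable_on \<Lambda>" "F contour_integrable_on circlepath a \<rho>"
proof -
  let ?P = "path_image \<Lambda>" and ?C = "circlepath a \<rho>"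
  have J: "connected (outside ?P)" "frontier (outside ?P) = ?P" "inside ?P \<inter> outside ?P = {}"
    using Jordan_inside_outside[OF path(2,3)] by auto
  have out: "- ball a \<rho> \<subseteq> outside ?P" by (rule outside_subset_convex[OF convex_ball \<rho>])
  have \<rho>0: "\<rho> > 0"
    using \<rho> pathstart_in_path_image[of \<Lambda>] by (metis ball_eq_empty empty_iff not_le subsetD)
  have KK: "K \<inter> ?P = {}" using ins inside_no_overlap by blast
  have KB: "K \<subseteq> ball a \<rho>" using ins out J(3) by blast
  have Cimg: "path_image ?C \<subseteq> - K"
    using KB \<rho>0 by auto
  have Cout: "path_image ?C \<subseteq> outside ?P" using out \<rho>0 by auto
  \<comment> \<open>By the Jordan curve theorem T is the closure of the connected exterior. It
    avoids K and meets both curves, so a path joining their base points can be taken in one open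
    component of the complement of K.\<close>
  define T where "T = outside ?P \<union> ?P"
  have "T = closure (outside ?P)"
    unfolding T_def closure_Un_frontier J(2) by simp
  then have T: "connected T" using J(1) connected_imp_connected_closure by simp
  have TK: "T \<subseteq> - K" using ins KK J(3) unfolding T_def by blast
  define W where "W = connected_component_set (- K) (pathstart \<Lambda>)"
  have sT: "pathstart \<Lambda> \<in> T" "pathstart ?C \<in> T"
    using Cout pathstart_in_path_image[of \<Lambda>] pathstart_in_path_image[of ?C] unfolding T_def by blast+
  have W: "open W" "connected W" "T \<subseteq> W" "W \<subseteq> - K"
    unfolding W_def using open_connected_component[OF K] connected_component_maximal[OF sT(1) T TK]
      connected_connected_component connected_component_subset[of "- K" "pathstart \<Lambda>"] by blast+
  obtain p where p: "polynomial_function p" "path_image p \<subseteq> W" "pathstart p = pathstart \<Lambda>" "pathfinish p = pathstart ?C"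
    using connected_open_polynomial_connected[OF W(1,2), of "pathstart \<Lambda>" "pathstart ?C"] sT W(3) by blast
  have vp: "valid_path p" using p(1) by (rule valid_path_polynomial_function)
  have pK: "path_image p \<subseteq> - K" using p(2) W(4) by blast
  have LK: "?P \<subseteq> - K" using KK by blast
  define \<gamma> where "\<gamma> = \<Lambda> +++ (p +++ (reversepath ?C +++ reversepath p))"
  note ends = path(3) p(3,4)
  have v\<gamma>: "valid_path \<gamma>" unfolding \<gamma>_def
    using path(1) vp ends by (intro valid_path_join) (auto simp: valid_path_imp_reverse)
  have im\<gamma>: "path_image \<gamma> \<subseteq> - K" unfolding \<gamma>_def using LK pK Cimg ends
    by (auto simp: path_image_join)
  have loop: "pathfinish \<gamma> = pathstart \<gamma>" unfolding \<gamma>_def using ends by simp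
  have pa: "path \<Lambda>" "path p" "path ?C" using path(1) vp by (auto simp: valid_path_imp_path)
  \<comment> \<open>Around a point of K the contour contributes 1 and the reversed circle -1, while
    the connecting path is traversed in both directions and cancels.\<close>
  have "winding_number \<gamma> w = 0" if "w \<notin> - K" for w
  proof -
    have w: "w \<in> K" using that by simp
    then have nin: "w \<notin> ?P" "w \<notin> path_image p" "w \<notin> path_image ?C" using LK pK Cimg by blast+
    have 1: "winding_number (reversepath ?C +++ reversepath p) w = - 1 - winding_number p w"
      using nin pa ends w KB
      by (subst winding_number_join)
         (auto simp: winding_number_reversepath winding_number_circlepath dist_norm norm_minus_commute subset_eq)
    have 2: "w \<notin> path_image (reversepath ?C +++ reversepath p)"
      using nin ends by (subst path_image_join) auto
    have 3: "winding_number (p +++ (reversepath ?C +++ reversepath p)) w = - 1"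
      using nin pa ends 1 2 by (subst winding_number_join) auto
    have 4: "w \<notin> path_image (p +++ (reversepath ?C +++ reversepath p))"
      using nin ends 2 by (subst path_image_join) auto
    show ?thesis unfolding \<gamma>_def using nin pa ends 3 4 wn ins w
      by (subst winding_number_join) auto
  qed
  from Cauchy_theorem_global[OF K F v\<gamma> loop im\<gamma> this]
  have 0: "contour_integral \<gamma> F = 0" by (rule contour_integral_unique)
  have int: "F contour_integrable_on \<Lambda>" "F contour_integrable_on p" "F contour_integrable_on ?C"
    using contour_integrable_holomorphic_simple[OF F K] path(1) vp LK pK Cimg by auto
  then show "F contour_integrable_on \<Lambda>" "F contour_integrable_on ?C" by auto
  show "contour_integral \<Lambda> F = contour_integral ?C F"
    using 0 int path(1) vp ends unfolding \<gamma>_def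
    by (simp add: contour_integrable_reversepath contour_integral_reversepath valid_path_imp_reverse)
qed

section \<open>The integral of the resolvent around the spectrum\<close>

lemma resolvent_spectrum_bound:
  assumes "N \<in> operators S S"
  shows "op_spectrum S (ident S - N) \<subseteq> cball 1 (norm N)"
  using resolvent_far(1)[OF assms] by (force simp: dist_norm norm_minus_commute)

lemma resolvent_entry_holomorphic:
  "A \<in> operators S S \<Longrightarrow> (\<lambda>z. coeff (blinfun_apply (resolvent S A z) f) x) holomorphic_on - op_spectrum S A"
  using resolvent_entry_derivative[of A S]
  by (subst holomorphic_on_open) (auto simp: open_resolvent_set)

text \<open>The Riesz projection of the entire spectrum is the identity. The contour may be replaced
  by any large circle about 1; there the coefficient differs from c / (z - 1) by O(rho^(-2)), while
  the length is 2 pi rho. The value is independent of rho, so the discrepancy is zero.\<close>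

lemma contour_integral_resolvent:
  assumes N: "N \<in> operators S S"
    and path: "valid_path \<Lambda>" "simple_path \<Lambda>" "pathfinish \<Lambda> = pathstart \<Lambda>"
    and ins: "op_spectrum S (ident S - N) \<subseteq> inside (path_image \<Lambda>)"
    and wn: "\<And>z. z \<in> inside (path_image \<Lambda>) \<Longrightarrow> winding_number \<Lambda> z = 1"
  shows "((\<lambda>z. coeff (blinfun_apply (resolvent S (ident S - N) z) f) x)
    has_contour_integral 2 * of_real pi * \<i> * coeff (blinfun_apply (ident S) f) x) \<Lambda>"
proof -
  define A where "A = ident S - N"
  have A: "A \<in> operators S S" unfolding A_def by (intro operators_diff operators_ident N)
  define F where "F z = coeff (blinfun_apply (resolvent S A z) f) x" for z
  define c where "c = coeff (blinfun_apply (ident S) f) x"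
  have hol: "F holomorphic_on - op_spectrum S A"
    unfolding F_def by (rule resolvent_entry_holomorphic[OF A])
  note large = contour_integral_eq_large_circle[OF open_resolvent_set[OF A] hol path ins[folded A_def]]
  have "bounded (path_image \<Lambda>)" using path(1) by (simp add: bounded_path_image valid_path_imp_path)
  then obtain M0 where M0: "path_image \<Lambda> \<subseteq> ball 1 M0" using bounded_subset_ballD by blast
  define M where "M = max M0 0 + norm N + 1"
  have M: "path_image \<Lambda> \<subseteq> ball 1 \<rho>" "\<rho> > norm N" "\<rho> > 0" if "\<rho> \<ge> M" for \<rho>
  proof -
    have "M0 \<le> \<rho>" using that norm_ge_zero[of N] unfolding M_def by linarith
    then show "path_image \<Lambda> \<subseteq> ball 1 \<rho>" using M0 by auto
    show "\<rho> > norm N" "\<rho> > 0" using that norm_ge_zero[of N] unfolding M_def by linarith+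
  qed
  define J where "J = contour_integral \<Lambda> F"
  have bound: "cmod (J - 2 * of_real pi * \<i> * c) * (\<rho> - norm N) \<le> 2 * pi * norm N * norm f" if \<rho>: "\<rho> \<ge> M" for \<rho>
  proof -
    note m = M[OF \<rho>]
    have J: "(F has_contour_integral J) (circlepath 1 \<rho>)"
      using has_contour_integral_integral[OF large(3)[OF wn m(1)]] large(1)[OF wn m(1)] by (simp add: J_def)
    have "((\<lambda>z. c / (z - 1)) has_contour_integral (2 * of_real pi * \<i> * c)) (circlepath 1 \<rho>)"
      using Cauchy_integral_circlepath_simple[of "\<lambda>_. c" 1 \<rho> 1] m(3) by simp
    from has_contour_integral_diff[OF J this]
    have "cmod (J - 2 * of_real pi * \<i> * c) \<le> (norm N * norm f / ((\<rho> - norm N) * \<rho>)) * (2 * pi * \<rho>)"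
    proof (rule has_contour_integral_bound_circlepath)
      show "0 \<le> norm N * norm f / ((\<rho> - norm N) * \<rho>)" using m by simp
      fix z assume z: "cmod (z - 1) = \<rho>"
      then have zN: "norm N < cmod (z - 1)" using m by simp
      note far = resolvent_far[OF N this, folded A_def]
      have "(z - 1) * F z = c - coeff (blinfun_apply N (blinfun_apply (resolvent S A z) f)) x"
        using arg_cong[OF far(3), of "\<lambda>T. coeff (blinfun_apply T f) x"]
        by (simp add: F_def c_def blinfun.diff_left)
      then have "F z - c / (z - 1) = - coeff (blinfun_apply N (blinfun_apply (resolvent S A z) f)) x / (z - 1)"
        using z m(3) by (auto simp: field_simps)
      then have "cmod (F z - c / (z - 1)) = cmod (coeff (blinfun_apply N (blinfun_apply (resolvent S A z) f)) x) / \<rho>"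
        using z by (simp add: norm_divide)
      also have "\<dots> \<le> (norm N * (1 / (\<rho> - norm N) * norm f)) / \<rho>"
      proof (rule divide_right_mono)
        have "norm (blinfun_apply (resolvent S A z) f) \<le> 1 / (\<rho> - norm N) * norm f"
          using mult_right_mono[OF far(2), of "norm f"] z by (intro order_trans[OF norm_blinfun]) simp
        then show "cmod (coeff (blinfun_apply N (blinfun_apply (resolvent S A z) f)) x)
            \<le> norm N * (1 / (\<rho> - norm N) * norm f)"
          by (rule order_trans[OF coeff_le_norm order_trans[OF norm_blinfun mult_left_mono]]) simp
      qed (use m in simp)
      also have "\<dots> = norm N * norm f / ((\<rho> - norm N) * \<rho>)" by simp
      finally show "cmod (F z - c / (z - 1)) \<le> norm N * norm f / ((\<rho> - norm N) * \<rho>)" .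
    qed (rule m)
    also have "\<dots> = 2 * pi * norm N * norm f / (\<rho> - norm N)" using m by (simp add: field_simps)
    finally show ?thesis using m by (simp add: field_simps)
  qed
  have "J = 2 * of_real pi * \<i> * c"
  proof (rule ccontr)
    assume ne: "J \<noteq> 2 * of_real pi * \<i> * c"
    define \<delta> where "\<delta> = cmod (J - 2 * of_real pi * \<i> * c)"
    have \<delta>: "\<delta> > 0" using ne by (simp add: \<delta>_def)
    have M0': "M > 0" "M > norm N" using M[OF order_refl] by auto
    \<comment> \<open>Chosen so that delta (rho - ||N||) exceeds the bound 2 pi ||N|| ||f|| by
      exactly delta (M - ||N||) > 0.\<close>
    define \<rho> where "\<rho> = M + 2 * pi * norm N * norm f / \<delta>"
    have "\<rho> \<ge> M" using \<delta> by (simp add: \<rho>_def)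
    from bound[OF this] have "\<delta> * (\<rho> - norm N) \<le> 2 * pi * norm N * norm f"
      unfolding \<delta>_def .
    moreover have "\<delta> * (\<rho> - norm N) = \<delta> * (M - norm N) + 2 * pi * norm N * norm f"
      using \<delta> by (simp add: \<rho>_def field_simps)
    ultimately have "\<delta> * (M - norm N) + 2 * pi * norm N * norm f \<le> 2 * pi * norm N * norm f"
      by simp
    moreover have "\<delta> * (M - norm N) > 0" using \<delta> M0' by simp
    ultimately show False by linarith
  qed
  then show ?thesis
    using has_contour_integral_integral[OF large(2)[OF wn M(1)[OF order_refl]]]
    unfolding J_def F_def c_def A_def by simp
qed

subsection \<open>The logarithm of an operator close to the identity\<close>

text \<open>The Mercator series of log(1 - N).\<close>

definition log_series :: "'a set \<Rightarrow> ('a ell2 \<Rightarrow>\<^sub>L 'a ell2) \<Rightarrow> ('a ell2 \<Rightarrow>\<^sub>L 'a ell2)" where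
  "log_series S N = - (\<Sum>k. (1 / real (Suc k)) *\<^sub>R opow S N (Suc k))"

lemma summable_log_series:
  assumes "norm N < 1"
  shows "summable (\<lambda>k. (1 / real (Suc k)) *\<^sub>R opow S N (Suc k))"
proof (rule summable_norm_cancel, rule summable_comparison_test')
  show "summable (\<lambda>k. norm N ^ k)" using assms by (intro summable_geometric) simp
  fix k
  have "norm ((1 / real (Suc k)) *\<^sub>R opow S N (Suc k)) \<le> 1 * norm N ^ Suc k"
    unfolding norm_scaleR by (intro mult_mono norm_opow_le) auto
  also have "\<dots> \<le> norm N ^ k" using assms by (simp add: mult_left_le_one_le)
  finally show "norm (norm ((1 / real (Suc k)) *\<^sub>R opow S N (Suc k))) \<le> norm N ^ k" by simp
qed

lemma log_series_sums:
  "norm N < 1 \<Longrightarrow> (\<lambda>k. (1 / real (Suc k)) *\<^sub>R opow S N (Suc k)) sums (- log_series S N)"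
  unfolding log_series_def using summable_sums[OF summable_log_series] by simp

lemma operators_log_series:
  assumes "norm N < 1" "N \<in> operators S S"
  shows "log_series S N \<in> operators S S"
  using operators_uminus[OF operators_sums[OF _ log_series_sums[OF assms(1)]], of S S S]
  by (simp add: operators_scaleR operators_opow assms(2))

text \<open>For r <= 1 the ball lies in the right half-plane, where the principal logarithm is
  holomorphic. Both functions then have derivative 1/z and the value 0 at 1.\<close>

lemma log_branch_eq_Ln:
  assumes "log_branch D L" "L 1 = 0" "ball 1 r \<subseteq> D" "r \<le> 1" "z \<in> ball 1 r"
  shows "L z = Ln z"
proof -
  have r: "r > 0" using assms(5) by (metis ball_eq_empty empty_iff not_le)
  have "((\<lambda>z. L z - Ln z) has_field_derivative 0) (at z within ball 1 r)" if z: "z \<in> ball 1 r" for z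
  proof -
    have zD: "z \<in> D" "open D" "L holomorphic_on D" and ex: "\<And>z. z \<in> D \<Longrightarrow> exp (L z) = z"
      using assms(1,3) z by (auto simp: log_branch_def)
    have "cmod (z - 1) < 1" using z assms(4) by (simp add: dist_norm norm_minus_commute)
    then have "Re z > 0" using abs_Re_le_cmod[of "z - 1"] by simp
    then have nz: "z \<notin> \<real>\<^sub>\<le>\<^sub>0" by (auto simp: complex_nonpos_Reals_iff)
    have z0: "z \<noteq> 0" using nz by auto
    have d: "(L has_field_derivative deriv L z) (at z)" by (rule holomorphic_derivI[OF zD(3,2,1)])
    have "((\<lambda>z. exp (L z)) has_field_derivative exp (L z) * deriv L z) (at z)"
      by (rule DERIV_chain'[OF d]) (rule DERIV_exp)
    moreover have "((\<lambda>z. exp (L z)) has_field_derivative 1) (at z)"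
      by (rule has_field_derivative_transform_within_open[of "\<lambda>z. z" _ _ D]) (use ex zD in auto)
    ultimately have "exp (L z) * deriv L z = 1" by (rule DERIV_unique)
    then have "deriv L z = 1 / z" using ex[OF zD(1)] z0 by (simp add: field_simps)
    then have "((\<lambda>z. L z - Ln z) has_field_derivative (1 / z - inverse z)) (at z)"
      using d by (intro DERIV_diff has_field_derivative_Ln nz) auto
    then show ?thesis by (simp add: field_simps has_field_derivative_at_within)
  qed
  from has_field_derivative_zero_constant[OF convex_ball this]
  obtain c where "\<And>z. z \<in> ball 1 r \<Longrightarrow> L z - Ln z = c" by blast
  from this[of 1] this[of z] show ?thesis using r assms(2,5) by simp
qed

text \<open>The divided difference \<open>(L(z) - log A) / (z - A)\<close> at \<open>A = 1 - N\<close>, expanded in \<open>w = 1 - z\<close>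
  and \<open>N\<close>; unlike the resolvent it has no singularity on the spectrum.\<close>

definition log_quotient_term :: "'a set \<Rightarrow> ('a ell2 \<Rightarrow>\<^sub>L 'a ell2) \<Rightarrow> complex \<Rightarrow> nat \<Rightarrow> ('a ell2 \<Rightarrow>\<^sub>L 'a ell2)" where
  "log_quotient_term S N w k = (1 / real (Suc k)) *\<^sub>R (\<Sum>j\<le>k. w ^ j *\<^sub>O opow S N (k - j))"

text \<open>The term averages k + 1 products, each of total degree k in w and N.\<close>

lemma norm_log_quotient_term_le:
  assumes "norm N \<le> r" "cmod w \<le> r"
  shows "norm (log_quotient_term S N w k) \<le> r ^ k"
proof -
  have r: "0 \<le> r" using assms(2) norm_ge_zero order_trans by blast
  have "norm (\<Sum>j\<le>k. w ^ j *\<^sub>O opow S N (k - j)) \<le> (\<Sum>j\<le>k. r ^ k)"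
  proof (rule sum_norm_le)
    fix j assume j: "j \<in> {..k}"
    have "norm (w ^ j *\<^sub>O opow S N (k - j)) \<le> r ^ j * r ^ (k - j)"
      unfolding norm_op_scale norm_power
      by (intro mult_mono power_mono order_trans[OF norm_opow_le] assms) (auto simp: r)
    then show "norm (w ^ j *\<^sub>O opow S N (k - j)) \<le> r ^ k" using j by (simp flip: power_add)
  qed
  then have "norm (log_quotient_term S N w k) \<le> (1 / real (Suc k)) * (real (Suc k) * r ^ k)"
    unfolding log_quotient_term_def norm_scaleR by (intro mult_mono) auto
  then show ?thesis by simp
qed

text \<open>The factorization of a difference of powers, N^(k+1) - w^(k+1). Inductively, the sum of
  degree k + 1 is N^(k+1) plus w times the sum of degree k.\<close>

lemma log_quotient_telescope:
  assumes N: "N \<in> operators S S"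
  shows "(N - w *\<^sub>O ident S) o\<^sub>L (\<Sum>j\<le>k. w ^ j *\<^sub>O opow S N (k - j)) = opow S N (Suc k) - w ^ Suc k *\<^sub>O ident S"
proof (induction k)
  case 0
  show ?case by (simp add: opow_Suc op_scale_one op_ident_square[OF N] op_ident_square[OF operators_ident]
      blinfun_compose.diff_left op_scale_compose_left)
next
  case (Suc k)
  define X where "X = (\<Sum>j\<le>k. w ^ j *\<^sub>O opow S N (k - j))"
  define M where "M = N - w *\<^sub>O ident S"
  have M: "M \<in> operators S S" unfolding M_def by (intro operators_diff operators_scale operators_ident N)
  have "(\<Sum>j\<le>Suc k. w ^ j *\<^sub>O opow S N (Suc k - j)) = opow S N (Suc k) + w *\<^sub>O X"
    unfolding sum.atMost_Suc_shift X_def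
    by (simp add: op_scale_one bounded_bilinear.sum_right[OF bounded_bilinear_op_scale] op_scale_scale)
  then have "M o\<^sub>L (\<Sum>j\<le>Suc k. w ^ j *\<^sub>O opow S N (Suc k - j)) = (M o\<^sub>L opow S N (Suc k)) + w *\<^sub>O (M o\<^sub>L X)"
    by (simp add: blinfun_compose.add_right op_scale_compose_right[OF M])
  also have "M o\<^sub>L X = opow S N (Suc k) - w ^ Suc k *\<^sub>O ident S"
    unfolding M_def X_def by (rule Suc)
  also have "M o\<^sub>L opow S N (Suc k) = opow S N (Suc (Suc k)) - w *\<^sub>O opow S N (Suc k)"
    unfolding M_def by (simp only: blinfun_compose.diff_left op_scale_compose_left
        op_ident_square[OF operators_opow[OF N]] opow_Suc[of S N "Suc k"])
  finally show ?case by (simp add: M_def op_scale_diff_right op_scale_scale)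
qed

definition log_quotient :: "'a set \<Rightarrow> ('a ell2 \<Rightarrow>\<^sub>L 'a ell2) \<Rightarrow> complex \<Rightarrow> ('a ell2 \<Rightarrow>\<^sub>L 'a ell2)" where
  "log_quotient S N z = (\<Sum>k. log_quotient_term S N (1 - z) k)"

lemma log_quotient_sums:
  assumes "norm N < 1" "cmod (1 - z) < 1"
  shows "(\<lambda>k. log_quotient_term S N (1 - z) k) sums log_quotient S N z"
  unfolding log_quotient_def
proof (rule summable_sums, rule summable_norm_cancel, rule summable_comparison_test')
  define r where "r = max (norm N) (cmod (1 - z))"
  show "summable (\<lambda>k. r ^ k)" using assms by (intro summable_geometric) (simp add: r_def abs_of_nonneg le_max_iff_disj)
  fix k show "norm (norm (log_quotient_term S N (1 - z) k)) \<le> r ^ k"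
    using norm_log_quotient_term_le[of N r "1 - z" S k] by (simp add: r_def)
qed

text \<open>The factorization of differences of powers converts each term of the quotient into the
  difference of the corresponding Mercator terms for N and for w = 1 - z.\<close>

lemma log_quotient_eq:
  assumes N: "N \<in> operators S S" "norm N < 1" and z: "cmod (1 - z) < 1"
  shows "(z *\<^sub>O ident S - (ident S - N)) o\<^sub>L log_quotient S N z = Ln z *\<^sub>O ident S - log_series S N"
proof -
  define w where "w = 1 - z"
  have e: "z *\<^sub>O ident S - (ident S - N) = N - w *\<^sub>O ident S"
    by (simp add: w_def op_scale_diff_left op_scale_one)
  have "(\<lambda>k. (N - w *\<^sub>O ident S) o\<^sub>L log_quotient_term S N w k) sums ((N - w *\<^sub>O ident S) o\<^sub>L log_quotient S N z)"
    unfolding w_def by (rule bounded_linear.sums[OF blinfun_compose.bounded_linear_right log_quotient_sums[OF N(2) z]])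
  moreover have "(N - w *\<^sub>O ident S) o\<^sub>L log_quotient_term S N w k
      = (1 / real (Suc k)) *\<^sub>R opow S N (Suc k) - (w ^ Suc k / of_nat (Suc k)) *\<^sub>O ident S" for k
    unfolding log_quotient_term_def blinfun_compose.scaleR_right log_quotient_telescope[OF N(1)]
    by (simp add: scaleR_op op_scale_diff_right op_scale_scale del: of_nat_Suc)
  moreover have "(\<lambda>k. (1 / real (Suc k)) *\<^sub>R opow S N (Suc k) - (w ^ Suc k / of_nat (Suc k)) *\<^sub>O ident S)
      sums (- log_series S N - (- Ln z) *\<^sub>O ident S)"
  proof (rule sums_diff[OF log_series_sums[OF N(2)]])
    have "(\<lambda>n. - (w ^ n) / of_nat n) sums Ln z"
      using Ln_series'[of "- w"] z by (simp add: w_def norm_minus_commute[of z])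
    from sums_minus[OF this] have "(\<lambda>n. w ^ n / of_nat n) sums (- Ln z)" by simp
    \<comment> \<open>Dropping the term at n = 0 leaves the sum unchanged: division by zero gives
      w^0 / 0 = 0.\<close>
    from sums_split_initial_segment[OF this, of 1]
    have "(\<lambda>k. w ^ Suc k / of_nat (Suc k)) sums (- Ln z)" by simp
    then show "(\<lambda>k. (w ^ Suc k / of_nat (Suc k)) *\<^sub>O ident S) sums ((- Ln z) *\<^sub>O ident S)"
      by (rule bounded_linear.sums[OF bounded_bilinear.bounded_linear_left[OF bounded_bilinear_op_scale]])
  qed
  ultimately have "(N - w *\<^sub>O ident S) o\<^sub>L log_quotient S N z = - log_series S N - (- Ln z) *\<^sub>O ident S"
    using sums_unique2 by (simp only:)
  also have "\<dots> = Ln z *\<^sub>O ident S - log_series S N"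
    by (rule blinfun_eqI, rule ell2_eqI) (simp add: blinfun.diff_left blinfun.minus_left)
  finally show ?thesis unfolding e .
qed

text \<open>The partial sums are polynomials in z, and the terms are dominated by a geometric series
  with ratio r uniformly on the ball.\<close>

lemma log_quotient_entry_holomorphic:
  assumes "norm N < r" "r < 1"
  shows "(\<lambda>z. coeff (blinfun_apply (log_quotient S N z) f) x) holomorphic_on ball 1 r"
proof (rule holomorphic_uniform_sequence[OF open_ball])
  let ?t = "\<lambda>k z. coeff (blinfun_apply (log_quotient_term S N (1 - z) k) f) x"
  have t: "?t k holomorphic_on A" for k A
  proof -
    have "?t k = (\<lambda>z. of_real (1 / real (Suc k)) * (\<Sum>j\<le>k. (1 - z) ^ j * coeff (blinfun_apply (opow S N (k - j)) f) x))"
      by (simp add: log_quotient_term_def blinfun.scaleR_left blinfun.sum_left coeff_sum)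
    then show ?thesis by (simp only:) (intro holomorphic_intros)
  qed
  then show "(\<lambda>z. \<Sum>k<n. ?t k z) holomorphic_on ball 1 r" for n by (intro holomorphic_intros)
  have le: "norm (?t k z) \<le> r ^ k * norm f" if "z \<in> ball 1 r" for k and z :: complex
  proof -
    have "norm (?t k z) \<le> norm (log_quotient_term S N (1 - z) k) * norm f"
      by (rule order_trans[OF coeff_le_norm norm_blinfun])
    also have "\<dots> \<le> r ^ k * norm f"
      using assms that by (intro mult_right_mono norm_log_quotient_term_le) (auto simp: dist_norm)
    finally show ?thesis .
  qed
  have sm: "summable (\<lambda>k. r ^ k * norm f)"
    using assms order_le_less_trans[OF norm_ge_zero assms(1)] by (intro summable_mult2 summable_geometric) simp
  have "uniform_limit (ball 1 r) (\<lambda>n z. \<Sum>k<n. ?t k z) (\<lambda>z. \<Sum>k. ?t k z) sequentially"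
    by (rule Weierstrass_m_test[OF le sm])
  also have "?this \<longleftrightarrow> uniform_limit (ball 1 r) (\<lambda>n z. \<Sum>k<n. ?t k z)
      (\<lambda>z. coeff (blinfun_apply (log_quotient S N z) f) x) sequentially"
  proof (rule uniform_limit_cong')
    fix z :: complex assume "z \<in> ball 1 r"
    then have "(\<lambda>k. log_quotient_term S N (1 - z) k) sums log_quotient S N z"
      using assms by (intro log_quotient_sums) (auto simp: dist_norm)
    from bounded_linear.sums[OF bounded_linear_entry this]
    show "(\<Sum>k. ?t k z) = coeff (blinfun_apply (log_quotient S N z) f) x" by (rule sums_unique[symmetric])
  qed simp
  finally have u: "uniform_limit (ball 1 r) (\<lambda>n z. \<Sum>k<n. ?t k z)
      (\<lambda>z. coeff (blinfun_apply (log_quotient S N z) f) x) sequentially" .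
  fix z :: complex assume "z \<in> ball 1 r"
  then obtain d where "d > 0" "cball z d \<subseteq> ball 1 r" using open_contains_cball open_ball by blast
  then show "\<exists>d>0. cball z d \<subseteq> ball 1 r \<and> uniform_limit (cball z d) (\<lambda>n z. \<Sum>k<n. ?t k z)
      (\<lambda>z. coeff (blinfun_apply (log_quotient S N z) f) x) sequentially"
    using uniform_limit_on_subset[OF u] by blast
qed

text \<open>An admissible contour may leave the disk on which the series expansion is valid. Write
  Q(z) for the coefficient of R(z)(L(z) - B), where B is the log series. Off the spectrum Q is
  holomorphic on D, and on the disk the log quotient extends it across the spectrum. Hence Q
  integrates to 0 along every admissible contour, so the integral of L(z) R(z) is that of R(z) B,
  namely 2 pi i B.\<close>

lemma is_op_log_series:
  assumes br: "log_branch D L" "L 1 = 0"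
    and r: "cball 1 r \<subseteq> D" "r < 1" and N: "N \<in> operators S S" "norm N < r"
  shows "is_op_log S D L (ident S - N) (log_series S N)"
proof -
  define A where "A = ident S - N"
  define K where "K = op_spectrum S A"
  define B where "B = log_series S N"
  define g where "g = resolvent S A"
  have r0: "r > 0" using N(2) norm_ge_zero[of N] by linarith
  have N1: "norm N < 1" using N(2) r(2) by simp
  have A: "A \<in> operators S S" unfolding A_def by (intro operators_diff operators_ident N)
  have B: "B \<in> operators S S" unfolding B_def by (rule operators_log_series[OF N1 N(1)])
  have Kr: "K \<subseteq> ball 1 r" using resolvent_spectrum_bound[OF N(1)] N(2) unfolding K_def A_def by (auto simp: subset_eq)
  have D: "open D" "simply_connected D" "L holomorphic_on D" using br(1) by (auto simp: log_branch_def)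
  have oK: "open (- K)" unfolding K_def by (rule open_resolvent_set[OF A])
  have ball: "ball 1 r \<subseteq> D" using r(1) by auto
  have hg: "(\<lambda>z. coeff (blinfun_apply (g z) f) x) holomorphic_on - K" for f x
    unfolding g_def K_def by (rule resolvent_entry_holomorphic[OF A])
  have cg: "continuous_on (- K) g"
    unfolding g_def K_def using isCont_resolvent[OF A] by (intro continuous_at_imp_continuous_on) auto
  \<comment> \<open>\<open>is_op_log\<close> demands that some admissible contour exist; the circle
    of radius r encloses the spectrum because norm N < r.\<close>
  have ex: "log_contour D K (circlepath 1 r)"
  proof -
    have "inside (path_image (circlepath 1 r)) = ball 1 r"
      using inside_frontier_eq_interior[of "cball 1 r"] r0 by (simp add: frontier_cball)
    then show ?thesis unfolding log_contour_def using r0 r(1) ball Kr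
      by (auto simp: simple_path_circlepath winding_number_circlepath dist_norm norm_minus_commute)
  qed
  have main: "((\<lambda>t. (1 / (2 * of_real pi * \<i>) * L (\<Lambda> t) * vector_derivative \<Lambda> (at t within {0..1})) *\<^sub>O
              op_inverse S (\<Lambda> t *\<^sub>O ident S - A)) has_integral B) {0..1}" if \<Lambda>: "log_contour D K \<Lambda>" for \<Lambda>
  proof -
    have p: "valid_path \<Lambda>" "simple_path \<Lambda>" "pathfinish \<Lambda> = pathstart \<Lambda>" "path_image \<Lambda> \<subseteq> D"
      "K \<subseteq> inside (path_image \<Lambda>)" and wn: "\<And>z. z \<in> inside (path_image \<Lambda>) \<Longrightarrow> winding_number \<Lambda> z = 1"
      using \<Lambda> by (auto simp: log_contour_def)
    have pK: "path_image \<Lambda> \<subseteq> D - K" using p(4,5) inside_no_overlap by blast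
    have res: "((\<lambda>z. coeff (blinfun_apply (g z) f) x) has_contour_integral
        2 * of_real pi * \<i> * coeff (blinfun_apply (ident S) f) x) \<Lambda>" for f x
      unfolding g_def A_def
      by (rule contour_integral_resolvent[OF N(1) p(1-3) _ wn]) (use p(5) in \<open>auto simp: K_def A_def\<close>)
    define h where "h z = (1 / (2 * of_real pi * \<i>) * L z) *\<^sub>O g z" for z
    have hc: "((\<lambda>z. coeff (blinfun_apply (h z) f) x) has_contour_integral coeff (blinfun_apply B f) x) \<Lambda>" for f x
    proof -
      define Q where "Q z = L z * coeff (blinfun_apply (g z) f) x - coeff (blinfun_apply (g z) (blinfun_apply B f)) x" for z
      define q where "q z = coeff (blinfun_apply (log_quotient S N z) f) x" for z
      have agree: "q z = Q z" if z: "z \<in> ball 1 r" "z \<in> D - K" for z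
      proof -
        have z1: "cmod (1 - z) < 1" using z r(2) by (simp add: dist_norm)
        have lq: "log_quotient S N z \<in> operators S S"
          by (rule operators_sums[OF _ log_quotient_sums[OF N1 z1]])
             (auto simp: log_quotient_term_def intro!: operators_scaleR operators_sum operators_scale operators_opow N)
        have zK: "z \<notin> op_spectrum S A" using z(2) by (simp add: K_def)
        note inv = resolvent_inverse[OF zK, folded g_def]
        have go: "g z \<in> operators S S" using inv by (simp add: is_op_inverse_def)
        have "log_quotient S N z = (g z o\<^sub>L (z *\<^sub>O ident S - A)) o\<^sub>L log_quotient S N z"
          using inv by (simp add: is_op_inverse_def op_ident_square[OF lq])
        also have "\<dots> = g z o\<^sub>L (Ln z *\<^sub>O ident S - B)"
          unfolding blinfun_compose_assoc A_def log_quotient_eq[OF N(1) N1 z1] B_def ..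
        also have "\<dots> = (L z *\<^sub>O g z) - (g z o\<^sub>L B)"
          using log_branch_eq_Ln[OF br ball _ z(1)] r(2)
          by (simp add: blinfun_compose.diff_right op_scale_compose_right[OF go] op_ident_square[OF go])
        finally show ?thesis unfolding q_def Q_def by (simp add: blinfun.diff_left)
      qed
      \<comment> \<open>The two pieces agree where both make sense, and together their domains cover
        D, including the spectrum.\<close>
      have "(\<lambda>z. if z \<in> ball 1 r then q z else Q z) holomorphic_on (ball 1 r \<union> (D - K))"
      proof (rule holomorphic_on_If_Un)
        show "q holomorphic_on ball 1 r" unfolding q_def by (rule log_quotient_entry_holomorphic[OF N(2) r(2)])
        show "Q holomorphic_on D - K" unfolding Q_def
          by (intro holomorphic_intros holomorphic_on_subset[OF D(3)] holomorphic_on_subset[OF hg]) auto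
        show "open (D - K)" using D(1) oK by (simp add: Diff_eq open_Int)
      qed (use agree in auto)
      moreover have "ball 1 r \<union> (D - K) = D" using Kr ball by blast
      ultimately have "(\<lambda>z. if z \<in> ball 1 r then q z else Q z) holomorphic_on D" by simp
      from Cauchy_theorem_simply_connected[OF D(1,2) this p(1,4,3)]
      have "((\<lambda>z. if z \<in> ball 1 r then q z else Q z) has_contour_integral 0) \<Lambda>" .
      then have "(Q has_contour_integral 0) \<Lambda>"
        by (rule has_contour_integral_eq) (use agree pK in auto)
      \<comment> \<open>Adding back the resolvent applied to B f leaves L times the resolvent as
        integrand, and contributes 2 pi i times B f.\<close>
      from has_contour_integral_add[OF this res[of "blinfun_apply B f" x]]
      have "((\<lambda>z. L z * coeff (blinfun_apply (g z) f) x) has_contour_integral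
          2 * of_real pi * \<i> * coeff (blinfun_apply (ident S o\<^sub>L B) f) x) \<Lambda>" by (simp add: Q_def)
      then have "((\<lambda>z. L z * coeff (blinfun_apply (g z) f) x) has_contour_integral
          2 * of_real pi * \<i> * coeff (blinfun_apply B f) x) \<Lambda>" unfolding op_ident_square[OF B] .
      from has_contour_integral_lmul[OF this, of "1 / (2 * of_real pi * \<i>)"]
      show ?thesis by (simp add: h_def mult.assoc)
    qed
    have "((\<lambda>t. vector_derivative \<Lambda> (at t within {0..1}) *\<^sub>O h (\<Lambda> t)) has_integral B) {0..1}"
    proof (rule operator_contour_integral[OF _ p(1) pK _ _ hc])
      show "open (D - K)" using D(1) oK by (simp add: Diff_eq open_Int)
      show "continuous_on (D - K) h" unfolding h_def
        by (intro bounded_bilinear.continuous_on[OF bounded_bilinear_op_scale] continuous_intros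
            continuous_on_subset[OF holomorphic_on_imp_continuous_on[OF D(3)]] continuous_on_subset[OF cg]) auto
      show "(\<lambda>z. coeff (blinfun_apply (h z) f) x) holomorphic_on D - K" for f x
        unfolding h_def blinfun_apply_op_scale coeff_scaleC
        by (intro holomorphic_intros holomorphic_on_subset[OF D(3)] holomorphic_on_subset[OF hg]) auto
    qed
    then show ?thesis by (simp add: h_def g_def resolvent_def op_scale_scale mult_ac)
  qed
  show ?thesis unfolding is_op_log_def using ex main unfolding K_def A_def B_def by blast
qed

lemma op_log_eq:
  assumes "is_op_log S D L A B"
  shows "op_log S D L A = B"
  unfolding op_log_def
proof (rule the_equality)
  show "is_op_log S D L A B" by (rule assms)
  fix C assume "is_op_log S D L A C"
  then show "C = B" using assms has_integral_unique unfolding is_op_log_def by blast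
qed

subsection \<open>Group actions and traces\<close>

no_notation Infinite_Set_Sum.abs_summable_on (infix "abs'_summable'_on" 50)

text \<open>The group operations are explicit parameters so that one group can act on two index
  types at once. Instances over vertices and arcs then share the same inversion of group elements,
  which the exchange of orbit sums relies on.\<close>

locale proper_action =
  fixes \<Gamma> :: "'g set" and inverse_of :: "'g \<Rightarrow> 'g" and mult :: "'g \<Rightarrow> 'g \<Rightarrow> 'g" and one :: 'g
    and act :: "'g \<Rightarrow> 'a \<Rightarrow> 'a" and S F :: "'a set"
  assumes one_in: "one \<in> \<Gamma>"
    and mult_in: "\<gamma> \<in> \<Gamma> \<Longrightarrow> \<delta> \<in> \<Gamma> \<Longrightarrow> mult \<gamma> \<delta> \<in> \<Gamma>"
    and inverse_in: "\<gamma> \<in> \<Gamma> \<Longrightarrow> inverse_of \<gamma> \<in> \<Gamma>"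
    and inverse_inverse: "\<gamma> \<in> \<Gamma> \<Longrightarrow> inverse_of (inverse_of \<gamma>) = \<gamma>"
    and mult_inverse: "\<gamma> \<in> \<Gamma> \<Longrightarrow> \<delta> \<in> \<Gamma> \<Longrightarrow> mult \<gamma> (mult (inverse_of \<gamma>) \<delta>) = \<delta>"
    and act_one: "act one x = x"
    and act_mult: "\<gamma> \<in> \<Gamma> \<Longrightarrow> \<delta> \<in> \<Gamma> \<Longrightarrow> act (mult \<gamma> \<delta>) x = act \<gamma> (act \<delta> x)"
    and act_inverse: "\<gamma> \<in> \<Gamma> \<Longrightarrow> act (inverse_of \<gamma>) (act \<gamma> x) = x"
    and act_in: "\<gamma> \<in> \<Gamma> \<Longrightarrow> x \<in> S \<Longrightarrow> act \<gamma> x \<in> S"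
    and finite_stabilizer: "x \<in> S \<Longrightarrow> finite (stabilizer act \<Gamma> x)"
    and representatives: "orbit_representatives act \<Gamma> S F"
begin

definition weight :: "'a \<Rightarrow> real" where
  "weight x = 1 / real (card (stabilizer act \<Gamma> x))"

lemma weight_nonneg: "0 \<le> weight x"
  by (simp add: weight_def)

lemma F_subset: "F \<subseteq> S"
  using representatives by (simp add: orbit_representatives_def)

lemma act_inverse': "\<gamma> \<in> \<Gamma> \<Longrightarrow> act \<gamma> (act (inverse_of \<gamma>) x) = x"
  using act_inverse[OF inverse_in] inverse_inverse by fastforce

lemma bij_act: "\<gamma> \<in> \<Gamma> \<Longrightarrow> bij (act \<gamma>)"
  by (rule o_bij[of "act (inverse_of \<gamma>)"]) (auto simp: act_inverse act_inverse')

lemma inv_act: "\<gamma> \<in> \<Gamma> \<Longrightarrow> inv (act \<gamma>) = act (inverse_of \<gamma>)"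
  by (rule inv_unique_comp) (auto simp: act_inverse act_inverse')

lemma act_in_iff: "\<gamma> \<in> \<Gamma> \<Longrightarrow> act \<gamma> x \<in> S \<longleftrightarrow> x \<in> S"
  using act_in[OF inverse_in, of \<gamma> "act \<gamma> x"] act_in[of \<gamma> x] by (auto simp: act_inverse)

text \<open>Orbit-stabilizer: if p represents the orbit of y and delta moves p to y, the pairs
  hitting y are exactly (p, delta sigma) with sigma in the stabilizer of p. Their number is the
  reciprocal of the weight of p.\<close>

lemma fiber:
  assumes y: "y \<in> S"
  obtains p where "p \<in> F" "finite {(q, \<gamma>). q \<in> F \<and> \<gamma> \<in> \<Gamma> \<and> act \<gamma> q = y}"
    "real (card {(q, \<gamma>). q \<in> F \<and> \<gamma> \<in> \<Gamma> \<and> act \<gamma> q = y}) * weight p = 1"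
    "\<And>q \<gamma>. q \<in> F \<Longrightarrow> \<gamma> \<in> \<Gamma> \<Longrightarrow> act \<gamma> q = y \<Longrightarrow> q = p"
proof -
  let ?P = "{(q, \<gamma>). q \<in> F \<and> \<gamma> \<in> \<Gamma> \<and> act \<gamma> q = y}"
  obtain p \<gamma>0 where p: "p \<in> F" "\<gamma>0 \<in> \<Gamma>" "act \<gamma>0 y = p"
    and uniq: "\<And>q \<gamma>. q \<in> F \<Longrightarrow> \<gamma> \<in> \<Gamma> \<Longrightarrow> act \<gamma> y = q \<Longrightarrow> q = p"
    using representatives y unfolding orbit_representatives_def by metis
  define \<delta> where "\<delta> = inverse_of \<gamma>0"
  have \<delta>: "\<delta> \<in> \<Gamma>" "act \<delta> p = y" using p inverse_in act_inverse unfolding \<delta>_def by blast+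
  have u: "q = p" if "q \<in> F" "\<gamma> \<in> \<Gamma>" "act \<gamma> q = y" for q \<gamma>
    using uniq[OF that(1) inverse_in[OF that(2)]] act_inverse[OF that(2), of q] that(3) by blast
  have P: "?P = (\<lambda>\<sigma>. (p, mult \<delta> \<sigma>)) ` stabilizer act \<Gamma> p"
  proof (intro set_eqI iffI)
    fix z assume "z \<in> ?P"
    then obtain q \<gamma> where z: "z = (q, \<gamma>)" "q \<in> F" "\<gamma> \<in> \<Gamma>" "act \<gamma> q = y" by blast
    then have q: "q = p" using u by blast
    have "mult (inverse_of \<delta>) \<gamma> \<in> stabilizer act \<Gamma> p"
      using z q \<delta> act_inverse[OF \<delta>(1), of p] by (simp add: stabilizer_def mult_in inverse_in act_mult)
    moreover have "z = (p, mult \<delta> (mult (inverse_of \<delta>) \<gamma>))" using z q mult_inverse[OF \<delta>(1) z(3)] by simp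
    ultimately show "z \<in> (\<lambda>\<sigma>. (p, mult \<delta> \<sigma>)) ` stabilizer act \<Gamma> p" by blast
  next
    fix z assume "z \<in> (\<lambda>\<sigma>. (p, mult \<delta> \<sigma>)) ` stabilizer act \<Gamma> p"
    then show "z \<in> ?P" using p(1) \<delta> by (auto simp: stabilizer_def mult_in act_mult)
  qed
  have fin: "finite (stabilizer act \<Gamma> p)" using finite_stabilizer F_subset p(1) by blast
  have "inj_on (\<lambda>\<sigma>. (p, mult \<delta> \<sigma>)) (stabilizer act \<Gamma> p)"
  proof (rule inj_onI)
    fix \<sigma> \<tau> assume \<sigma>: "\<sigma> \<in> stabilizer act \<Gamma> p" "\<tau> \<in> stabilizer act \<Gamma> p" "(p, mult \<delta> \<sigma>) = (p, mult \<delta> \<tau>)"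
    then have g: "\<sigma> \<in> \<Gamma>" "\<tau> \<in> \<Gamma>" by (auto simp: stabilizer_def)
    have "mult (inverse_of \<delta>) (mult \<delta> \<sigma>) = \<sigma>" if "\<sigma> \<in> \<Gamma>" for \<sigma>
      using mult_inverse[OF inverse_in[OF \<delta>(1)] that] inverse_inverse[OF \<delta>(1)] by simp
    then show "\<sigma> = \<tau>" using \<sigma>(3) g by (metis prod.inject)
  qed
  then have card: "card ?P = card (stabilizer act \<Gamma> p)" unfolding P by (rule card_image)
  have "one \<in> stabilizer act \<Gamma> p" by (simp add: stabilizer_def one_in act_one)
  then have "card (stabilizer act \<Gamma> p) \<noteq> 0" using fin by auto
  then have "real (card ?P) * weight p = 1" unfolding card weight_def by simp
  then show ?thesis using that[of p] p(1) fin u unfolding P by blast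
qed

text \<open>Each point of S is hit by as many pairs (q, gamma) as the stabilizer of its
  representative has elements, and the weight compensates for exactly this multiplicity.\<close>

lemma unfold_orbits:
  fixes f :: "'a \<Rightarrow> 'c::banach"
  assumes f: "f abs_summable_on S"
  shows "(\<lambda>(q, \<gamma>). weight q *\<^sub>R f (act \<gamma> q)) abs_summable_on F \<times> \<Gamma>"
    and "(\<Sum>\<^sub>\<infinity>(q, \<gamma>)\<in>F \<times> \<Gamma>. weight q *\<^sub>R f (act \<gamma> q)) = infsum f S"
proof -
  define P where "P y = {(q, \<gamma>). q \<in> F \<and> \<gamma> \<in> \<Gamma> \<and> act \<gamma> q = y}" for y
  define h where "h = (\<lambda>(q, \<gamma>). weight q *\<^sub>R f (act \<gamma> q))"
  have fib: "finite (P y)" "(\<Sum>p\<in>P y. h p) = f y" "(\<Sum>p\<in>P y. norm (h p)) = norm (f y)" if y: "y \<in> S" for y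
  proof -
    obtain p where "p \<in> F" and p: "finite (P y)" "real (card (P y)) * weight p = 1"
      "\<And>q \<gamma>. q \<in> F \<Longrightarrow> \<gamma> \<in> \<Gamma> \<Longrightarrow> act \<gamma> q = y \<Longrightarrow> q = p"
      by (rule fiber[OF y, folded P_def]) (rule that)
    have h: "h z = weight p *\<^sub>R f y" if "z \<in> P y" for z
      using that p(3) by (auto simp: h_def P_def)
    show "finite (P y)" by (rule p)
    show "(\<Sum>p\<in>P y. h p) = f y"
      using p(2) by (simp add: h sum_constant_scaleR)
    have "(\<Sum>p\<in>P y. norm (h p)) = real (card (P y)) * (weight p * norm (f y))"
      by (simp add: h weight_nonneg)
    then show "(\<Sum>p\<in>P y. norm (h p)) = norm (f y)" using p(2) by (simp flip: mult.assoc)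
  qed
  \<comment> \<open>The pairs are grouped by the point they hit, so that summing over each finite
    fiber first returns f.\<close>
  have bij: "bij_betw snd (Sigma S P) (F \<times> \<Gamma>)"
    by (rule bij_betw_byWitness[of _ "\<lambda>(q, \<gamma>). (act \<gamma> q, (q, \<gamma>))"])
       (use F_subset act_in in \<open>auto simp: P_def\<close>)
  have sm: "(\<lambda>z. h (snd z)) abs_summable_on Sigma S P"
  proof (rule Infinite_Sum.abs_summable_on_Sigma_iff[THEN iffD2], intro conjI ballI)
    show "(\<lambda>p. h (snd (y, p))) abs_summable_on P y" if "y \<in> S" for y
      using fib(1)[OF that] by simp
    have "(\<lambda>y. norm (f y)) summable_on S" by (rule f)
    then have "(\<lambda>y. norm (norm (f y))) summable_on S" by simp
    then show "(\<lambda>y. \<Sum>\<^sub>\<infinity>p\<in>P y. norm (h (snd (y, p)))) abs_summable_on S"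
      by (rule summable_on_cong[THEN iffD1, rotated]) (simp add: fib)
  qed
  have "h abs_summable_on F \<times> \<Gamma>"
    using sm summable_on_reindex_bij_betw[OF bij, of "\<lambda>p. norm (h p)"] by simp
  then show "(\<lambda>(q, \<gamma>). weight q *\<^sub>R f (act \<gamma> q)) abs_summable_on F \<times> \<Gamma>" unfolding h_def .
  have "infsum h (F \<times> \<Gamma>) = infsum (\<lambda>z. h (snd z)) (Sigma S P)"
    by (rule infsum_reindex_bij_betw[OF bij, symmetric])
  also have "\<dots> = (\<Sum>\<^sub>\<infinity>y\<in>S. \<Sum>\<^sub>\<infinity>p\<in>P y. h (snd (y, p)))"
    by (rule infsum_Sigma_banach[symmetric]) (rule Infinite_Sum.abs_summable_summable[OF sm])
  also have "\<dots> = infsum f S" by (rule infsum_cong) (simp add: fib)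
  finally show "(\<Sum>\<^sub>\<infinity>(q, \<gamma>)\<in>F \<times> \<Gamma>. weight q *\<^sub>R f (act \<gamma> q)) = infsum f S" unfolding h_def .
qed

end

section \<open>Exchange of orbit sums for invariant kernels\<close>

lemma abs_summable_on_scaleR:
  fixes f :: "'a \<Rightarrow> 'b::real_normed_vector"
  assumes "f abs_summable_on A"
  shows "(\<lambda>x. c *\<^sub>R f x) abs_summable_on A"
  using summable_on_cmult_right[OF assms, of "\<bar>c\<bar>"] by simp

text \<open>Unfold the inner sums on both sides, obtaining sums over representatives x,
  representatives y and a group element gamma. Invariance gives k(x, gamma y) = k(gamma^(-1) x, y),
  so substituting the inverse for gamma carries one sum to the other. The second conclusion moves
  the summability hypothesis to the other side.\<close>

lemma mass_transport:
  fixes k :: "'a \<Rightarrow> 'b \<Rightarrow> complex"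
  assumes S: "proper_action \<Gamma> i m e a S F" and T: "proper_action \<Gamma> i m e b T G"
    and inv: "\<And>\<gamma> x y. \<gamma> \<in> \<Gamma> \<Longrightarrow> x \<in> S \<Longrightarrow> y \<in> T \<Longrightarrow> k (a \<gamma> x) (b \<gamma> y) = k x y"
    and row: "\<And>x. x \<in> S \<Longrightarrow> k x abs_summable_on T"
    and col: "\<And>y. y \<in> T \<Longrightarrow> (\<lambda>x. k x y) abs_summable_on S"
    and sm: "(\<lambda>x. proper_action.weight \<Gamma> a x * (\<Sum>\<^sub>\<infinity>y\<in>T. norm (k x y))) summable_on F"
  shows "(\<Sum>\<^sub>\<infinity>x\<in>F. proper_action.weight \<Gamma> a x *\<^sub>R (\<Sum>\<^sub>\<infinity>y\<in>T. k x y))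
       = (\<Sum>\<^sub>\<infinity>y\<in>G. proper_action.weight \<Gamma> b y *\<^sub>R (\<Sum>\<^sub>\<infinity>x\<in>S. k x y))"
    and "(\<lambda>y. proper_action.weight \<Gamma> b y * (\<Sum>\<^sub>\<infinity>x\<in>S. norm (k x y))) summable_on G"
proof -
  interpret A: proper_action \<Gamma> i m e a S F by (rule S)
  interpret B: proper_action \<Gamma> i m e b T G by (rule T)
  define \<Phi> where "\<Phi> = (\<lambda>(x, z). A.weight x *\<^sub>R (case z of (y, \<gamma>) \<Rightarrow> B.weight y *\<^sub>R k x (b \<gamma> y)))"
  define \<Psi> where "\<Psi> = (\<lambda>(y, z). B.weight y *\<^sub>R (case z of (x, \<gamma>) \<Rightarrow> A.weight x *\<^sub>R k (a \<gamma> x) y))"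
  have norms: "(\<Sum>\<^sub>\<infinity>z\<in>G \<times> \<Gamma>. norm (\<Phi> (x, z))) = A.weight x * (\<Sum>\<^sub>\<infinity>y\<in>T. norm (k x y))" if x: "x \<in> S" for x
  proof -
    have "(\<lambda>y. norm (k x y)) abs_summable_on T" using row[OF x] by simp
    from B.unfold_orbits(2)[OF this]
    show ?thesis unfolding \<Phi>_def
      by (simp add: case_prod_unfold A.weight_nonneg B.weight_nonneg mult.assoc infsum_cmult_right')
  qed
  have norms': "(\<Sum>\<^sub>\<infinity>z\<in>F \<times> \<Gamma>. norm (\<Psi> (y, z))) = B.weight y * (\<Sum>\<^sub>\<infinity>x\<in>S. norm (k x y))" if y: "y \<in> T" for y
  proof -
    have "(\<lambda>x. norm (k x y)) abs_summable_on S" using col[OF y] by simp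
    from A.unfold_orbits(2)[OF this]
    show ?thesis unfolding \<Psi>_def
      by (simp add: case_prod_unfold A.weight_nonneg B.weight_nonneg mult.assoc infsum_cmult_right')
  qed
  have \<Phi>: "\<Phi> abs_summable_on F \<times> (G \<times> \<Gamma>)"
  proof (rule Infinite_Sum.abs_summable_on_Sigma_iff[THEN iffD2], intro conjI ballI)
    show "(\<lambda>z. \<Phi> (x, z)) abs_summable_on G \<times> \<Gamma>" if "x \<in> F" for x
      using abs_summable_on_scaleR[OF B.unfold_orbits(1)[OF row[of x]], of "A.weight x"] A.F_subset that
      unfolding \<Phi>_def by auto
    have "(\<lambda>x. \<Sum>\<^sub>\<infinity>z\<in>G \<times> \<Gamma>. norm (\<Phi> (x, z))) summable_on F"
      using sm by (rule summable_on_cong[THEN iffD1, rotated]) (use A.F_subset norms in auto)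
    then show "(\<lambda>x. \<Sum>\<^sub>\<infinity>z\<in>G \<times> \<Gamma>. norm (\<Phi> (x, z))) abs_summable_on F"
      by (simp add: infsum_nonneg)
  qed
  \<comment> \<open>This is the substitution: swap the two representatives and invert the group
    element.\<close>
  define \<theta> where "\<theta> = (\<lambda>(x::'a, y::'b, \<gamma>). (y, x, i \<gamma>))"
  have bij: "bij_betw \<theta> (F \<times> (G \<times> \<Gamma>)) (G \<times> (F \<times> \<Gamma>))"
    by (rule bij_betw_byWitness[of _ "\<lambda>(y, x, \<gamma>). (x, y, i \<gamma>)"])
       (auto simp: \<theta>_def A.inverse_inverse A.inverse_in)
  have eq': "\<Phi> (x, y, \<gamma>) = \<Psi> (\<theta> (x, y, \<gamma>))" if "x \<in> F" "y \<in> G" "\<gamma> \<in> \<Gamma>" for x y \<gamma>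
  proof -
    have "k (a (i \<gamma>) x) (b (i \<gamma>) (b \<gamma> y)) = k x (b \<gamma> y)"
      using that A.F_subset B.F_subset by (intro inv) (auto simp: A.inverse_in B.act_in)
    then show ?thesis using that by (simp add: \<Phi>_def \<Psi>_def \<theta>_def B.act_inverse)
  qed
  have eq: "\<Phi> z = \<Psi> (\<theta> z)" if z: "z \<in> F \<times> (G \<times> \<Gamma>)" for z
    using z eq'[of "fst z" "fst (snd z)" "snd (snd z)"] by (simp add: mem_Times_iff)
  have \<Psi>: "\<Psi> abs_summable_on G \<times> (F \<times> \<Gamma>)"
    using \<Phi> summable_on_reindex_bij_betw[OF bij, of "\<lambda>z. norm (\<Psi> z)"]
      summable_on_cong[of "F \<times> (G \<times> \<Gamma>)" "\<lambda>z. norm (\<Phi> z)" "\<lambda>z. norm (\<Psi> (\<theta> z))"] eq by simp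
  have "(\<Sum>\<^sub>\<infinity>x\<in>F. A.weight x *\<^sub>R (\<Sum>\<^sub>\<infinity>y\<in>T. k x y)) = (\<Sum>\<^sub>\<infinity>x\<in>F. \<Sum>\<^sub>\<infinity>z\<in>G \<times> \<Gamma>. \<Phi> (x, z))"
    unfolding \<Phi>_def using B.unfold_orbits(2)[OF row] A.F_subset
    by (intro infsum_cong) (auto simp: infsum_scaleR_right)
  also have "\<dots> = infsum \<Phi> (F \<times> (G \<times> \<Gamma>))" by (rule infsum_Sigma_banach) (rule Infinite_Sum.abs_summable_summable[OF \<Phi>])
  also have "\<dots> = infsum (\<lambda>z. \<Psi> (\<theta> z)) (F \<times> (G \<times> \<Gamma>))" by (rule infsum_cong) (rule eq)
  also have "\<dots> = infsum \<Psi> (G \<times> (F \<times> \<Gamma>))" by (rule infsum_reindex_bij_betw[OF bij])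
  also have "\<dots> = (\<Sum>\<^sub>\<infinity>y\<in>G. \<Sum>\<^sub>\<infinity>z\<in>F \<times> \<Gamma>. \<Psi> (y, z))"
    by (rule infsum_Sigma_banach[symmetric]) (rule Infinite_Sum.abs_summable_summable[OF \<Psi>])
  also have "\<dots> = (\<Sum>\<^sub>\<infinity>y\<in>G. B.weight y *\<^sub>R (\<Sum>\<^sub>\<infinity>x\<in>S. k x y))"
    unfolding \<Psi>_def using A.unfold_orbits(2)[OF col] B.F_subset
    by (intro infsum_cong) (auto simp: infsum_scaleR_right)
  finally show "(\<Sum>\<^sub>\<infinity>x\<in>F. A.weight x *\<^sub>R (\<Sum>\<^sub>\<infinity>y\<in>T. k x y))
       = (\<Sum>\<^sub>\<infinity>y\<in>G. B.weight y *\<^sub>R (\<Sum>\<^sub>\<infinity>x\<in>S. k x y))" .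
  have "(\<lambda>y. \<Sum>\<^sub>\<infinity>z\<in>F \<times> \<Gamma>. norm (\<Psi> (y, z))) abs_summable_on G"
    using \<Psi> unfolding Infinite_Sum.abs_summable_on_Sigma_iff by blast
  then have "(\<lambda>y. \<Sum>\<^sub>\<infinity>z\<in>F \<times> \<Gamma>. norm (\<Psi> (y, z))) summable_on G" by (rule Infinite_Sum.abs_summable_summable)
  then show "(\<lambda>y. B.weight y * (\<Sum>\<^sub>\<infinity>x\<in>S. norm (k x y))) summable_on G"
    by (rule summable_on_cong[THEN iffD1, rotated]) (use B.F_subset norms' in auto)
qed

text \<open>Row x of P is the complex conjugate of \<open>adj P\<close> applied to
  \<open>delta x\<close>, so an entry of the product is an inner product of square-summable
  functions. The bound in the last part is uniform in x and z; multiplied by summable weights it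
  gives the convergence required for exchanging orbit sums.\<close>

lemma entry_compose:
  assumes P: "P \<in> operators T W"
  shows "(\<lambda>y. entry P x y * entry Q y z) abs_summable_on UNIV"
    and "entry (P o\<^sub>L Q) x z = (\<Sum>\<^sub>\<infinity>y. entry P x y * entry Q y z)"
    and "(\<Sum>\<^sub>\<infinity>y. norm (entry P x y * entry Q y z)) \<le> (norm (adj P))\<^sup>2 + (norm Q)\<^sup>2"
proof -
  define f where "f = blinfun_apply (adj P) (delta x)"
  define g where "g = blinfun_apply Q (delta z)"
  have eP: "coeff (blinfun_apply P h) x = cinner f h" for h
    using cinner_adj'[OF P, of "delta x" h] by (simp add: f_def cinner_delta_left)
  have e: "entry P x y * entry Q y z = cnj (coeff f y) * coeff g y" for y
  proof -
    have "entry P x y = cnj (coeff f y)"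
      unfolding entry_def eP by (subst cinner_commute) (simp add: cinner_delta_left)
    then show ?thesis by (simp add: entry_def g_def)
  qed
  show s: "(\<lambda>y. entry P x y * entry Q y z) abs_summable_on UNIV"
    unfolding e summable_on_iff_abs_summable_on_complex[symmetric] by (rule cinner_summable)
  show "entry (P o\<^sub>L Q) x z = (\<Sum>\<^sub>\<infinity>y. entry P x y * entry Q y z)"
    unfolding e unfolding entry_def by (simp add: eP g_def cinner_def)
  have "(\<Sum>\<^sub>\<infinity>y. norm (entry P x y * entry Q y z)) \<le> (\<Sum>\<^sub>\<infinity>y. (cmod (coeff f y))\<^sup>2 + (cmod (coeff g y))\<^sup>2)"
  proof (rule infsum_mono[OF s])
    show "(\<lambda>y. (cmod (coeff f y))\<^sup>2 + (cmod (coeff g y))\<^sup>2) summable_on UNIV"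
      by (intro summable_on_add coeff_summable)
    fix y
    have "2 * cmod (coeff f y) * cmod (coeff g y) \<le> (cmod (coeff f y))\<^sup>2 + (cmod (coeff g y))\<^sup>2"
      by (rule sum_squares_bound)
    moreover have "0 \<le> cmod (coeff f y) * cmod (coeff g y)" by simp
    ultimately have "cmod (coeff f y) * cmod (coeff g y) \<le> (cmod (coeff f y))\<^sup>2 + (cmod (coeff g y))\<^sup>2"
      by linarith
    then show "norm (entry P x y * entry Q y z) \<le> (cmod (coeff f y))\<^sup>2 + (cmod (coeff g y))\<^sup>2"
      unfolding e by (simp add: norm_mult)
  qed
  also have "\<dots> = (norm f)\<^sup>2 + (norm g)\<^sup>2"
    unfolding norm_ell2_sq by (intro infsum_add coeff_summable)
  also have "\<dots> \<le> (norm (adj P))\<^sup>2 + (norm Q)\<^sup>2"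
    using norm_blinfun[of "adj P" "delta x"] norm_blinfun[of Q "delta z"]
    by (intro add_mono power_mono) (auto simp: f_def g_def)
  finally show "(\<Sum>\<^sub>\<infinity>y. norm (entry P x y * entry Q y z)) \<le> (norm (adj P))\<^sup>2 + (norm Q)\<^sup>2" .
qed

lemma entry_outside: "P \<in> operators T W \<Longrightarrow> y \<notin> T \<Longrightarrow> entry P x y = 0"
  unfolding entry_def by (subst operators_kernel[of P T W]) auto

lemma entry_compose_on:
  assumes P: "P \<in> operators T W"
  shows "(\<lambda>y. entry P x y * entry Q y z) abs_summable_on T"
    and "entry (P o\<^sub>L Q) x z = (\<Sum>\<^sub>\<infinity>y\<in>T. entry P x y * entry Q y z)"
    and "(\<Sum>\<^sub>\<infinity>y\<in>T. norm (entry P x y * entry Q y z)) \<le> (norm (adj P))\<^sup>2 + (norm Q)\<^sup>2"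
proof -
  note c = entry_compose[OF P, where x = x and Q = Q and z = z]
  show "(\<lambda>y. entry P x y * entry Q y z) abs_summable_on T"
    by (rule summable_on_subset_banach[OF c(1)]) simp
  show "entry (P o\<^sub>L Q) x z = (\<Sum>\<^sub>\<infinity>y\<in>T. entry P x y * entry Q y z)"
    unfolding c(2) by (rule infsum_cong_neutral) (auto simp: entry_outside[OF P])
  have "(\<Sum>\<^sub>\<infinity>y\<in>T. norm (entry P x y * entry Q y z)) = (\<Sum>\<^sub>\<infinity>y. norm (entry P x y * entry Q y z))"
    by (rule infsum_cong_neutral) (auto simp: entry_outside[OF P])
  then show "(\<Sum>\<^sub>\<infinity>y\<in>T. norm (entry P x y * entry Q y z)) \<le> (norm (adj P))\<^sup>2 + (norm Q)\<^sup>2"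
    using c(3) by simp
qed

section \<open>Equivariant operators and cyclicity of the trace\<close>

definition intertwines :: "'g set \<Rightarrow> ('g \<Rightarrow> 'a \<Rightarrow> 'a) \<Rightarrow> ('g \<Rightarrow> 'b \<Rightarrow> 'b) \<Rightarrow> ('a ell2 \<Rightarrow>\<^sub>L 'b ell2) \<Rightarrow> bool" where
  "intertwines \<Gamma> a b A \<longleftrightarrow>
     (\<forall>\<gamma>\<in>\<Gamma>. \<forall>f. blinfun_apply A (translate (a \<gamma>) f) = translate (b \<gamma>) (blinfun_apply A f))"

lemma coeff_translate:
  assumes "bij p"
  shows "coeff (translate p f) x = coeff f (inv p x)"
proof -
  have "(\<lambda>x. (cmod (coeff f (inv p x)))\<^sup>2) summable_on UNIV"
    using summable_on_reindex_bij_betw[OF bij_imp_bij_inv[OF assms], of "\<lambda>x. (cmod (coeff f x))\<^sup>2"]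
    by (simp add: coeff_summable)
  then show ?thesis unfolding translate_def by (simp add: coeff_Abs)
qed

lemma translate_delta:
  assumes "bij p"
  shows "translate p (delta y) = delta (p y)"
proof (rule ell2_eqI)
  fix x
  have "inv p x = y \<longleftrightarrow> x = p y" using assms by (metis bij_inv_eq_iff)
  then show "coeff (translate p (delta y)) x = coeff (delta (p y)) x"
    by (simp add: coeff_translate[OF assms])
qed

lemma cinner_translate:
  assumes "bij p"
  shows "cinner (translate p f) g = cinner f (translate (inv p) g)"
proof -
  have "(\<Sum>\<^sub>\<infinity>x. cnj (coeff f (inv p x)) * coeff g (p (inv p x))) = (\<Sum>\<^sub>\<infinity>x. cnj (coeff f x) * coeff g (p x))"
    by (rule infsum_reindex_bij_betw[OF bij_imp_bij_inv[OF assms]])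
  then show ?thesis unfolding cinner_def
    using assms by (simp add: coeff_translate bij_imp_bij_inv inv_inv_eq bij_is_surj surj_f_inv_f)
qed

lemma intertwines_compose: "intertwines \<Gamma> b c A \<Longrightarrow> intertwines \<Gamma> a b B \<Longrightarrow> intertwines \<Gamma> a c (A o\<^sub>L B)"
  by (simp add: intertwines_def)

context
  fixes \<Gamma> :: "'g set" and i :: "'g \<Rightarrow> 'g" and m e a S F and b :: "'g \<Rightarrow> 'b \<Rightarrow> 'b" and T G
  assumes S: "proper_action \<Gamma> i m e a S F" and T: "proper_action \<Gamma> i m e b T G"
begin

interpretation A: proper_action \<Gamma> i m e a S F by (rule S)
interpretation B: proper_action \<Gamma> i m e b T G by (rule T)

lemma entry_intertwines:
  assumes "intertwines \<Gamma> a b X" "\<gamma> \<in> \<Gamma>"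
  shows "entry X (b \<gamma> y) (a \<gamma> x) = entry X y x"
proof -
  have "blinfun_apply X (delta (a \<gamma> x)) = translate (b \<gamma>) (blinfun_apply X (delta x))"
    using assms unfolding intertwines_def by (metis translate_delta A.bij_act)
  then show ?thesis unfolding entry_def
    using assms(2) by (simp add: coeff_translate B.bij_act B.inv_act B.act_inverse)
qed

lemma intertwines_add:
  assumes "intertwines \<Gamma> a b X" "intertwines \<Gamma> a b Y"
  shows "intertwines \<Gamma> a b (X + Y)"
  using assms unfolding intertwines_def
  by (auto intro!: ell2_eqI simp: blinfun.add_left coeff_translate B.bij_act)

lemma intertwines_diff:
  assumes "intertwines \<Gamma> a b X" "intertwines \<Gamma> a b Y"
  shows "intertwines \<Gamma> a b (X - Y)"
  using assms unfolding intertwines_def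
  by (auto intro!: ell2_eqI simp: blinfun.diff_left coeff_translate B.bij_act)

lemma intertwines_scale:
  assumes "intertwines \<Gamma> a b X"
  shows "intertwines \<Gamma> a b (c *\<^sub>O X)"
  using assms unfolding intertwines_def
  by (auto intro!: ell2_eqI simp: coeff_translate B.bij_act)

lemma intertwines_ident: "intertwines \<Gamma> a a (ident S)"
  unfolding intertwines_def
  by (auto intro!: ell2_eqI simp: coeff_translate A.bij_act A.inv_act A.inverse_in A.act_in_iff)

lemma intertwines_adj:
  assumes X: "X \<in> operators S T" "intertwines \<Gamma> a b X"
  shows "intertwines \<Gamma> b a (adj X)"
  unfolding intertwines_def
proof (intro ballI allI, rule cinner_ext)
  fix \<gamma> g f assume \<gamma>: "\<gamma> \<in> \<Gamma>"
  have ii: "inv (a (i \<gamma>)) = a \<gamma>" "inv (b (i \<gamma>)) = b \<gamma>"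
    using \<gamma> by (simp_all add: A.inv_act B.inv_act A.inverse_in A.inverse_inverse)
  have "cinner f (blinfun_apply (adj X) (translate (b \<gamma>) g)) = cinner (blinfun_apply X f) (translate (b \<gamma>) g)"
    by (rule cinner_adj[OF X(1), symmetric])
  also have "\<dots> = cinner (translate (b (i \<gamma>)) (blinfun_apply X f)) g"
    using cinner_translate[OF B.bij_act[OF A.inverse_in[OF \<gamma>]]] by (simp add: ii)
  also have "\<dots> = cinner (blinfun_apply X (translate (a (i \<gamma>)) f)) g"
    using X(2) A.inverse_in[OF \<gamma>] by (simp add: intertwines_def)
  also have "\<dots> = cinner (translate (a (i \<gamma>)) f) (blinfun_apply (adj X) g)" by (rule cinner_adj[OF X(1)])
  also have "\<dots> = cinner f (translate (a \<gamma>) (blinfun_apply (adj X) g))"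
    using cinner_translate[OF A.bij_act[OF A.inverse_in[OF \<gamma>]]] by (simp add: ii)
  finally show "cinner f (blinfun_apply (adj X) (translate (b \<gamma>) g))
      = cinner f (translate (a \<gamma>) (blinfun_apply (adj X) g))" .
qed

lemma intertwines_inverse:
  assumes X: "intertwines \<Gamma> a a X" and W: "is_op_inverse S X W"
  shows "intertwines \<Gamma> a a W"
  unfolding intertwines_def
proof (intro ballI allI)
  fix \<gamma> f assume \<gamma>: "\<gamma> \<in> \<Gamma>"
  note w = W[unfolded is_op_inverse_def]
  have l: "blinfun_apply W (blinfun_apply X g) = blinfun_apply (ident S) g"
    and r: "blinfun_apply X (blinfun_apply W g) = blinfun_apply (ident S) g" for g
    using w by (metis blinfun_apply_blinfun_compose)+
  have iW: "blinfun_apply (ident S) (blinfun_apply W g) = blinfun_apply W g"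
    and Wi: "blinfun_apply W (blinfun_apply (ident S) g) = blinfun_apply W g" for g
    using w op_ident_square[of W S] by (metis blinfun_apply_blinfun_compose)+
  note ti = intertwines_ident[unfolded intertwines_def, rule_format, OF \<gamma>]
  \<comment> \<open>W depends only on the part of its argument supported on S, and on that part X W
    is the identity; this inserts X W before the translation, where X can be commuted past
    it.\<close>
  have "blinfun_apply W (translate (a \<gamma>) f) = blinfun_apply W (translate (a \<gamma>) (blinfun_apply (ident S) f))"
    by (simp add: Wi flip: ti)
  also have "\<dots> = blinfun_apply W (blinfun_apply X (translate (a \<gamma>) (blinfun_apply W f)))"
    using X \<gamma> by (simp add: intertwines_def flip: r)
  also have "\<dots> = translate (a \<gamma>) (blinfun_apply W f)" by (simp add: l ti iW)
  finally show "blinfun_apply W (translate (a \<gamma>) f) = translate (a \<gamma>) (blinfun_apply W f)" .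
qed

lemma Gamma_trace_weight: "Gamma_trace a \<Gamma> F X = (\<Sum>\<^sub>\<infinity>x\<in>F. A.weight x *\<^sub>R entry X x x)"
  unfolding Gamma_trace_def A.weight_def by (intro infsum_cong) (simp add: scaleR_conv_of_real)

text \<open>For the invariant kernel k(x, y) = Y(x, y) X(y, x), row sums are the diagonal entries of
  Y X and column sums those of X Y. The right-hand side is the trace over G written out;
  \<open>Gamma_trace_commute\<close> folds it back.\<close>

lemma Gamma_trace_cyclic:
  assumes X: "X \<in> operators S T" "intertwines \<Gamma> a b X" and Y: "Y \<in> operators T S" "intertwines \<Gamma> b a Y"
    and sm: "A.weight summable_on F"
  shows "Gamma_trace a \<Gamma> F (Y o\<^sub>L X) = (\<Sum>\<^sub>\<infinity>y\<in>G. B.weight y *\<^sub>R entry (X o\<^sub>L Y) y y)"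
proof -
  define k where "k x y = entry Y x y * entry X y x" for x y
  have kc: "k x y = entry X y x * entry Y x y" for x y by (simp add: k_def mult.commute)
  have "Gamma_trace a \<Gamma> F (Y o\<^sub>L X) = (\<Sum>\<^sub>\<infinity>x\<in>F. A.weight x *\<^sub>R (\<Sum>\<^sub>\<infinity>y\<in>T. k x y))"
    unfolding Gamma_trace_weight k_def entry_compose_on(2)[OF Y(1)] ..
  also have "\<dots> = (\<Sum>\<^sub>\<infinity>y\<in>G. B.weight y *\<^sub>R (\<Sum>\<^sub>\<infinity>x\<in>S. k x y))"
  proof (rule mass_transport(1)[OF S T])
    show "k (a \<gamma> x) (b \<gamma> y) = k x y" if "\<gamma> \<in> \<Gamma>" for \<gamma> x y
    proof -
      have "entry Y (a \<gamma> x) (b \<gamma> y) = entry Y x y"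
      proof -
        have "blinfun_apply Y (delta (b \<gamma> y)) = translate (a \<gamma>) (blinfun_apply Y (delta y))"
          using Y(2) that unfolding intertwines_def by (metis translate_delta B.bij_act)
        then show ?thesis unfolding entry_def
          using that by (simp add: coeff_translate A.bij_act A.inv_act A.act_inverse)
      qed
      then show ?thesis by (simp add: k_def entry_intertwines[OF X(2) that])
    qed
    show "k x abs_summable_on T" for x
      unfolding k_def[abs_def] by (rule entry_compose_on(1)[OF Y(1)])
    show "(\<lambda>x. k x y) abs_summable_on S" for y
      unfolding kc by (rule entry_compose_on(1)[OF X(1)])
    \<comment> \<open>A bound on all row sums at once, so that the weighted row sums are dominated
      by C times the weights.\<close>
    define C where "C = (norm (adj Y))\<^sup>2 + (norm X)\<^sup>2"
    have "(\<lambda>x. norm (A.weight x * (\<Sum>\<^sub>\<infinity>y\<in>T. norm (k x y)))) summable_on F"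
    proof (rule Infinite_Sum.abs_summable_on_comparison_test')
      show "(\<lambda>x. C * A.weight x) summable_on F" by (rule summable_on_cmult_right[OF sm])
      fix x
      have "A.weight x * (\<Sum>\<^sub>\<infinity>y\<in>T. norm (k x y)) \<le> A.weight x * C"
        unfolding k_def C_def by (rule mult_left_mono[OF entry_compose_on(3)[OF Y(1)] A.weight_nonneg])
      then show "norm (A.weight x * (\<Sum>\<^sub>\<infinity>y\<in>T. norm (k x y))) \<le> C * A.weight x"
        by (simp add: A.weight_nonneg infsum_nonneg mult.commute)
    qed
    then show "(\<lambda>x. A.weight x * (\<Sum>\<^sub>\<infinity>y\<in>T. norm (k x y))) summable_on F" by (rule Infinite_Sum.abs_summable_summable)
  qed
  also have "\<dots> = (\<Sum>\<^sub>\<infinity>y\<in>G. B.weight y *\<^sub>R entry (X o\<^sub>L Y) y y)"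
    unfolding kc entry_compose_on(2)[OF X(1)] ..
  finally show ?thesis .
qed

lemma entry_le_norm: "cmod (entry X x y) \<le> norm X"
  unfolding entry_def using order_trans[OF coeff_le_norm norm_blinfun[of X "delta y"]] by simp

text \<open>Every entry is at most the operator norm, and the weights are summable. Continuity in
  the operator norm is what lets the trace pass through the logarithm and Neumann series.\<close>

lemma bounded_linear_Gamma_trace:
  assumes sm: "A.weight summable_on F"
  shows "bounded_linear (Gamma_trace a \<Gamma> F)"
proof (rule bounded_linear_intro[where K = "infsum A.weight F"])
  have le: "norm (A.weight x *\<^sub>R entry X x x) \<le> norm X * A.weight x" for x X
    using mult_left_mono[OF entry_le_norm A.weight_nonneg] by (simp add: A.weight_nonneg mult.commute)
  have s: "(\<lambda>x. A.weight x *\<^sub>R entry X x x) abs_summable_on F" for X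
    by (rule Infinite_Sum.abs_summable_on_comparison_test'[OF summable_on_cmult_right[OF sm] le])
  show "Gamma_trace a \<Gamma> F (X + Y) = Gamma_trace a \<Gamma> F X + Gamma_trace a \<Gamma> F Y" for X Y
    unfolding Gamma_trace_weight
    using infsum_add[OF Infinite_Sum.abs_summable_summable[OF s[of X]] Infinite_Sum.abs_summable_summable[OF s[of Y]]]
    by (simp add: entry_def blinfun.add_left scaleR_add_right)
  show "Gamma_trace a \<Gamma> F (r *\<^sub>R X) = r *\<^sub>R Gamma_trace a \<Gamma> F X" for r X
    unfolding Gamma_trace_weight infsum_scaleR_right[symmetric]
    by (simp add: entry_def blinfun.scaleR_left scaleR_conv_of_real mult_ac)
  fix X
  have "norm (Gamma_trace a \<Gamma> F X) \<le> (\<Sum>\<^sub>\<infinity>x\<in>F. norm (A.weight x *\<^sub>R entry X x x))"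
    unfolding Gamma_trace_weight by (rule norm_infsum_bound[OF s])
  also have "\<dots> \<le> (\<Sum>\<^sub>\<infinity>x\<in>F. norm X * A.weight x)"
    by (rule infsum_mono[OF s summable_on_cmult_right[OF sm] le])
  also have "\<dots> = norm X * infsum A.weight F" by (rule infsum_cmult_right')
  finally show "norm (Gamma_trace a \<Gamma> F X) \<le> norm X * infsum A.weight F" .
qed

lemma Gamma_trace_scale: "Gamma_trace a \<Gamma> F (c *\<^sub>O X) = c * Gamma_trace a \<Gamma> F X"
  unfolding Gamma_trace_def infsum_cmult_right'[symmetric] by (simp add: entry_def mult_ac)

end

section \<open>Complex derivative of the trace of a logarithm\<close>

lemma has_derivative_opow:
  assumes N: "(N has_derivative (\<lambda>h. h *\<^sub>O M)) (at u)" and MN: "M o\<^sub>L N u = N u o\<^sub>L M"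
    and Nu: "N u \<in> operators S S"
  shows "((\<lambda>u. opow S (N u) (Suc k)) has_derivative (\<lambda>h. h *\<^sub>O (real (Suc k) *\<^sub>R (M o\<^sub>L opow S (N u) k)))) (at u)"
proof (induction k)
  case 0
  have "((\<lambda>u. N u o\<^sub>L ident S) has_derivative (\<lambda>h. (h *\<^sub>O M) o\<^sub>L ident S)) (at u)"
    by (rule bounded_linear.has_derivative[OF blinfun_compose.bounded_linear_left N])
  then show ?case by (simp add: opow_Suc op_scale_compose_left)
next
  case (Suc k)
  have "((\<lambda>u. N u o\<^sub>L opow S (N u) (Suc k)) has_derivative
      (\<lambda>h. (N u o\<^sub>L (h *\<^sub>O (real (Suc k) *\<^sub>R (M o\<^sub>L opow S (N u) k)))) + ((h *\<^sub>O M) o\<^sub>L opow S (N u) (Suc k)))) (at u)"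
    by (rule blinfun_compose.FDERIV[OF N Suc])
  \<comment> \<open>Since M commutes with N u, the two Leibniz terms are multiples of the same
    product, with coefficients k + 1 and 1.\<close>
  moreover have "(N u o\<^sub>L (h *\<^sub>O (real (Suc k) *\<^sub>R (M o\<^sub>L opow S (N u) k)))) + ((h *\<^sub>O M) o\<^sub>L opow S (N u) (Suc k))
      = h *\<^sub>O (real (Suc (Suc k)) *\<^sub>R (M o\<^sub>L opow S (N u) (Suc k)))" for h
  proof -
    have "N u o\<^sub>L (M o\<^sub>L opow S (N u) k) = M o\<^sub>L opow S (N u) (Suc k)"
      unfolding opow_Suc blinfun_compose_assoc[symmetric] MN ..
    then have "(N u o\<^sub>L (h *\<^sub>O (real (Suc k) *\<^sub>R (M o\<^sub>L opow S (N u) k)))) + ((h *\<^sub>O M) o\<^sub>L opow S (N u) (Suc k))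
        = (h * of_nat (Suc k) + h) *\<^sub>O (M o\<^sub>L opow S (N u) (Suc k))"
      by (simp add: op_scale_compose_right[OF Nu] op_scale_compose_left scaleR_op op_scale_scale
          op_scale_add_left del: of_nat_Suc)
    then show ?thesis by (simp add: scaleR_op op_scale_scale algebra_simps)
  qed
  ultimately show ?case by (simp add: opow_Suc[of S _ "Suc k"])
qed

text \<open>Termwise differentiation: as N(u) = u P + u^2 Q commutes with N'(u), the term N^(k+1) /
  (k+1) has derivative N' N^k, and these sum to N' times the Neumann series. The quadratic form of N
  serves both sides of the identity: u U with Q = 0, and 1 - B(u).\<close>

lemma trace_log_series_derivative:
  fixes \<tau> :: "('a ell2 \<Rightarrow>\<^sub>L 'a ell2) \<Rightarrow> complex"
  assumes \<tau>: "bounded_linear \<tau>" "\<And>c X. \<tau> (c *\<^sub>O X) = c * \<tau> X"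
    and PQ: "P \<in> operators S S" "Q \<in> operators S S" "P o\<^sub>L Q = Q o\<^sub>L P"
    and small: "\<And>u. cmod u < \<epsilon> \<Longrightarrow> norm (u *\<^sub>O P + u\<^sup>2 *\<^sub>O Q) \<le> r" and r: "r < 1"
    and u: "cmod u < \<epsilon>"
  shows "((\<lambda>u. \<tau> (log_series S (u *\<^sub>O P + u\<^sup>2 *\<^sub>O Q))) has_field_derivative
    - \<tau> ((P + (2 * u) *\<^sub>O Q) o\<^sub>L neumann S (u *\<^sub>O P + u\<^sup>2 *\<^sub>O Q))) (at u)"
proof -
  define N where "N u = u *\<^sub>O P + u\<^sup>2 *\<^sub>O Q" for u
  define M where "M u = P + (2 * u) *\<^sub>O Q" for u
  have Nop: "N u \<in> operators S S" for u unfolding N_def by (intro operators_add operators_scale PQ)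
  have MN: "M u o\<^sub>L N u = N u o\<^sub>L M u" for u
    by (simp add: M_def N_def blinfun_compose.add_left blinfun_compose.add_right op_scale_compose_left
        op_scale_compose_right[OF PQ(1)] op_scale_compose_right[OF PQ(2)] op_scale_add_right op_scale_scale PQ(3)
        power2_eq_square mult_ac)
  have dN: "(N has_derivative (\<lambda>h. h *\<^sub>O M u)) (at u)" for u
  proof -
    note bl = bounded_bilinear.bounded_linear_left[OF bounded_bilinear_op_scale]
    have "((\<lambda>u. u *\<^sub>O P) has_derivative (\<lambda>h. h *\<^sub>O P)) (at u)"
      by (rule bounded_linear_imp_has_derivative[OF bl])
    moreover have "((\<lambda>u. u\<^sup>2) has_derivative (\<lambda>h. 2 * u * h)) (at u)"
      by (rule has_derivative_eq_rhs, (rule derivative_intros)+) (auto simp: fun_eq_iff)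
    from bounded_linear.has_derivative[OF bl this]
    have "((\<lambda>u. u\<^sup>2 *\<^sub>O Q) has_derivative (\<lambda>h. (2 * u * h) *\<^sub>O Q)) (at u)" .
    ultimately have "((\<lambda>u. u *\<^sub>O P + u\<^sup>2 *\<^sub>O Q) has_derivative (\<lambda>h. h *\<^sub>O P + (2 * u * h) *\<^sub>O Q)) (at u)"
      by (rule has_derivative_add)
    then show ?thesis
      by (simp add: N_def[abs_def] M_def op_scale_add_right op_scale_scale mult_ac)
  qed
  have N1: "norm (N u) \<le> r" "norm (N u) < 1" if "cmod u < \<epsilon>" for u
    using small[OF that] r unfolding N_def by auto
  have r0: "0 \<le> r" using N1(1)[OF u] norm_ge_zero order_trans by blast
  define f where "f k u = - (1 / of_nat (Suc k)) * \<tau> (opow S (N u) (Suc k))" for k u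
  define f' where "f' k u = - \<tau> (M u o\<^sub>L opow S (N u) k)" for k u
  have df: "(f k has_field_derivative f' k u) (at u within ball 0 \<epsilon>)" for k u
  proof -
    have "((\<lambda>u. \<tau> (opow S (N u) (Suc k))) has_derivative
        (\<lambda>h. \<tau> (h *\<^sub>O (real (Suc k) *\<^sub>R (M u o\<^sub>L opow S (N u) k))))) (at u)"
      by (rule bounded_linear.has_derivative[OF \<tau>(1) has_derivative_opow[OF dN MN Nop]])
    moreover have "\<tau> (h *\<^sub>O (real (Suc k) *\<^sub>R (M u o\<^sub>L opow S (N u) k)))
        = of_nat (Suc k) * \<tau> (M u o\<^sub>L opow S (N u) k) * h" for h
      by (simp add: \<tau>(2) scaleR_op mult_ac del: of_nat_Suc)
    ultimately have "((\<lambda>u. \<tau> (opow S (N u) (Suc k))) has_field_derivative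
        of_nat (Suc k) * \<tau> (M u o\<^sub>L opow S (N u) k)) (at u)"
      unfolding has_field_derivative_def by simp
    from DERIV_cmult[OF this, of "- (1 / of_nat (Suc k))"]
    show ?thesis unfolding f_def f'_def by (simp add: has_field_derivative_at_within del: of_nat_Suc)
  qed
  \<comment> \<open>A bound for the norm of N'(u) = P + 2 u Q on the whole disk, which makes the
    differentiated series uniformly convergent.\<close>
  define K where "K = norm P + 2 * \<epsilon> * norm Q"
  obtain C where C: "\<And>X. norm (\<tau> X) \<le> norm X * C" "C \<ge> 0"
    using bounded_linear.nonneg_bounded[OF \<tau>(1)] by blast
  have \<epsilon>0: "0 \<le> \<epsilon>" using u norm_ge_zero[of u] by linarith
  have bound: "norm (f' k u) \<le> K * C * r ^ k" if v: "u \<in> ball 0 \<epsilon>" for k u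
  proof -
    have v': "cmod u < \<epsilon>" using v by simp
    have "norm (M u) \<le> norm P + norm ((2 * u) *\<^sub>O Q)" unfolding M_def by (rule norm_triangle_ineq)
    also have "\<dots> \<le> K" unfolding K_def norm_op_scale using v' by (auto intro!: mult_right_mono simp: norm_mult)
    finally have MK: "norm (M u) \<le> K" .
    have "norm (opow S (N u) k) \<le> r ^ k"
      by (rule order_trans[OF norm_opow_le power_mono[OF N1(1)[OF v']]]) simp
    with MK have "norm (M u o\<^sub>L opow S (N u) k) \<le> K * r ^ k" by (rule norm_compose_le)
    then have "norm (M u o\<^sub>L opow S (N u) k) * C \<le> K * r ^ k * C" by (rule mult_right_mono[OF _ C(2)])
    then show ?thesis unfolding f'_def using C(1)[of "M u o\<^sub>L opow S (N u) k"] by (simp add: mult_ac)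
  qed
  have sm: "summable (\<lambda>k. K * C * r ^ k)" using r r0 by (intro summable_mult summable_geometric) simp
  have ul: "uniform_limit (ball 0 \<epsilon>) (\<lambda>n u. \<Sum>k<n. f' k u) (\<lambda>u. \<Sum>k. f' k u) sequentially"
    by (rule Weierstrass_m_test[OF bound sm])
  have fs: "(\<lambda>k. f k u) sums \<tau> (log_series S (N u))" if v: "cmod u < \<epsilon>" for u
  proof -
    from bounded_linear.sums[OF \<tau>(1) log_series_sums[OF N1(2)[OF v], of S]]
    have "(\<lambda>k. \<tau> ((1 / real (Suc k)) *\<^sub>R opow S (N u) (Suc k))) sums \<tau> (- log_series S (N u))" .
    from sums_minus[OF this] show ?thesis
      unfolding f_def by (simp add: scaleR_op[of "1 / _"] \<tau>(2) uminus_op[of "log_series S (N u)"] del: of_nat_Suc)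
  qed
  have "\<exists>g. \<forall>x\<in>ball 0 \<epsilon>. (\<lambda>k. f k x) sums g x \<and> (g has_field_derivative (\<Sum>k. f' k x)) (at x within ball 0 \<epsilon>)"
    by (rule has_field_derivative_series[OF convex_ball df ul, of u]) (use u fs[OF u] in \<open>auto simp: sums_iff\<close>)
  then obtain g where g: "\<And>x. x \<in> ball 0 \<epsilon> \<Longrightarrow> (\<lambda>k. f k x) sums g x"
    "\<And>x. x \<in> ball 0 \<epsilon> \<Longrightarrow> (g has_field_derivative (\<Sum>k. f' k x)) (at x within ball 0 \<epsilon>)" by blast
  have ub: "u \<in> ball 0 \<epsilon>" using u by simp
  have "(g has_field_derivative (\<Sum>k. f' k u)) (at u)"
    using g(2)[OF ub] at_within_open[OF ub open_ball] by simp
  moreover have "(\<Sum>k. f' k u) = - \<tau> (M u o\<^sub>L neumann S (N u))"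
  proof -
    have "(\<lambda>k. \<tau> (M u o\<^sub>L opow S (N u) k)) sums \<tau> (M u o\<^sub>L neumann S (N u))"
      by (rule bounded_linear.sums[OF \<tau>(1)
            bounded_linear.sums[OF blinfun_compose.bounded_linear_right neumann_sums[OF N1(2)[OF u]]]])
    from sums_minus[OF this] show ?thesis unfolding f'_def by (rule sums_unique[symmetric])
  qed
  ultimately have "(g has_field_derivative - \<tau> (M u o\<^sub>L neumann S (N u))) (at u)" by simp
  then have "((\<lambda>u. \<tau> (log_series S (N u))) has_field_derivative - \<tau> (M u o\<^sub>L neumann S (N u))) (at u)"
  proof (rule has_field_derivative_transform_within_open[OF _ open_ball ub])
    fix x :: complex assume "x \<in> ball 0 \<epsilon>"
    then show "g x = \<tau> (log_series S (N x))" using g(1)[of x] fs[of x] sums_unique2 by auto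
  qed
  then show ?thesis unfolding N_def M_def .
qed

lemma log_series_zero: "log_series S 0 = 0"
  by (simp add: log_series_def opow_Suc)

subsection \<open>Two coisometries\<close>

locale two_coisometries =
  fixes S :: "'a set" and T :: "'b set" and d1 d2 :: "'a ell2 \<Rightarrow>\<^sub>L 'b ell2" and a b :: complex
  assumes d1: "d1 \<in> operators S T" and d1_adj: "d1 o\<^sub>L adj d1 = ident T"
    and d2: "d2 \<in> operators S T" and d2_adj: "d2 o\<^sub>L adj d2 = ident T"
begin

definition J where "J = (adj d1 o\<^sub>L d1) - (ident S - (adj d1 o\<^sub>L d1))"

definition C where "C = a *\<^sub>O (adj d2 o\<^sub>L d2) + b *\<^sub>O (ident S - (adj d2 o\<^sub>L d2))"

definition H where "H = d2 o\<^sub>L adj d1 o\<^sub>L d1 o\<^sub>L adj d2"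

lemma adj_ops: "adj d1 \<in> operators T S" "adj d2 \<in> operators T S"
  using operators_adj d1 d2 by auto

lemma J_op: "J \<in> operators S S"
  unfolding J_def by (intro operators_diff operators_ident operators_compose[OF adj_ops(1) d1])

lemma C_op: "C \<in> operators S S"
  unfolding C_def
  by (intro operators_add operators_scale operators_diff operators_ident operators_compose[OF adj_ops(2) d2])

lemma H_op: "H \<in> operators T T"
  unfolding H_def
  by (intro operators_compose[OF _ adj_ops(2)] operators_compose[OF _ d1] operators_compose[OF _ adj_ops(1)] d2)

lemma coisometry_apply:
  "blinfun_apply d1 (blinfun_apply (adj d1) w) = blinfun_apply (ident T) w"
  "blinfun_apply d2 (blinfun_apply (adj d2) w) = blinfun_apply (ident T) w"
  using d1_adj d2_adj by (metis blinfun_apply_blinfun_compose)+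

lemma ident_apply:
  "blinfun_apply (ident S) (blinfun_apply (adj d1) w) = blinfun_apply (adj d1) w"
  "blinfun_apply (ident S) (blinfun_apply (adj d2) w) = blinfun_apply (adj d2) w"
  "blinfun_apply (ident T) (blinfun_apply d1 v) = blinfun_apply d1 v"
  "blinfun_apply (ident T) (blinfun_apply d2 v) = blinfun_apply d2 v"
  "blinfun_apply d1 (blinfun_apply (ident S) v) = blinfun_apply d1 v"
  "blinfun_apply d2 (blinfun_apply (ident S) v) = blinfun_apply d2 v"
  "blinfun_apply (adj d1) (blinfun_apply (ident T) w) = blinfun_apply (adj d1) w"
  "blinfun_apply (adj d2) (blinfun_apply (ident T) w) = blinfun_apply (adj d2) w"
  "blinfun_apply (ident S) (blinfun_apply (ident S) v) = blinfun_apply (ident S) v"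
  by (metis op_ident_left op_ident_right blinfun_apply_blinfun_compose adj_ops d1 d2 operators_ident)+

lemma J_apply: "blinfun_apply J v = 2 *\<^sub>C blinfun_apply (adj d1) (blinfun_apply d1 v) - blinfun_apply (ident S) v"
  unfolding J_def by (rule ell2_eqI) (simp add: blinfun.diff_left)

lemma linear_apply:
  "A \<in> {d1, d2} \<Longrightarrow> blinfun_apply A (c *\<^sub>C v) = c *\<^sub>C blinfun_apply A v"
  "A' \<in> {adj d1, adj d2} \<Longrightarrow> blinfun_apply A' (c *\<^sub>C w) = c *\<^sub>C blinfun_apply A' w"
  using operators_scaleC d1 d2 adj_ops by blast+

lemmas apply_simps = linear_apply coisometry_apply ident_apply operators_scaleC[OF operators_ident]
  blinfun.add_left blinfun.diff_left blinfun.add_right blinfun.diff_right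

lemma J_ident: "blinfun_apply J (blinfun_apply (ident S) v) = blinfun_apply J v"
  and ident_J: "blinfun_apply (ident S) (blinfun_apply J v) = blinfun_apply J v"
  by (metis op_ident_square J_op blinfun_apply_blinfun_compose)+

text \<open>The coisometry relation makes \<open>d1\<close> absorb the reflection: d1 J = 2 d1 - d1
  = d1. Substituting this into J = 2 (adj d1) d1 - 1, evaluated at J v, cancels everything but
  v.\<close>

lemma J_J: "blinfun_apply J (blinfun_apply J v) = blinfun_apply (ident S) v"
proof -
  define w where "w = blinfun_apply d1 v"
  have w: "blinfun_apply d1 (blinfun_apply J v) = 2 *\<^sub>C blinfun_apply (ident T) w - w"
    by (simp add: J_apply apply_simps w_def)
  have "blinfun_apply (ident T) w = w" by (simp add: w_def apply_simps)
  then have "blinfun_apply d1 (blinfun_apply J v) = w" using w by (intro ell2_eqI) simp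
  then have "blinfun_apply J (blinfun_apply J v) = 2 *\<^sub>C blinfun_apply (adj d1) w - blinfun_apply J v"
    unfolding J_apply[of "blinfun_apply J v"] by (simp add: ident_J)
  then show ?thesis by (simp add: J_apply w_def del: coeff_ident)
qed

lemma C_apply: "blinfun_apply C v
    = (a - b) *\<^sub>C blinfun_apply (adj d2) (blinfun_apply d2 v) + b *\<^sub>C blinfun_apply (ident S) v"
  unfolding C_def by (rule ell2_eqI) (simp add: blinfun.add_left blinfun.diff_left algebra_simps del: coeff_ident)

section \<open>The inverse of \<open>ident S - u *\<^sub>O (J o\<^sub>L C)\<close> by a Woodbury
  formula\<close>

definition B :: "complex \<Rightarrow> 'b ell2 \<Rightarrow>\<^sub>L 'b ell2" where
  "B u = ((1 + a * u) * (1 - b * u)) *\<^sub>O ident T - (2 * (a - b) * u) *\<^sub>O H"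

text \<open>With s = 1 - u^2 b^2, the relation J^2 = 1 makes \<open>K' u\<close> equal to s times
  the inverse of 1 - u b J, for s nonzero. \<open>K u\<close> is \<open>K' u\<close> multiplied by
  J.\<close>

definition K :: "complex \<Rightarrow> 'a ell2 \<Rightarrow>\<^sub>L 'a ell2" where
  "K u = J + (u * b) *\<^sub>O ident S"

definition K' :: "complex \<Rightarrow> 'a ell2 \<Rightarrow>\<^sub>L 'a ell2" where
  "K' u = ident S + (u * b) *\<^sub>O J"

lemma K_op: "K u \<in> operators S S" "K' u \<in> operators S S"
  unfolding K_def K'_def by (intro operators_add operators_scale operators_ident J_op)+

text \<open>This identifies B(u) as s = 1 - u^2 b^2 times the Schur complement 1 - u (a - b) d2 (1 -
  u b J)^(-1) J (adj d2). It follows from d2 J (adj d2) = 2 H - 1.\<close>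

lemma scaled_d2_K:
  assumes w: "blinfun_apply (ident T) w = w"
  shows "(u * (a - b)) *\<^sub>C blinfun_apply d2 (blinfun_apply (K u) (blinfun_apply (adj d2) w))
    = (1 - u\<^sup>2 * b\<^sup>2) *\<^sub>C w - blinfun_apply (B u) w"
proof -
  have "blinfun_apply d2 (blinfun_apply J (blinfun_apply (adj d2) w)) = 2 *\<^sub>C blinfun_apply H w - w"
    by (simp add: J_apply H_def apply_simps w)
  then have e: "blinfun_apply d2 (blinfun_apply (K u) (blinfun_apply (adj d2) w))
      = (2 *\<^sub>C blinfun_apply H w - w) + (u * b) *\<^sub>C w"
    by (simp add: K_def apply_simps w)
  show ?thesis
    unfolding e by (intro ell2_eqI) (simp add: B_def apply_simps w algebra_simps power2_eq_square del: coeff_ident)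
qed

text \<open>The Woodbury form of the inverse, with beta standing for the inverse of B(u). The
  correction term is bracketed as a map from T to S after a map from S to T, the two factors that
  the trace will interchange.\<close>

definition G :: "complex \<Rightarrow> ('b ell2 \<Rightarrow>\<^sub>L 'b ell2) \<Rightarrow> 'a ell2 \<Rightarrow>\<^sub>L 'a ell2" where
  "G u \<beta> = (1 / (1 - u\<^sup>2 * b\<^sup>2)) *\<^sub>O
     (K' u + (u * (a - b)) *\<^sub>O ((K u o\<^sub>L adj d2 o\<^sub>L \<beta>) o\<^sub>L (d2 o\<^sub>L K' u)))"

lemma G_op: "\<beta> \<in> operators T T \<Longrightarrow> G u \<beta> \<in> operators S S"
  unfolding G_def
  by (intro operators_scale operators_add K_op operators_compose[OF _ operators_compose[OF d2 K_op(2)]]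
      operators_compose[OF operators_compose[OF K_op(1) adj_ops(2)]])

text \<open>On f, the operator G returns (q + u (a - b) K z) / s. Multiplying by M = 1 - u J C gives
  M q = s f - u (a - b) r(q) and M (K z) = r(q), where r is J (adj d2) d2, so the r(q) terms cancel.
  The second equation is where B(u) beta = 1 enters. On the complement of S all of this is read
  through \<open>ident S\<close>.\<close>

lemma right_inverse_G:
  assumes \<beta>: "\<beta> \<in> operators T T" "B u o\<^sub>L \<beta> = ident T" and s0: "1 - u\<^sup>2 * b\<^sup>2 \<noteq> 0"
  shows "(ident S - u *\<^sub>O (J o\<^sub>L C)) o\<^sub>L G u \<beta> = ident S"
proof (rule blinfun_eqI)
  fix f
  define s where "s = 1 - u\<^sup>2 * b\<^sup>2"
  define q where "q = blinfun_apply (K' u) f"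
  define w where "w = blinfun_apply \<beta> (blinfun_apply d2 q)"
  define z where "z = blinfun_apply (adj d2) w"
  define Kz where "Kz = blinfun_apply (K u) z"
  define M where "M = ident S - u *\<^sub>O (J o\<^sub>L C)"
  define r where "r v = blinfun_apply J (blinfun_apply (adj d2) (blinfun_apply d2 v))" for v
  note Js = operators_scaleC[OF J_op]
  have M: "M \<in> operators S S"
    unfolding M_def by (intro operators_diff operators_ident operators_scale operators_compose[OF J_op C_op])
  have Mv: "blinfun_apply M v = blinfun_apply (ident S) v - u *\<^sub>C ((a - b) *\<^sub>C r v + b *\<^sub>C blinfun_apply J v)" for v
    by (simp add: M_def C_apply blinfun.diff_left blinfun.add_right Js J_ident r_def)
  have w: "blinfun_apply (ident T) w = w"
    unfolding w_def using op_ident_square(1)[OF \<beta>(1)] by (metis blinfun_apply_blinfun_compose)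
  have Bw: "blinfun_apply (B u) w = blinfun_apply d2 q"
    unfolding w_def using \<beta>(2) by (metis blinfun_apply_blinfun_compose ident_apply(4))
  have ez: "blinfun_apply (ident S) z = z" by (simp add: z_def ident_apply)
  have Kz: "Kz = blinfun_apply J z + (u * b) *\<^sub>C z"
    by (simp add: Kz_def K_def blinfun.add_left ez)
  have eKz: "blinfun_apply (ident S) Kz = Kz"
    by (simp add: Kz blinfun.add_right operators_scaleC[OF operators_ident] ident_J ez)
  have JKz: "blinfun_apply J Kz = z + (u * b) *\<^sub>C blinfun_apply J z"
    by (simp add: Kz blinfun.add_right Js J_J ez)
  have q: "q = blinfun_apply (ident S) f + (u * b) *\<^sub>C blinfun_apply J f"
    by (simp add: q_def K'_def blinfun.add_left)
  have eq: "blinfun_apply (ident S) q = q"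
    by (simp add: q blinfun.add_right operators_scaleC[OF operators_ident] ident_J ident_apply)
  have Jq: "blinfun_apply J q = blinfun_apply J f + (u * b) *\<^sub>C blinfun_apply (ident S) f"
    by (simp add: q blinfun.add_right Js J_J J_ident)
  have "(u * (a - b)) *\<^sub>C blinfun_apply d2 Kz = s *\<^sub>C w - blinfun_apply d2 q"
    using scaled_d2_K[OF w, of u] by (simp add: Bw Kz_def z_def s_def)
  then have "blinfun_apply J (blinfun_apply (adj d2) ((u * (a - b)) *\<^sub>C blinfun_apply d2 Kz))
      = blinfun_apply J (blinfun_apply (adj d2) (s *\<^sub>C w - blinfun_apply d2 q))" by simp
  then have rKz: "(u * (a - b)) *\<^sub>C r Kz = s *\<^sub>C blinfun_apply J z - r q"
    by (simp add: linear_apply Js r_def z_def blinfun.diff_right)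
  have Gf: "blinfun_apply (G u \<beta>) f = (1 / s) *\<^sub>C (q + (u * (a - b)) *\<^sub>C Kz)"
    by (simp add: G_def blinfun.add_left q_def w_def z_def Kz_def s_def)
  have "blinfun_apply (M o\<^sub>L G u \<beta>) f = blinfun_apply (ident S) f"
  proof (rule ell2_eqI)
    fix x
    have rx: "u * (a - b) * coeff (r Kz) x = s * coeff (blinfun_apply J z) x - coeff (r q) x"
      using arg_cong[OF rKz, of "\<lambda>f. coeff f x"] by simp
    have "s * coeff (blinfun_apply (M o\<^sub>L G u \<beta>) f) x
        = coeff (blinfun_apply M q) x + u * (a - b) * coeff (blinfun_apply M Kz) x"
      using s0 by (simp add: Gf operators_scaleC[OF M] blinfun.add_right s_def)
    also have "coeff (blinfun_apply M Kz) x
        = coeff Kz x - (s * coeff (blinfun_apply J z) x - coeff (r q) x) - u * b * coeff (blinfun_apply J Kz) x"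
      unfolding Mv eKz rx[symmetric] by (simp add: algebra_simps)
    also have "\<dots> = coeff (r q) x"
      unfolding JKz unfolding Kz s_def by (simp add: algebra_simps power2_eq_square)
    also have "coeff (blinfun_apply M q) x = s * coeff (blinfun_apply (ident S) f) x - u * (a - b) * coeff (r q) x"
      unfolding Mv eq Jq unfolding q s_def by (simp add: algebra_simps power2_eq_square del: coeff_ident)
    finally have "s * coeff (blinfun_apply (M o\<^sub>L G u \<beta>) f) x = s * coeff (blinfun_apply (ident S) f) x"
      by simp
    then show "coeff (blinfun_apply (M o\<^sub>L G u \<beta>) f) x = coeff (blinfun_apply (ident S) f) x"
      using s0 by (simp only: s_def[symmetric] mult_cancel_left) simp
  qed
  then show "blinfun_apply ((ident S - u *\<^sub>O (J o\<^sub>L C)) o\<^sub>L G u \<beta>) f = blinfun_apply (ident S) f"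
    unfolding M_def .
qed

text \<open>A right inverse coincides with any two-sided inverse; the two-sided inverse W will come
  from the Neumann series.\<close>

lemma resolvent_eq_G:
  assumes "\<beta> \<in> operators T T" "B u o\<^sub>L \<beta> = ident T" "1 - u\<^sup>2 * b\<^sup>2 \<noteq> 0"
    and W: "is_op_inverse S (ident S - u *\<^sub>O (J o\<^sub>L C)) W"
  shows "W = G u \<beta>"
proof -
  have "W = W o\<^sub>L ((ident S - u *\<^sub>O (J o\<^sub>L C)) o\<^sub>L G u \<beta>)"
    using W unfolding right_inverse_G[OF assms(1-3)] by (simp add: is_op_inverse_def op_ident_square)
  also have "\<dots> = G u \<beta>"
    using W unfolding blinfun_compose_assoc[symmetric]
    by (simp add: is_op_inverse_def op_ident_square(1)[OF G_op[OF assms(1)]])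
  finally show ?thesis .
qed

text \<open>The product of the two correction factors in the opposite order, an operator on T. Here
  K' K = (1 + u^2 b^2) J + 2 u b, and \<open>scaled_d2_K\<close> eliminates d2 J (adj d2) in favour
  of B(u), which cancels against beta. The remaining coefficient of beta factors because s + u^2 b^2
  + u^2 b (a - b) + u^2 b^2 = 1 + a b u^2 + u^2 b^2 - u^2 b^2 + u^2 b^2 - u^2 b^2 after dividing out
  s.\<close>

lemma reversed_product:
  assumes \<beta>: "\<beta> \<in> operators T T" "B u o\<^sub>L \<beta> = ident T"
  shows "(u * (a - b)) *\<^sub>O ((d2 o\<^sub>L K' u) o\<^sub>L (K u o\<^sub>L adj d2 o\<^sub>L \<beta>))
    = ((1 + a * b * u\<^sup>2) * (1 - u\<^sup>2 * b\<^sup>2)) *\<^sub>O \<beta> - (1 + u\<^sup>2 * b\<^sup>2) *\<^sub>O ident T"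
proof (rule blinfun_eqI, rule ell2_eqI)
  fix g x
  define w where "w = blinfun_apply \<beta> g"
  define z where "z = blinfun_apply (adj d2) w"
  have w: "blinfun_apply (ident T) w = w"
    unfolding w_def using op_ident_square(1)[OF \<beta>(1)] by (metis blinfun_apply_blinfun_compose)
  have Bw: "blinfun_apply (B u) w = blinfun_apply (ident T) g"
    unfolding w_def using \<beta>(2) by (metis blinfun_apply_blinfun_compose)
  have ez: "blinfun_apply (ident S) z = z" by (simp add: z_def ident_apply)
  have dz: "blinfun_apply d2 z = w" by (simp add: z_def coisometry_apply w)
  have Kz: "blinfun_apply (K u) z = blinfun_apply J z + (u * b) *\<^sub>C z"
    by (simp add: K_def blinfun.add_left ez)
  define y where "y = coeff (blinfun_apply d2 (blinfun_apply J z)) x"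
  have "coeff (blinfun_apply d2 (blinfun_apply (K' u) (blinfun_apply (K u) z))) x
      = (1 + u\<^sup>2 * b\<^sup>2) * y + 2 * u * b * coeff w x"
    unfolding Kz
    by (simp add: K'_def blinfun.add_left blinfun.add_right operators_scaleC[OF operators_ident]
        operators_scaleC[OF J_op] linear_apply ident_J J_J ez dz y_def algebra_simps power2_eq_square del: coeff_ident)
  moreover have "u * (a - b) * (y + u * b * coeff w x)
      = (1 - u\<^sup>2 * b\<^sup>2) * coeff w x - coeff (blinfun_apply (ident T) g) x"
    using arg_cong[OF scaled_d2_K[OF w, of u], of "\<lambda>f. coeff f x"]
    unfolding z_def[symmetric] Kz Bw by (simp add: blinfun.add_right linear_apply dz y_def del: coeff_ident)
  then have "u * (a - b) * y = (1 - u\<^sup>2 * b\<^sup>2) * coeff w x - coeff (blinfun_apply (ident T) g) x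
      - u * (a - b) * (u * b * coeff w x)" by (simp add: algebra_simps)
  ultimately have "u * (a - b) * coeff (blinfun_apply d2 (blinfun_apply (K' u) (blinfun_apply (K u) z))) x
      = (1 + u\<^sup>2 * b\<^sup>2) * ((1 - u\<^sup>2 * b\<^sup>2) * coeff w x - coeff (blinfun_apply (ident T) g) x
          - u * (a - b) * (u * b * coeff w x)) + u * (a - b) * (2 * u * b * coeff w x)"
    by (simp add: distrib_left mult.left_commute[of "u * (a - b)"])
  also have "\<dots> = (1 + a * b * u\<^sup>2) * (1 - u\<^sup>2 * b\<^sup>2) * coeff w x - (1 + u\<^sup>2 * b\<^sup>2) * coeff (blinfun_apply (ident T) g) x"
    by (simp add: algebra_simps power2_eq_square del: coeff_ident)
  finally show "coeff (blinfun_apply ((u * (a - b)) *\<^sub>O ((d2 o\<^sub>L K' u) o\<^sub>L (K u o\<^sub>L adj d2 o\<^sub>L \<beta>))) g) x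
    = coeff (blinfun_apply (((1 + a * b * u\<^sup>2) * (1 - u\<^sup>2 * b\<^sup>2)) *\<^sub>O \<beta> - (1 + u\<^sup>2 * b\<^sup>2) *\<^sub>O ident T) g) x"
    by (simp add: z_def w_def blinfun.diff_left del: coeff_ident)
qed

end

section \<open>Traces of the two resolvents\<close>

lemma Gamma_trace_commute:
  assumes S: "proper_action \<Gamma> i m e \<alpha> S F" and T: "proper_action \<Gamma> i m e \<alpha>' T F'"
    and X: "X \<in> operators S T" "intertwines \<Gamma> \<alpha> \<alpha>' X" and Y: "Y \<in> operators T S" "intertwines \<Gamma> \<alpha>' \<alpha> Y"
    and sm: "proper_action.weight \<Gamma> \<alpha> summable_on F"
  shows "Gamma_trace \<alpha> \<Gamma> F (Y o\<^sub>L X) = Gamma_trace \<alpha>' \<Gamma> F' (X o\<^sub>L Y)"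
  unfolding Gamma_trace_cyclic[OF S T X Y sm] Gamma_trace_weight[OF T T] ..

context two_coisometries
begin

context
  fixes \<Gamma> :: "'g set" and i m e \<alpha> F \<alpha>' F'
  assumes S: "proper_action \<Gamma> i m e \<alpha> S F" and T: "proper_action \<Gamma> i m e \<alpha>' T F'"
    and eq: "intertwines \<Gamma> \<alpha> \<alpha>' d1" "intertwines \<Gamma> \<alpha> \<alpha>' d2"
    and smS: "proper_action.weight \<Gamma> \<alpha> summable_on F" and smT: "proper_action.weight \<Gamma> \<alpha>' summable_on F'"
begin

abbreviation "TrS \<equiv> Gamma_trace \<alpha> \<Gamma> F"
abbreviation "TrT \<equiv> Gamma_trace \<alpha>' \<Gamma> F'"

interpretation trS: bounded_linear TrS by (rule bounded_linear_Gamma_trace[OF S S smS])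
interpretation trT: bounded_linear TrT by (rule bounded_linear_Gamma_trace[OF T T smT])

lemma TrS_scale: "TrS (c *\<^sub>O X) = c * TrS X" by (rule Gamma_trace_scale[OF S S])
lemma TrT_scale: "TrT (c *\<^sub>O X) = c * TrT X" by (rule Gamma_trace_scale[OF T T])

lemma eq_adj: "intertwines \<Gamma> \<alpha>' \<alpha> (adj d1)" "intertwines \<Gamma> \<alpha>' \<alpha> (adj d2)"
  using intertwines_adj[OF S T d1 eq(1)] intertwines_adj[OF S T d2 eq(2)] .

lemma eq_J: "intertwines \<Gamma> \<alpha> \<alpha> J"
  unfolding J_def
  by (intro intertwines_diff[OF S S] intertwines_compose[OF eq_adj(1) eq(1)] intertwines_ident[OF S S])

lemma eq_K: "intertwines \<Gamma> \<alpha> \<alpha> (K u)" "intertwines \<Gamma> \<alpha> \<alpha> (K' u)"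
  unfolding K_def K'_def
  by (intro intertwines_add[OF S S] intertwines_scale[OF S S] eq_J intertwines_ident[OF S S])+

lemma eq_B: "intertwines \<Gamma> \<alpha>' \<alpha>' (B u)"
  unfolding B_def H_def
  by (intro intertwines_diff[OF T T] intertwines_scale[OF T T] intertwines_ident[OF T T]
      intertwines_compose[OF _ eq_adj(2)] intertwines_compose[OF _ eq(1)] intertwines_compose[OF eq(2) eq_adj(1)])

text \<open>By cyclicity the projection (adj d1) d1 has the same trace as d1 (adj d1), the identity
  on T. This is the origin of the exponent in the determinant formula.\<close>

lemma trace_J: "TrS J = 2 * TrT (ident T) - TrS (ident S)"
  using Gamma_trace_commute[OF S T d1 eq(1) adj_ops(1) eq_adj(1) smS]
  unfolding J_def trS.diff d1_adj by simp

text \<open>Take the trace of the Woodbury formula and interchange the factors of its correction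
  term. The denominator s = (1 + b u)(1 - b u) then loses the factor 1 - b u in every term.\<close>

lemma trace_resolvent:
  assumes \<beta>: "is_op_inverse T (B u) \<beta>" and W: "is_op_inverse S (ident S - u *\<^sub>O (J o\<^sub>L C)) W"
    and nz: "1 + b * u \<noteq> 0" "1 - b * u \<noteq> 0"
  shows "TrS W = TrS (ident S) / (1 + b * u) - TrT (ident T) * (1 - b * u) / (1 + b * u)
    + (1 + a * b * u\<^sup>2) * TrT \<beta>"
proof -
  define s where "s = 1 - u\<^sup>2 * b\<^sup>2"
  have s: "s = (1 + b * u) * (1 - b * u)" unfolding s_def by (simp add: algebra_simps power2_eq_square)
  have s0: "s \<noteq> 0" unfolding s using nz by simp
  have \<beta>op: "\<beta> \<in> operators T T" and B\<beta>: "B u o\<^sub>L \<beta> = ident T" using \<beta> by (auto simp: is_op_inverse_def)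
  have eq\<beta>: "intertwines \<Gamma> \<alpha>' \<alpha>' \<beta>" by (rule intertwines_inverse[OF T T eq_B \<beta>])
  define X where "X = d2 o\<^sub>L K' u"
  define Y where "Y = K u o\<^sub>L adj d2 o\<^sub>L \<beta>"
  have X: "X \<in> operators S T" "intertwines \<Gamma> \<alpha> \<alpha>' X"
    unfolding X_def using operators_compose[OF d2 K_op(2)] intertwines_compose[OF eq(2) eq_K(2)] by auto
  have Y: "Y \<in> operators T S" "intertwines \<Gamma> \<alpha>' \<alpha> Y"
    unfolding Y_def
    using operators_compose[OF operators_compose[OF K_op(1) adj_ops(2)] \<beta>op]
      intertwines_compose[OF intertwines_compose[OF eq_K(1) eq_adj(2)] eq\<beta>] by auto
  have "(u * (a - b)) * TrS (Y o\<^sub>L X) = TrT ((u * (a - b)) *\<^sub>O (X o\<^sub>L Y))"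
    unfolding Gamma_trace_commute[OF S T X Y smS] TrT_scale ..
  also have "\<dots> = (1 + a * b * u\<^sup>2) * s * TrT \<beta> - (1 + u\<^sup>2 * b\<^sup>2) * TrT (ident T)"
    unfolding X_def Y_def reversed_product[OF \<beta>op B\<beta>] trT.diff TrT_scale s_def ..
  finally have XY: "(u * (a - b)) * TrS (Y o\<^sub>L X) = (1 + a * b * u\<^sup>2) * s * TrT \<beta> - (1 + u\<^sup>2 * b\<^sup>2) * TrT (ident T)" .
  have "W = G u \<beta>" by (rule resolvent_eq_G[OF \<beta>op B\<beta> s0[unfolded s_def] W])
  then have "TrS W = (1 / s) * (TrS (K' u) + (u * (a - b)) * TrS (Y o\<^sub>L X))"
    unfolding G_def X_def Y_def s_def by (simp only: TrS_scale trS.add)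
  then have "s * TrS W = TrS (K' u) + (u * (a - b)) * TrS (Y o\<^sub>L X)" using s0 by simp
  also have "TrS (K' u) = TrS (ident S) + u * b * (2 * TrT (ident T) - TrS (ident S))"
    unfolding K'_def by (simp only: TrS_scale trS.add trace_J)
  finally have sW: "s * TrS W = TrS (ident S) + u * b * (2 * TrT (ident T) - TrS (ident S))
      + ((1 + a * b * u\<^sup>2) * s * TrT \<beta> - (1 + u\<^sup>2 * b\<^sup>2) * TrT (ident T))" unfolding XY .
  have "s * (TrS (ident S) / (1 + b * u) - TrT (ident T) * (1 - b * u) / (1 + b * u) + (1 + a * b * u\<^sup>2) * TrT \<beta>)
      = (1 - b * u) * TrS (ident S) - TrT (ident T) * (1 - b * u) * (1 - b * u) + (1 + a * b * u\<^sup>2) * s * TrT \<beta>"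
    using nz unfolding distrib_left right_diff_distrib by (simp add: s) (simp add: algebra_simps)
  also have "\<dots> = s * TrS W" unfolding sW by (simp add: algebra_simps power2_eq_square)
  finally show ?thesis using s0 by (metis mult_cancel_left)
qed

text \<open>The identity in logarithmic form. The bounds by r are carried along so that both
  operators stay within reach of \<open>is_op_log_series\<close> for a disk of radius r inside the
  domain of the branch.\<close>

lemma log_traces:
  assumes r: "0 < r" "r < 1"
  shows "\<exists>\<epsilon>>0. \<forall>u. cmod u < \<epsilon> \<longrightarrow> norm (u *\<^sub>O (J o\<^sub>L C)) < r \<and> norm (ident T - B u) < r \<and> 1 + b * u \<noteq> 0 \<and>
    TrS (log_series S (u *\<^sub>O (J o\<^sub>L C)))
      = (TrS (ident S) - 2 * TrT (ident T)) * Ln (1 + b * u) + TrT (log_series T (ident T - B u))"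
proof -
  define U where "U = J o\<^sub>L C"
  \<comment> \<open>P and Q are the coefficients of u and u^2 in 1 - B(u).\<close>
  define P where "P = (2 * (a - b)) *\<^sub>O H - (a - b) *\<^sub>O ident T"
  define Q where "Q = (a * b) *\<^sub>O ident T"
  have Uop: "U \<in> operators S S" unfolding U_def by (rule operators_compose[OF J_op C_op])
  have PQop: "P \<in> operators T T" "Q \<in> operators T T" unfolding P_def Q_def
    by (intro operators_diff operators_scale operators_ident H_op)+
  have PQ: "P o\<^sub>L Q = Q o\<^sub>L P"
    unfolding Q_def op_scale_compose_right[OF PQop(1)] op_scale_compose_left
    by (simp add: op_ident_square PQop)
  have IB: "ident T - B u = u *\<^sub>O P + u\<^sup>2 *\<^sub>O Q" for u
    by (rule blinfun_eqI, rule ell2_eqI)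
       (simp add: B_def P_def Q_def blinfun.diff_left blinfun.add_left algebra_simps power2_eq_square)
  \<comment> \<open>c dominates each norm to be controlled, and |u| < r / (2 c) brings each product
    below r / 2. The summand 1 also gives epsilon <= 1, which allows u^2 to be estimated by
    u.\<close>
  define c where "c = norm U + norm P + norm Q + cmod b + 1"
  have c: "c \<ge> 1" unfolding c_def by simp
  define \<epsilon> where "\<epsilon> = r / (2 * c)"
  have \<epsilon>: "\<epsilon> > 0" "\<epsilon> \<le> 1" using r c by (auto simp: \<epsilon>_def divide_simps)
  have uc: "cmod u * c \<le> r / 2" if "cmod u < \<epsilon>" for u
    using that c by (simp add: \<epsilon>_def field_simps)
  have part: "cmod u * x \<le> r / 2" if "cmod u < \<epsilon>" "x \<le> c" for u x
    using order_trans[OF mult_left_mono[OF that(2)] uc[OF that(1)]] by simp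
  \<comment> \<open>The zero quadratic term puts u U into the shape required by
    \<open>trace_log_series_derivative\<close>.\<close>
  have smallU: "norm (u *\<^sub>O U + u\<^sup>2 *\<^sub>O 0) \<le> r / 2" if "cmod u < \<epsilon>" for u
    using part[OF that, of "norm U"] by (simp add: op_scale_zero_right norm_op_scale c_def)
  have smallB: "norm (u *\<^sub>O P + u\<^sup>2 *\<^sub>O Q) \<le> r / 2" if u: "cmod u < \<epsilon>" for u
  proof -
    have u1: "cmod u \<le> 1" using u \<epsilon> by simp
    have "norm (u *\<^sub>O P + u\<^sup>2 *\<^sub>O Q) \<le> cmod u * norm P + (cmod u)\<^sup>2 * norm Q"
      using norm_triangle_ineq[of "u *\<^sub>O P" "u\<^sup>2 *\<^sub>O Q"] by (simp add: norm_op_scale norm_power)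
    also have "\<dots> \<le> cmod u * norm P + cmod u * norm Q"
      using u1 by (intro add_left_mono mult_right_mono) (auto simp: power2_eq_square mult_left_le)
    also have "\<dots> = cmod u * (norm P + norm Q)" by (simp add: distrib_left)
    also have "\<dots> \<le> r / 2" by (rule part[OF u]) (simp add: c_def)
    finally show ?thesis .
  qed
  have bu: "cmod (b * u) < 1" if "cmod u < \<epsilon>" for u
    using part[OF that, of "cmod b"] r by (simp add: c_def norm_mult mult.commute)
  have re: "Re (1 + b * u) > 0" if "cmod u < \<epsilon>" for u
    using bu[OF that] abs_Re_le_cmod[of "b * u"] by simp
  have nz: "1 + b * u \<noteq> 0" "1 - b * u \<noteq> 0" "1 + b * u \<notin> \<real>\<^sub>\<le>\<^sub>0" if "cmod u < \<epsilon>" for u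
  proof -
    show "1 + b * u \<noteq> 0" using re[OF that] by (metis less_irrefl zero_complex.sel(1))
    have "Re (1 - b * u) > 0" using re[of "- u"] that by simp
    then show "1 - b * u \<noteq> 0" by (metis less_irrefl zero_complex.sel(1))
    show "1 + b * u \<notin> \<real>\<^sub>\<le>\<^sub>0" using re[OF that] by (simp add: complex_nonpos_Reals_iff)
  qed
  define \<kappa> where "\<kappa> = TrS (ident S) - 2 * TrT (ident T)"
  define \<Phi> where "\<Phi> u = TrS (log_series S (u *\<^sub>O U + u\<^sup>2 *\<^sub>O 0)) - \<kappa> * Ln (1 + b * u)
      - TrT (log_series T (u *\<^sub>O P + u\<^sup>2 *\<^sub>O Q))" for u
  have r2: "r / 2 < 1" using r by simp
  define W where "W u = neumann S (u *\<^sub>O U + u\<^sup>2 *\<^sub>O 0)" for u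
  define \<beta> where "\<beta> u = neumann T (u *\<^sub>O P + u\<^sup>2 *\<^sub>O Q)" for u
  have d: "(\<Phi> has_field_derivative - TrS ((U + (2 * u) *\<^sub>O 0) o\<^sub>L W u) - \<kappa> * (b / (1 + b * u))
      - - TrT ((P + (2 * u) *\<^sub>O Q) o\<^sub>L \<beta> u)) (at u)" if u: "cmod u < \<epsilon>" for u
  proof -
    have "((\<lambda>u. Ln (1 + b * u)) has_field_derivative b / (1 + b * u)) (at u)"
      using nz(3)[OF u] nz(1)[OF u] by (auto intro!: derivative_eq_intros simp: field_simps)
    then show ?thesis unfolding \<Phi>_def[abs_def] W_def \<beta>_def
      by (intro DERIV_diff DERIV_cmult
        trace_log_series_derivative[OF trS.bounded_linear_axioms TrS_scale Uop operators_zero _ smallU r2 u]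
        trace_log_series_derivative[OF trT.bounded_linear_axioms TrT_scale PQop PQ smallB r2 u]) auto
  qed
  \<comment> \<open>The derivative is multiplied by u before it is evaluated: u U W = W - 1, and the
    analogous relation holds for B(u), so only traces of the two resolvents remain. This is why u =
    0 is excluded.\<close>
  have zero: "- TrS ((U + (2 * u) *\<^sub>O 0) o\<^sub>L W u) - \<kappa> * (b / (1 + b * u))
      - - TrT ((P + (2 * u) *\<^sub>O Q) o\<^sub>L \<beta> u) = 0" if u: "cmod u < \<epsilon>" "u \<noteq> 0" for u
  proof -
    have N: "norm (u *\<^sub>O U) < 1" "norm (u *\<^sub>O P + u\<^sup>2 *\<^sub>O Q) < 1"
      using smallU[OF u(1)] smallB[OF u(1)] r by (auto simp: op_scale_zero_right)
    have W: "is_op_inverse S (ident S - u *\<^sub>O (J o\<^sub>L C)) (W u)"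
      using is_op_inverse_neumann[OF N(1) operators_scale[OF Uop]]
      by (simp add: W_def op_scale_zero_right U_def)
    have BI: "ident T - (u *\<^sub>O P + u\<^sup>2 *\<^sub>O Q) = B u" unfolding IB[symmetric] by simp
    have \<beta>: "is_op_inverse T (B u) (\<beta> u)"
      using is_op_inverse_neumann[OF N(2) operators_add[OF operators_scale[OF PQop(1)] operators_scale[OF PQop(2)]]]
      unfolding BI \<beta>_def .
    have Wop: "W u \<in> operators S S" and \<beta>op: "\<beta> u \<in> operators T T" using W \<beta> by (auto simp: is_op_inverse_def)
    have "(ident S - u *\<^sub>O U) o\<^sub>L W u = ident S" using W by (simp add: is_op_inverse_def U_def)
    then have "u *\<^sub>O (U o\<^sub>L W u) = W u - ident S"
      by (simp add: blinfun_compose.diff_left op_ident_square[OF Wop] op_scale_compose_left algebra_simps)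
    then have "TrS (u *\<^sub>O (U o\<^sub>L W u)) = TrS (W u) - TrS (ident S)" by (simp only: trS.diff)
    then have 1: "u * TrS ((U + (2 * u) *\<^sub>O 0) o\<^sub>L W u) = TrS (W u) - TrS (ident S)"
      by (simp add: TrS_scale op_scale_zero_right)
    \<comment> \<open>With N = u P + u^2 Q one has u N' = N + u^2 Q. The first part gives N beta =
      beta - 1 and the second is a scalar multiple of beta.\<close>
    have "u *\<^sub>O ((P + (2 * u) *\<^sub>O Q) o\<^sub>L \<beta> u) = ((u *\<^sub>O P + u\<^sup>2 *\<^sub>O Q) o\<^sub>L \<beta> u) + (u\<^sup>2 *\<^sub>O (Q o\<^sub>L \<beta> u))"
      by (rule blinfun_eqI, rule ell2_eqI) (simp add: blinfun.add_left algebra_simps power2_eq_square)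
    also have "(u *\<^sub>O P + u\<^sup>2 *\<^sub>O Q) o\<^sub>L \<beta> u = \<beta> u - ident T"
      using \<beta> unfolding IB[symmetric]
      by (simp add: blinfun_compose.diff_left op_ident_square[OF \<beta>op] is_op_inverse_def)
    also have "u\<^sup>2 *\<^sub>O (Q o\<^sub>L \<beta> u) = (u\<^sup>2 * (a * b)) *\<^sub>O \<beta> u"
      unfolding Q_def by (simp add: op_scale_compose_left op_scale_scale op_ident_square[OF \<beta>op])
    finally have "TrT (u *\<^sub>O ((P + (2 * u) *\<^sub>O Q) o\<^sub>L \<beta> u)) = TrT (\<beta> u) - TrT (ident T) + u\<^sup>2 * (a * b) * TrT (\<beta> u)"
      by (simp only: trT.add trT.diff TrT_scale)
    then have 2: "u * TrT ((P + (2 * u) *\<^sub>O Q) o\<^sub>L \<beta> u) = (1 + a * b * u\<^sup>2) * TrT (\<beta> u) - TrT (ident T)"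
      by (simp add: TrT_scale algebra_simps)
    note n = nz(1,2)[OF u(1)]
    have "u * (- TrS ((U + (2 * u) *\<^sub>O 0) o\<^sub>L W u) - \<kappa> * (b / (1 + b * u)) - - TrT ((P + (2 * u) *\<^sub>O Q) o\<^sub>L \<beta> u))
        = - (TrS (W u) - TrS (ident S)) - \<kappa> * (b * u) / (1 + b * u) + ((1 + a * b * u\<^sup>2) * TrT (\<beta> u) - TrT (ident T))"
      unfolding 1[symmetric] 2[symmetric] by (simp add: algebra_simps)
    also have "\<dots> = 0"
      unfolding trace_resolvent[OF \<beta> W n] \<kappa>_def using n(1) by (simp add: divide_simps) (simp add: algebra_simps)
    finally show ?thesis using u(2) by simp
  qed
  \<comment> \<open>A continuous function whose derivative vanishes on a convex set except at
    finitely many points is constant there; this deals with the excluded point 0.\<close>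
  have "\<Phi> u = 0" if u: "cmod u < \<epsilon>" for u
  proof (rule has_derivative_zero_unique_strong_convex[of "ball 0 \<epsilon>" "{0}" \<Phi> 0])
    show "continuous_on (ball 0 \<epsilon>) \<Phi>"
      by (intro continuous_at_imp_continuous_on ballI DERIV_isCont[OF d]) simp
    show "\<Phi> 0 = 0" by (simp add: \<Phi>_def op_scale_zero op_scale_zero_right log_series_zero trS.zero trT.zero)
    fix x :: complex assume x: "x \<in> ball 0 \<epsilon> - {0}"
    then have "(\<Phi> has_field_derivative 0) (at x)" using d[of x] zero[of x] by simp
    then show "(\<Phi> has_derivative (\<lambda>h. 0)) (at x within ball 0 \<epsilon>)"
      unfolding has_field_derivative_def mult_zero_left[abs_def] by (rule has_derivative_at_withinI)
  qed (use \<epsilon> u in auto)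
  then have "TrS (log_series S (u *\<^sub>O U)) = \<kappa> * Ln (1 + b * u) + TrT (log_series T (ident T - B u))"
    if "cmod u < \<epsilon>" for u
    using that unfolding \<Phi>_def IB by (simp add: op_scale_zero_right algebra_simps)
  moreover have "norm (u *\<^sub>O U) < r" "norm (ident T - B u) < r" if "cmod u < \<epsilon>" for u
    using smallU[OF that] smallB[OF that] r unfolding IB by (auto simp: op_scale_zero_right)
  ultimately show ?thesis using \<epsilon>(1) nz(1) unfolding U_def \<kappa>_def by blast
qed

end

end

subsection \<open>Periodic graphs\<close>

text \<open>Automorphisms are permutations of the whole type, so the group laws hold at every point.
  An arc stabilizer is finite because it fixes the initial vertex of the arc.\<close>

lemma
  assumes "periodic_graph V E \<Gamma> F0"
  shows periodic_graph_vertex_action: "proper_action \<Gamma> inv (\<circ>) id (\<lambda>\<gamma>. \<gamma>) V F0"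
    and periodic_graph_arc_action: "orbit_representatives arc_act \<Gamma> (arcs E) F1 \<Longrightarrow>
      proper_action \<Gamma> inv (\<circ>) id arc_act (arcs E) F1"
proof -
  note pg = assms[unfolded periodic_graph_def]
  have G: "id \<in> \<Gamma>" "\<And>\<gamma> \<delta>. \<gamma> \<in> \<Gamma> \<Longrightarrow> \<delta> \<in> \<Gamma> \<Longrightarrow> \<gamma> \<circ> \<delta> \<in> \<Gamma>" "\<And>\<gamma>. \<gamma> \<in> \<Gamma> \<Longrightarrow> inv \<gamma> \<in> \<Gamma>"
    and aut: "\<And>\<gamma>. \<gamma> \<in> \<Gamma> \<Longrightarrow> \<gamma> permutes V"
      "\<And>\<gamma> u v. \<gamma> \<in> \<Gamma> \<Longrightarrow> u \<in> V \<Longrightarrow> v \<in> V \<Longrightarrow> {\<gamma> u, \<gamma> v} \<in> E \<longleftrightarrow> {u, v} \<in> E"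
    using pg unfolding automorphism_group_def graph_automorphisms_def by blast+
  have bij: "bij \<gamma>" if "\<gamma> \<in> \<Gamma>" for \<gamma> using aut(1)[OF that] by (rule permutes_bij)
  have inv: "inv (inv \<gamma>) = \<gamma>" "\<gamma> \<circ> (inv \<gamma> \<circ> \<delta>) = \<delta>" "inv \<gamma> (\<gamma> x) = x" if "\<gamma> \<in> \<Gamma>" for \<gamma> \<delta> :: "'a \<Rightarrow> 'a" and x
    using bij[OF that] by (auto simp: inv_inv_eq bij_is_inj bij_is_surj surj_f_inv_f fun_eq_iff)
  have fin: "finite (stabilizer (\<lambda>\<gamma>. \<gamma>) \<Gamma> v)" if "v \<in> V" for v using pg that by blast
  have EV: "u \<in> V \<and> v \<in> V" if "(u, v) \<in> arcs E" for u v
    using pg that unfolding simple_graph_def arcs_def by (auto simp: doubleton_eq_iff)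
  show "proper_action \<Gamma> inv (\<circ>) id (\<lambda>\<gamma>. \<gamma>) V F0"
    by (unfold_locales) (use G inv fin pg aut(1) in \<open>auto simp: permutes_in_image\<close>)
  assume reps: "orbit_representatives arc_act \<Gamma> (arcs E) F1"
  show "proper_action \<Gamma> inv (\<circ>) id arc_act (arcs E) F1"
  proof
    fix x assume x: "x \<in> arcs E"
    obtain u v where uv: "x = (u, v)" by (cases x)
    show "arc_act \<gamma> x \<in> arcs E" if "\<gamma> \<in> \<Gamma>" for \<gamma>
      using x EV[of u v] aut(2)[OF that, of u v] unfolding uv arcs_def by simp
    have "stabilizer arc_act \<Gamma> x \<subseteq> stabilizer (\<lambda>\<gamma>. \<gamma>) \<Gamma> u" by (auto simp: uv stabilizer_def)
    then show "finite (stabilizer arc_act \<Gamma> x)" using fin[of u] EV[of u v] x uv finite_subset by blast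
  qed (use G inv reps in \<open>auto simp: prod.map_comp comp_def prod.map_ident\<close>)
qed

text \<open>Mass transport along the kernel \<open>k(v, e) = 1\<close> if the arc \<open>e\<close> starts at \<open>v\<close> turns the bounded
  degree and the finite covolume on vertices into finite covolume on arcs.\<close>

lemma periodic_graph_arc_weights:
  assumes pg: "periodic_graph V E \<Gamma> F0" and reps: "orbit_representatives arc_act \<Gamma> (arcs E) F1"
  shows "proper_action.weight \<Gamma> arc_act summable_on F1"
proof -
  note VA = periodic_graph_vertex_action[OF pg] and RA = periodic_graph_arc_action[OF pg reps]
  interpret A: proper_action \<Gamma> inv "(\<circ>)" id "\<lambda>\<gamma>. \<gamma>" V F0 by (rule VA)
  interpret B: proper_action \<Gamma> inv "(\<circ>)" id arc_act "arcs E" F1 by (rule RA)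
  define k :: "'a \<Rightarrow> 'a \<times> 'a \<Rightarrow> complex" where "k v x = (if fst x = v then 1 else 0)" for v x
  obtain N where N: "\<And>v. v \<in> V \<Longrightarrow> finite {w. {v, w} \<in> E} \<and> card {w. {v, w} \<in> E} \<le> N"
    using pg unfolding periodic_graph_def by blast
  have sm0: "A.weight summable_on F0"
    using pg unfolding periodic_graph_def A.weight_def[abs_def] by blast
  have out: "finite {x \<in> arcs E. fst x = v}" "real (card {x \<in> arcs E. fst x = v}) \<le> real N" if "v \<in> V" for v
  proof -
    have e: "{x \<in> arcs E. fst x = v} = Pair v ` {w. {v, w} \<in> E}" by (auto simp: arcs_def)
    show "finite {x \<in> arcs E. fst x = v}" unfolding e using N[OF that] by blast
    have "card {x \<in> arcs E. fst x = v} \<le> card {w. {v, w} \<in> E}" unfolding e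
      by (rule card_image_le) (use N[OF that] in blast)
    then show "real (card {x \<in> arcs E. fst x = v}) \<le> real N" using N[OF that] by simp
  qed
  have row: "((\<lambda>x. norm (k v x)) has_sum real (card {x \<in> arcs E. fst x = v})) (arcs E)" if "v \<in> V" for v
  proof -
    have "((\<lambda>x. norm (k v x)) has_sum (\<Sum>x\<in>{x \<in> arcs E. fst x = v}. norm (k v x))) {x \<in> arcs E. fst x = v}"
      by (rule has_sum_finite[OF out(1)[OF that]])
    also have "?this \<longleftrightarrow> ((\<lambda>x. norm (k v x)) has_sum (\<Sum>x\<in>{x \<in> arcs E. fst x = v}. norm (k v x))) (arcs E)"
      by (rule has_sum_cong_neutral) (auto simp: k_def)
    finally show ?thesis by (simp add: k_def)
  qed
  have col: "((\<lambda>v. norm (k v x)) has_sum 1) V" if "x \<in> arcs E" for x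
  proof -
    have xV: "fst x \<in> V"
    proof -
      obtain u v where uv: "x = (u, v)" by (cases x)
      then have "{u, v} \<in> E" using that by (simp add: arcs_def)
      then show ?thesis using pg uv unfolding periodic_graph_def simple_graph_def
        by (auto simp: doubleton_eq_iff)
    qed
    have "((\<lambda>v. norm (k v x)) has_sum (\<Sum>v\<in>{fst x}. norm (k v x))) {fst x}" by (rule has_sum_finite) simp
    also have "?this \<longleftrightarrow> ((\<lambda>v. norm (k v x)) has_sum (\<Sum>v\<in>{fst x}. norm (k v x))) V"
      by (rule has_sum_cong_neutral) (auto simp: k_def xV)
    finally show ?thesis by (simp add: k_def)
  qed
  \<comment> \<open>Every arc has exactly one initial vertex, so the inner sum is 1 and this is
    summability of the arc weights themselves.\<close>
  have "(\<lambda>y. B.weight y * (\<Sum>\<^sub>\<infinity>x\<in>V. norm (k x y))) summable_on F1"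
  proof (rule mass_transport(2)[OF VA RA])
    show "k (\<gamma> v) (arc_act \<gamma> x) = k v x" if "\<gamma> \<in> \<Gamma>" for \<gamma> v x
      using A.act_inverse[OF that] unfolding k_def by (metis fst_map_prod)
    show "k v abs_summable_on arcs E" if "v \<in> V" for v using row[OF that] by (auto simp: summable_on_def)
    show "(\<lambda>v. k v x) abs_summable_on V" if "x \<in> arcs E" for x using col[OF that] by (auto simp: summable_on_def)
    show "(\<lambda>v. A.weight v * (\<Sum>\<^sub>\<infinity>x\<in>arcs E. norm (k v x))) summable_on F0"
    proof (rule Infinite_Sum.abs_summable_summable, rule Infinite_Sum.abs_summable_on_comparison_test')
      show "(\<lambda>v. real N * A.weight v) summable_on F0" by (rule summable_on_cmult_right[OF sm0])
      fix v assume "v \<in> F0"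
      then have v: "v \<in> V" using A.F_subset by blast
      show "norm (A.weight v * (\<Sum>\<^sub>\<infinity>x\<in>arcs E. norm (k v x))) \<le> real N * A.weight v"
        unfolding infsumI[OF row[OF v]]
        using mult_left_mono[OF out(2)[OF v] A.weight_nonneg[of v]] by (simp add: A.weight_nonneg mult.commute)
    qed
  qed
  then show ?thesis
    by (rule summable_on_cong[THEN iffD1, rotated]) (use B.F_subset col in \<open>auto simp: infsumI\<close>)
qed

theorem theorem6:
  fixes V :: "'v set" and E :: "'v set set" and \<Gamma> :: "('v \<Rightarrow> 'v) set"
    and F0 :: "'v set" and F1 R :: "('v \<times> 'v) set"
    and d1 d2 :: "('v \<times> 'v) ell2 \<Rightarrow>\<^sub>L 'v ell2"
    and C1 C2 U :: "('v \<times> 'v) ell2 \<Rightarrow>\<^sub>L ('v \<times> 'v) ell2"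
    and a2 b2 c2 :: complex
    and D :: "complex set" and L :: "complex \<Rightarrow> complex"
  assumes "periodic_graph V E \<Gamma> F0"
    and "R = arcs E"
    and "orbit_representatives arc_act \<Gamma> R F1"
    and "d1 \<in> operators R V" and "equivariant \<Gamma> d1" and "d1 o\<^sub>L adj d1 = ident V"
    and "d2 \<in> operators R V" and "equivariant \<Gamma> d2" and "d2 o\<^sub>L adj d2 = ident V"
    and "c2 = a2 - b2"
    and "C1 = (adj d1 o\<^sub>L d1) - (ident R - (adj d1 o\<^sub>L d1))"
    and "C2 = a2 *\<^sub>O (adj d2 o\<^sub>L d2) + b2 *\<^sub>O (ident R - (adj d2 o\<^sub>L d2))"
    and "U = C1 o\<^sub>L C2"
    and "log_branch D L" and "1 \<in> D" and "L 1 = 0"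
  shows "\<exists>\<epsilon>>0. \<forall>u :: complex. cmod u < \<epsilon> \<longrightarrow>
    (let A = ident R - u *\<^sub>O U;
         B = ((1 + a2 * u) * (1 - b2 * u)) *\<^sub>O ident V
             - (2 * c2 * u) *\<^sub>O (d2 o\<^sub>L adj d1 o\<^sub>L d1 o\<^sub>L adj d2)
     in (\<exists>X. is_op_log R D L A X) \<and> (\<exists>Y. is_op_log V D L B Y) \<and>
        Gamma_det arc_act \<Gamma> F1 R D L A =
          (1 + b2 * u) powr (Gamma_trace arc_act \<Gamma> F1 (ident R)
                             - 2 * Gamma_trace vertex_act \<Gamma> F0 (ident V)) *
          Gamma_det vertex_act \<Gamma> F0 V D L B)"
proof -
  note pg = assms(1) and R = assms(2) and br = assms(14,15,16)
  have reps: "orbit_representatives arc_act \<Gamma> (arcs E) F1" using assms(2,3) by simp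
  interpret two_coisometries R V d1 d2 a2 b2
    using assms(4,6,7,9) by unfold_locales
  note RA = periodic_graph_arc_action[OF pg reps, folded R] and VA = periodic_graph_vertex_action[OF pg]
  note eq = assms(5,8)[unfolded equivariant_def, folded intertwines_def]
  have smV: "proper_action.weight \<Gamma> (\<lambda>\<gamma>. \<gamma>) summable_on F0"
    using pg unfolding periodic_graph_def proper_action.weight_def[OF VA, abs_def] by blast
  note smR = periodic_graph_arc_weights[OF pg reps]
  have "open D" using br(1) by (simp add: log_branch_def)
  then obtain r0 where r0: "r0 > 0" "cball 1 r0 \<subseteq> D" using br(2) open_contains_cball by blast
  \<comment> \<open>The disk must fit into D for the contour argument, and its radius must stay
    below 1 for the power series.\<close>
  define r where "r = min r0 (1 / 2)"
  have r: "0 < r" "r < 1" "cball 1 r \<subseteq> D" using r0 unfolding r_def by auto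
  have U: "U = J o\<^sub>L C" using assms(11-13) by (simp add: J_def C_def)
  have B: "((1 + a2 * u) * (1 - b2 * u)) *\<^sub>O ident V
      - (2 * c2 * u) *\<^sub>O (d2 o\<^sub>L adj d1 o\<^sub>L d1 o\<^sub>L adj d2) = B u" for u
    unfolding B_def H_def assms(10) ..
  obtain \<epsilon> where \<epsilon>: "\<epsilon> > 0" and main: "\<And>u. cmod u < \<epsilon> \<Longrightarrow> norm (u *\<^sub>O U) < r \<and> norm (ident V - B u) < r \<and>
      1 + b2 * u \<noteq> 0 \<and> Gamma_trace arc_act \<Gamma> F1 (log_series R (u *\<^sub>O U))
      = (Gamma_trace arc_act \<Gamma> F1 (ident R) - 2 * Gamma_trace (\<lambda>\<gamma>. \<gamma>) \<Gamma> F0 (ident V)) * Ln (1 + b2 * u)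
        + Gamma_trace (\<lambda>\<gamma>. \<gamma>) \<Gamma> F0 (log_series V (ident V - B u))"
    using log_traces[OF RA VA eq smR smV r(1,2)] unfolding U by blast
  show ?thesis
  proof (intro exI[of _ \<epsilon>] conjI \<epsilon> allI impI)
    fix u assume "cmod u < \<epsilon>"
    note m = main[OF this]
    have Uop: "u *\<^sub>O U \<in> operators R R" unfolding U by (intro operators_scale operators_compose[OF J_op C_op])
    have Bop: "ident V - B u \<in> operators V V"
      unfolding B_def by (intro operators_diff operators_scale operators_ident H_op)
    have logA: "is_op_log R D L (ident R - u *\<^sub>O U) (log_series R (u *\<^sub>O U))"
      by (rule is_op_log_series[OF br(1,3) r(3,2) Uop]) (use m in blast)
    have logB: "is_op_log V D L (B u) (log_series V (ident V - B u))"
      using is_op_log_series[OF br(1,3) r(3,2) Bop] m by simp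
    have det: "Gamma_det arc_act \<Gamma> F1 R D L (ident R - u *\<^sub>O U) =
          (1 + b2 * u) powr (Gamma_trace arc_act \<Gamma> F1 (ident R) - 2 * Gamma_trace vertex_act \<Gamma> F0 (ident V)) *
          Gamma_det vertex_act \<Gamma> F0 V D L (B u)"
      unfolding Gamma_det_def op_log_eq[OF logA] op_log_eq[OF logB] powr_def
      using m by (simp add: exp_add)
    show "let A = ident R - u *\<^sub>O U;
         B = ((1 + a2 * u) * (1 - b2 * u)) *\<^sub>O ident V
             - (2 * c2 * u) *\<^sub>O (d2 o\<^sub>L adj d1 o\<^sub>L d1 o\<^sub>L adj d2)
     in (\<exists>X. is_op_log R D L A X) \<and> (\<exists>Y. is_op_log V D L B Y) \<and>
        Gamma_det arc_act \<Gamma> F1 R D L A =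
          (1 + b2 * u) powr (Gamma_trace arc_act \<Gamma> F1 (ident R)
                             - 2 * Gamma_trace vertex_act \<Gamma> F0 (ident V)) *
          Gamma_det vertex_act \<Gamma> F0 V D L B"
      unfolding Let_def B using logA logB det by blast
  qed
qed

end
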